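(* $\mathbf{PCW}\subseteq\mathbf{PTW}$.
   Context: Decision problems are identified with languages over $\Sigma=\{0,1\}$ under a standard encoding; $A\leq_P B$ means that $A$ is many-one reducible to $B$ in polynomial time. $\Vert$ denotes concatenation of bit strings. Circuit outputs are interpreted as numbers written in binary. $\operatorname{sgn}$ is the sign function with values in $\{-1,0,1\}$. The problem Weak-Tournament-Source: the input is a Boolean circuit $C\colon\{0,1\}^{2n}\to\{0,1\}$; the question is whether there exists $x\in\{0,1\}^n$ such that for all $y\in\{0,1\}^n$ with $y\neq x$ we have $C(x\Vert y)=1$ and $C(y\Vert x)=0$. The problem Ckt-Condorcet: the input is a sequence of Boolean circuits $\langle C_1,\dots,C_m\rangle$, each with $n$ inputs and $n$ outputs; the question is whether there exists $x\in\{0,1\}^n$ such that for all $y\in\{0,1\}^n$ with $y\neq x$ we have $\sum_{i=1}^m\operatorname{sgn}(C_i(x)-C_i(y))>0$. $\mathbf{PTW}=\{L\subseteq\Sigma^*: L\leq_P \text{Weak-Tournament-Source}\}$ and $\mathbf{PCW}=\{L\subseteq\Sigma^*: L\leq_P\text{Ckt-Condorcet}\}$. *)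

theory Defs
  imports Main "HOL-Computational_Algebra.Polynomial"
begin

section \<open>Polynomial-time many-one reducibility\<close>

text \<open>
  Deterministic multi-tape Turing machines with two-way infinite tapes. A machine has a finite set of
  states and a finite tape alphabet containing the blank and the two input symbols; \<open>Aux\<close>
  supplies further tape symbols.
\<close>

type_synonym lang = "bool list set"

datatype symbol = Blank | Bit bool | Aux nat

datatype dir = Move_Left | Stay | Move_Right

record tm =
  tm_tapes :: nat
  tm_states :: "nat set"
  tm_alphabet :: "symbol set"
  tm_start :: nat
  tm_halt :: nat
  tm_delta :: "nat \<Rightarrow> symbol list \<Rightarrow> nat \<times> (symbol \<times> dir) list"

definition wf_tm :: "tm \<Rightarrow> bool" where
  "wf_tm M \<longleftrightarrow>
     tm_tapes M \<ge> 1 \<and>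
     finite (tm_states M) \<and> tm_start M \<in> tm_states M \<and> tm_halt M \<in> tm_states M \<and>
     finite (tm_alphabet M) \<and> {Blank, Bit False, Bit True} \<subseteq> tm_alphabet M \<and>
     (\<forall>q ss q' acts.
        q \<in> tm_states M \<longrightarrow> q \<noteq> tm_halt M \<longrightarrow>
        length ss = tm_tapes M \<longrightarrow> set ss \<subseteq> tm_alphabet M \<longrightarrow>
        tm_delta M q ss = (q', acts) \<longrightarrow>
          q' \<in> tm_states M \<and> length acts = tm_tapes M \<and> fst ` set acts \<subseteq> tm_alphabet M)"

text \<open>A tape is its contents together with the position of the head.\<close>

type_synonym tape = "(int \<Rightarrow> symbol) \<times> int"

type_synonym config = "nat \<times> tape list"

definition tape_read :: "tape \<Rightarrow> symbol" where
  "tape_read tp = fst tp (snd tp)"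

fun dir_offset :: "dir \<Rightarrow> int" where
  "dir_offset Move_Left = - 1"
| "dir_offset Stay = 0"
| "dir_offset Move_Right = 1"

definition tape_act :: "symbol \<times> dir \<Rightarrow> tape \<Rightarrow> tape" where
  "tape_act a tp = ((fst tp)(snd tp := fst a), snd tp + dir_offset (snd a))"

definition tm_step :: "tm \<Rightarrow> config \<Rightarrow> config" where
  "tm_step M c =
     (if fst c = tm_halt M then c
      else (case tm_delta M (fst c) (map tape_read (snd c)) of
              (q', acts) \<Rightarrow> (q', map2 tape_act acts (snd c))))"

definition tape_of :: "bool list \<Rightarrow> tape" where
  "tape_of w = (\<lambda>i. if 0 \<le> i \<and> i < int (length w) then Bit (w ! nat i) else Blank, 0)"

definition tm_init :: "tm \<Rightarrow> bool list \<Rightarrow> config" where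
  "tm_init M w = (tm_start M, tape_of w # replicate (tm_tapes M - 1) (tape_of []))"

text \<open>
  The first tape serves for input and output: the machine has to halt with exactly the output word
  on it and the head back on cell 0. The contents of the other tapes are irrelevant.
\<close>

definition polytime_computable :: "(bool list \<Rightarrow> bool list) \<Rightarrow> bool" where
  "polytime_computable f \<longleftrightarrow>
     (\<exists>M (p :: nat poly). wf_tm M \<and>
        (\<forall>w. \<exists>t \<le> poly p (length w). \<exists>tps.
           (tm_step M ^^ t) (tm_init M w) = (tm_halt M, tape_of (f w) # tps)))"

definition poly_reducible :: "lang \<Rightarrow> lang \<Rightarrow> bool"  (infix "\<le>\<^sub>P" 50) where
  "A \<le>\<^sub>P B \<longleftrightarrow> (\<exists>f. polytime_computable f \<and> (\<forall>w. w \<in> A \<longleftrightarrow> f w \<in> B))"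


section \<open>Boolean circuits\<close>

text \<open>
  A circuit is a list of gates in topological order. The operands of \<open>Not\<close>,
  \<open>And\<close>, \<open>Or\<close> are positions of earlier gates in that list,
  \<open>In i\<close> reads input bit \<open>i\<close>, and the output bits are the values of the gates
  listed in \<open>outputs\<close>.
\<close>

datatype gate = In nat | Const bool | Not nat | And nat nat | Or nat nat

record circuit =
  num_inputs :: nat
  gates :: "gate list"
  outputs :: "nat list"

fun wf_gate :: "nat \<Rightarrow> nat \<Rightarrow> gate \<Rightarrow> bool" where
  "wf_gate n k (In i) \<longleftrightarrow> i < n"
| "wf_gate n k (Const b) \<longleftrightarrow> True"
| "wf_gate n k (Not i) \<longleftrightarrow> i < k"
| "wf_gate n k (And i j) \<longleftrightarrow> i < k \<and> j < k"
| "wf_gate n k (Or i j) \<longleftrightarrow> i < k \<and> j < k"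

definition wf_circuit :: "circuit \<Rightarrow> bool" where
  "wf_circuit C \<longleftrightarrow>
     (\<forall>k < length (gates C). wf_gate (num_inputs C) k (gates C ! k)) \<and>
     (\<forall>k \<in> set (outputs C). k < length (gates C))"

fun gate_val :: "bool list \<Rightarrow> bool list \<Rightarrow> gate \<Rightarrow> bool" where
  "gate_val x vs (In i) = x ! i"
| "gate_val x vs (Const b) = b"
| "gate_val x vs (Not i) = (\<not> vs ! i)"
| "gate_val x vs (And i j) = (vs ! i \<and> vs ! j)"
| "gate_val x vs (Or i j) = (vs ! i \<or> vs ! j)"

definition gate_vals :: "bool list \<Rightarrow> gate list \<Rightarrow> bool list" where
  "gate_vals x gs = foldl (\<lambda>vs g. vs @ [gate_val x vs g]) [] gs"

definition eval_circuit :: "circuit \<Rightarrow> bool list \<Rightarrow> bool list" where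
  "eval_circuit C x = map ((!) (gate_vals x (gates C))) (outputs C)"

definition is_circuit :: "nat \<Rightarrow> nat \<Rightarrow> circuit \<Rightarrow> bool" where
  "is_circuit n m C \<longleftrightarrow> wf_circuit C \<and> num_inputs C = n \<and> length (outputs C) = m"

text \<open>Most significant bit first; \<open>horner_sum\<close> itself is least significant bit first.\<close>

definition binary_value :: "bool list \<Rightarrow> int" where
  "binary_value bs = horner_sum of_bool 2 (rev bs)"


section \<open>Encoding of circuits as bit strings\<close>

text \<open>
  Numbers are encoded in unary. They are gate positions, input positions and numbers of inputs, so
  this is polynomially related to binary indices in the usual encodings, where a circuit has at
  least the size of its number of inputs. All encodings below are prefix-free.
\<close>

definition enc_nat :: "nat \<Rightarrow> bool list" where
  "enc_nat k = replicate k True @ [False]"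

definition enc_list :: "('a \<Rightarrow> bool list) \<Rightarrow> 'a list \<Rightarrow> bool list" where
  "enc_list e xs = concat (map (\<lambda>x. True # e x) xs) @ [False]"

fun enc_gate :: "gate \<Rightarrow> bool list" where
  "enc_gate (In i) = [False, False, False] @ enc_nat i"
| "enc_gate (Const b) = [False, False, True, b]"
| "enc_gate (Not i) = [False, True, False] @ enc_nat i"
| "enc_gate (And i j) = [False, True, True] @ enc_nat i @ enc_nat j"
| "enc_gate (Or i j) = [True, False, False] @ enc_nat i @ enc_nat j"

definition enc_circuit :: "circuit \<Rightarrow> bool list" where
  "enc_circuit C = enc_nat (num_inputs C) @ enc_list enc_gate (gates C) @ enc_list enc_nat (outputs C)"

lemma enc_nat_prefix_free: "enc_nat a @ u = enc_nat b @ v \<Longrightarrow> a = b \<and> u = v"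
proof (induction a arbitrary: b)
  case 0
  then show ?case by (cases b) (auto simp: enc_nat_def)
next
  case (Suc a)
  then show ?case by (cases b) (auto simp: enc_nat_def)
qed

lemma enc_list_prefix_free:
  assumes "\<And>a b u v. e a @ u = e b @ v \<Longrightarrow> a = b \<and> u = v"
  shows "enc_list e xs @ u = enc_list e ys @ v \<Longrightarrow> xs = ys \<and> u = v"
proof (induction xs arbitrary: ys)
  case Nil
  then show ?case by (cases ys) (auto simp: enc_list_def)
next
  case (Cons x xs)
  then show ?case
  proof (cases ys)
    case (Cons y ys')
    with Cons.prems have "e x @ (enc_list e xs @ u) = e y @ (enc_list e ys' @ v)"
      by (simp add: enc_list_def)
    from assms[OF this] Cons.IH[of ys'] Cons show ?thesis by simp
  qed (auto simp: enc_list_def)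
qed

lemma enc_gate_prefix_free: "enc_gate g @ u = enc_gate h @ v \<Longrightarrow> g = h \<and> u = v"
  by (cases g; cases h) (auto dest!: enc_nat_prefix_free)

lemma enc_circuit_prefix_free:
  assumes "enc_circuit C @ u = enc_circuit D @ v"
  shows "C = D \<and> u = v"
proof -
  from assms have "num_inputs C = num_inputs D"
    and 1: "enc_list enc_gate (gates C) @ (enc_list enc_nat (outputs C) @ u)
          = enc_list enc_gate (gates D) @ (enc_list enc_nat (outputs D) @ v)"
    by (auto simp: enc_circuit_def dest: enc_nat_prefix_free)
  moreover have "gates C = gates D"
    and 2: "enc_list enc_nat (outputs C) @ u = enc_list enc_nat (outputs D) @ v"
    using enc_list_prefix_free[OF _ 1] enc_gate_prefix_free by blast+
  moreover have "outputs C = outputs D" "u = v"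
    using enc_list_prefix_free[OF _ 2] enc_nat_prefix_free by blast+
  ultimately show ?thesis by simp
qed

lemma inj_enc_circuit: "inj enc_circuit"
  using enc_circuit_prefix_free[where u = "[]" and v = "[]"] by (auto intro: injI)

lemma inj_enc_circuits: "inj (enc_list enc_circuit)"
proof (rule injI)
  fix Cs Ds
  assume "enc_list enc_circuit Cs = enc_list enc_circuit Ds"
  then have "enc_list enc_circuit Cs @ [] = enc_list enc_circuit Ds @ []" by simp
  from enc_list_prefix_free[OF _ this] enc_circuit_prefix_free show "Cs = Ds" by blast
qed


section \<open>The two problems and their classes\<close>

definition Weak_Tournament_Source :: lang where
  "Weak_Tournament_Source =
     {enc_circuit C | C n. is_circuit (2 * n) 1 C \<and>
        (\<exists>x. length x = n \<and>
           (\<forall>y. length y = n \<and> y \<noteq> x \<longrightarrow>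
              eval_circuit C (x @ y) = [True] \<and> eval_circuit C (y @ x) = [False]))}"

text \<open>
  The sequence of circuits is nonempty, since otherwise it would not determine the common number
  \<open>n\<close> of inputs.
\<close>

definition Ckt_Condorcet :: lang where
  "Ckt_Condorcet =
     {enc_list enc_circuit Cs | Cs n. Cs \<noteq> [] \<and> (\<forall>C \<in> set Cs. is_circuit n n C) \<and>
        (\<exists>x. length x = n \<and>
           (\<forall>y. length y = n \<and> y \<noteq> x \<longrightarrow>
              (\<Sum>i < length Cs. sgn (binary_value (eval_circuit (Cs ! i) x)
                                   - binary_value (eval_circuit (Cs ! i) y))) > 0))}"

definition PTW :: "lang set" where
  "PTW = {L. L \<le>\<^sub>P Weak_Tournament_Source}"

definition PCW :: "lang set" where
  "PCW = {L. L \<le>\<^sub>P Ckt_Condorcet}"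

end

theory Submission imports Defs begin

text \<open>
  Let \<open>C(x, y) = 1\<close> iff the sum of the \<open>sgn (C\<^sub>i(x) - C\<^sub>i(y))\<close> is positive. This sum is
  antisymmetric in \<open>x\<close> and \<open>y\<close>, so that the Condorcet winners of
  \<open>C\<^sub>1, \<dots>, C\<^sub>m\<close> are exactly the sources of \<open>C\<close>. Since
  \<open>sgn (u - v) + 1 = [u > v] + [u \<ge> v]\<close>, the circuit \<open>C\<close> has to decide whether more than
  \<open>m\<close> out of \<open>2 * m\<close> comparison bits are set; it counts them by dynamic programming.

  That \<open>C\<close> can be constructed in polynomial time is reduced to closure properties. Functions
  between types whose elements are coded as bit strings are computed by while programs that use each
  tape as a stack, and these compile to Turing machines. The functions with polynomial bounds on time
  and output size are closed under composition, pairing, case distinction and iteration with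
  polynomially bounded intermediate results, which yields the usual operations on lists and on unary
  numbers, and with these a parser, a validity check and the construction of \<open>C\<close>.
\<close>

section \<open>Composition of polynomial-time computable functions\<close>

text \<open>One reduction between the two problems yields the inclusion of the classes because
  reducibility is transitive. The reduction prefixed to it is an arbitrary polynomial-time function,
  given only by some Turing machine; hence composition has to be proved for machines and not merely
  for programs.

  The closure properties are shaped by iteration. A step that doubles its argument runs in
  polynomial time, but its iterates do not stay polynomial. So size bounds are carried along with
  time bounds, and a loop asks for a bound on all its intermediate results. Mostly this comes from
  steps that enlarge the accumulator by an amount independent of its size; where that fails, as in
  the list parser, the bound needs its own argument.

  A reduction is total. Words that encode no valid circuit list are sent to the empty word, which
  encodes no circuit. Therefore the parser has to recognise exactly the encodings instead of only
  inverting them.\<close>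

lemma poly_mono_nat: "m \<le> n \<Longrightarrow> poly p m \<le> poly (p :: nat poly) n"
  by (induction p) (auto intro!: add_mono mult_mono)

lemma tape_act_stay [simp]: "tape_act (tape_read tp, Stay) tp = tp"
  by (simp add: tape_act_def tape_read_def)

section \<open>How far a machine can write\<close>

definition blank_beyond :: "int \<Rightarrow> tape \<Rightarrow> bool" where
  "blank_beyond N tp \<longleftrightarrow> snd tp \<le> N \<and> (\<forall>i>N. fst tp i = Blank)"

text \<open>Only the cell under the head is written, so the bound must cover the head position as
  well to be preserved; it rises by one because the head may move right.\<close>

lemma blank_beyond_act: "blank_beyond N tp \<Longrightarrow> blank_beyond (N + 1) (tape_act a tp)"
  by (cases "snd a") (auto simp: blank_beyond_def tape_act_def)

lemma blank_beyond_step: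
  assumes "\<forall>tp \<in> set (snd c). blank_beyond N tp"
  shows "\<forall>tp \<in> set (snd (tm_step M c)). blank_beyond (N + 1) tp"
proof -
  have "blank_beyond N tp \<Longrightarrow> blank_beyond (N + 1) tp" for tp
    by (auto simp: blank_beyond_def)
  then show ?thesis
    using assms
    by (auto simp: tm_step_def blank_beyond_act split: prod.splits dest!: set_zip_rightD)
qed

lemma blank_beyond_steps:
  "\<forall>tp \<in> set (snd c). blank_beyond N tp \<Longrightarrow> \<forall>tp \<in> set (snd ((tm_step M ^^ t) c)). blank_beyond (N + int t) tp"
proof (induction t)
  case (Suc t)
  then show ?case
    using blank_beyond_step[of "(tm_step M ^^ t) c" "N + int t" M] by (simp add: algebra_simps)
qed simp

text \<open>For composition: the second machine is timed in the length of its input, which is the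
  output of the first. The written region extends by at most one cell per step.\<close>

lemma output_length_le:
  assumes "(tm_step M ^^ t) (tm_init M w) = (q, tape_of v # tps)"
  shows "length v \<le> length w + t + 1"
proof -
  have "\<forall>tp \<in> set (snd (tm_init M w)). blank_beyond (int (length w)) tp"
    by (auto simp: tm_init_def blank_beyond_def tape_of_def)
  from blank_beyond_steps[OF this, where M = M and t = t] assms
  have "fst (tape_of v) i = Blank" if "i > int (length w) + int t" for i
    using that by (auto simp: blank_beyond_def)
  \<comment> \<open>This cell is blank, so \<open>v\<close> must end before it.\<close>
  from this[of "int (length w + t + 1)"] show ?thesis
    by (auto simp: tape_of_def split: if_splits)
qed

text \<open>\<open>wf_tm\<close> restricts the transition function only on states and symbols of the
  machine. That the number of actions equals the number of tapes is therefore available in valid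
  configurations only.\<close>

definition valid_config :: "tm \<Rightarrow> config \<Rightarrow> bool" where
  "valid_config M c \<longleftrightarrow> fst c \<in> tm_states M \<and> length (snd c) = tm_tapes M \<and>
     (\<forall>tp \<in> set (snd c). range (fst tp) \<subseteq> tm_alphabet M)"

lemma valid_config_read:
  "valid_config M c \<Longrightarrow> set (map tape_read (snd c)) \<subseteq> tm_alphabet M"
  by (auto simp: valid_config_def tape_read_def)

lemma valid_config_step:
  assumes M: "wf_tm M" and c: "valid_config M c"
  shows "valid_config M (tm_step M c)"
proof (cases "fst c = tm_halt M")
  case False
  obtain q' acts where d: "tm_delta M (fst c) (map tape_read (snd c)) = (q', acts)"
    by fastforce
  have s: "q' \<in> tm_states M" "length acts = tm_tapes M" "fst ` set acts \<subseteq> tm_alphabet M"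
    using M c False d valid_config_read[OF c]
    unfolding wf_tm_def valid_config_def by (metis length_map)+
  have "range (fst tp) \<subseteq> tm_alphabet M" if tp: "tp \<in> set (map2 tape_act acts (snd c))" for tp
  proof -
    obtain a tp' where "(a, tp') \<in> set (zip acts (snd c))" and tp: "tp = tape_act a tp'"
      using tp by auto
    then have "a \<in> set acts" "tp' \<in> set (snd c)"
      by (auto dest: set_zip_leftD set_zip_rightD)
    then show ?thesis
      using s c unfolding tp valid_config_def tape_act_def by (fastforce simp: image_subset_iff)
  qed
  then show ?thesis
    using s c False d by (auto simp: valid_config_def tm_step_def)
qed (use c in \<open>auto simp: tm_step_def\<close>)

lemma valid_config_init: "wf_tm M \<Longrightarrow> valid_config M (tm_init M w)"
  by (auto simp: valid_config_def tm_init_def wf_tm_def tape_of_def)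
     (metis (full_types) insert_subset)

lemma tm_steps_halted: "fst c = tm_halt M \<Longrightarrow> (tm_step M ^^ t) c = c"
  by (induction t) (auto simp: tm_step_def)

section \<open>Running one machine after another\<close>

abbreviation stay :: "symbol list \<Rightarrow> (symbol \<times> dir) list" where
  "stay \<equiv> map (\<lambda>s. (s, Stay))"

lemma map2_stay [simp]: "map2 tape_act (map ((\<lambda>s. (s, Stay)) \<circ> tape_read) tps) tps = tps"
  by (induction tps) auto

text \<open>
  The composed machine has the tapes of \<open>M\<close> followed by the work tapes of \<open>N\<close>,
  which are still blank when \<open>N\<close> starts. Its states are the states of \<open>M\<close>
  (even) and of \<open>N\<close> (odd). The alphabet tests are only there for well-formedness.
\<close>

definition tm_comp :: "tm \<Rightarrow> tm \<Rightarrow> tm" where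
  "tm_comp M N = \<lparr>
     tm_tapes = tm_tapes M + tm_tapes N - 1,
     tm_states = (\<lambda>q. 2 * q) ` tm_states M \<union> (\<lambda>q. 2 * q + 1) ` tm_states N,
     tm_alphabet = tm_alphabet M \<union> tm_alphabet N,
     tm_start = 2 * tm_start M,
     tm_halt = 2 * tm_halt N + 1,
     tm_delta = (\<lambda>q ss.
       let k = tm_tapes M; as = take k ss; bs = drop k ss in
       if even q then
         if q div 2 = tm_halt M then (2 * tm_start N + 1, stay ss)
         else if set as \<subseteq> tm_alphabet M then
           (case tm_delta M (q div 2) as of (q', acts) \<Rightarrow> (2 * q', acts @ stay bs))
         else (q, stay ss)
       else
         if set (hd as # bs) \<subseteq> tm_alphabet N then
           (case tm_delta N (q div 2) (hd as # bs) of (q', acts) \<Rightarrow>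
              (2 * q' + 1, hd acts # stay (tl as) @ tl acts))
         else (q, stay ss)) \<rparr>"

lemma wf_tm_comp:
  assumes M: "wf_tm M" and N: "wf_tm N"
  shows "wf_tm (tm_comp M N)"
proof -
  have kM: "tm_tapes M \<ge> 1" and kN: "tm_tapes N \<ge> 1"
    using M N by (auto simp: wf_tm_def)
  have "q' \<in> tm_states (tm_comp M N) \<and> length acts = tm_tapes (tm_comp M N) \<and>
      fst ` set acts \<subseteq> tm_alphabet (tm_comp M N)"
    if q: "q \<in> tm_states (tm_comp M N)" and nh: "q \<noteq> tm_halt (tm_comp M N)"
      and len: "length ss = tm_tapes (tm_comp M N)" and alph: "set ss \<subseteq> tm_alphabet (tm_comp M N)"
      and d: "tm_delta (tm_comp M N) q ss = (q', acts)" for q ss q' acts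
  proof -
    define as bs where "as = take (tm_tapes M) ss" and "bs = drop (tm_tapes M) ss"
    have ss: "ss = as @ bs"
      by (simp add: as_def bs_def)
    have las: "length as = tm_tapes M" and lbs: "length bs = tm_tapes N - 1"
      using len kM kN by (auto simp: as_def bs_def tm_comp_def)
    have "as \<noteq> []"
      using las kM by auto
    then obtain a as' where as: "as = a # as'"
      by (cases as) auto
    \<comment> \<open>This covers the jump from \<open>M\<close> to \<open>N\<close> and the
      branches in which an alphabet test fails; none of them changes a symbol.\<close>
    have stay: ?thesis if "q' \<in> tm_states (tm_comp M N)" "acts = stay ss"
      using that len alph by (auto simp: image_image)
    note d' = d[unfolded tm_comp_def tm.simps Let_def, folded as_def bs_def]
    show ?thesis
    proof (cases "even q")
      case True
      then obtain p where p: "q = 2 * p" "p \<in> tm_states M"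
        using q by (auto simp: tm_comp_def)
      show ?thesis
      proof (cases "p \<noteq> tm_halt M \<and> set as \<subseteq> tm_alphabet M")
        case False
        then show ?thesis
          using d' p N q by (intro stay) (auto simp: tm_comp_def wf_tm_def split: if_splits)
      next
        case True
        obtain p' acts' where e: "tm_delta M p as = (p', acts')"
          by fastforce
        then have "p' \<in> tm_states M" "length acts' = tm_tapes M" "fst ` set acts' \<subseteq> tm_alphabet M"
          using M True p(2) las unfolding wf_tm_def by metis+
        moreover have "q' = 2 * p'" "acts = acts' @ stay bs"
          using d' e True p by auto
        moreover have "fst ` set (acts' @ stay bs) = fst ` set acts' \<union> set bs"
          by (simp add: image_Un image_image)
        ultimately show ?thesis
          using alph lbs ss kN by (auto simp: tm_comp_def)
      qed
    next
      case False
      then obtain p where p: "q = 2 * p + 1" "p \<in> tm_states N"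
        using q by (auto simp: tm_comp_def)
      then have "p \<noteq> tm_halt N"
        using nh by (auto simp: tm_comp_def)
      show ?thesis
      proof (cases "set (a # bs) \<subseteq> tm_alphabet N")
        case False
        then show ?thesis
          using d' p q as by (intro stay) (auto simp: tm_comp_def split: if_splits)
      next
        case True
        obtain p' acts' where e: "tm_delta N p (a # bs) = (p', acts')"
          by fastforce
        have *: "p' \<in> tm_states N" "length acts' = tm_tapes N" "fst ` set acts' \<subseteq> tm_alphabet N"
          using N True p(2) \<open>p \<noteq> tm_halt N\<close> lbs kN e unfolding wf_tm_def
          by (metis One_nat_def Suc_pred' length_Cons less_eq_Suc_le)+
        then obtain x xs where "acts' = x # xs"
          using kN by (cases acts') auto
        moreover from this have "q' = 2 * p' + 1" "acts = x # stay as' @ xs"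
          using d' e True p as by auto
        moreover have "fst ` set (x # stay as' @ xs) = fst ` set (x # xs) \<union> set as'"
          by (simp add: image_Un image_image Un_commute)
        ultimately show ?thesis
          using * alph las as ss kN by (auto simp: tm_comp_def)
      qed
    qed
  qed
  moreover have "tm_tapes (tm_comp M N) \<ge> 1" "finite (tm_states (tm_comp M N))"
    "tm_start (tm_comp M N) \<in> tm_states (tm_comp M N)" "tm_halt (tm_comp M N) \<in> tm_states (tm_comp M N)"
    "finite (tm_alphabet (tm_comp M N))" "{Blank, Bit False, Bit True} \<subseteq> tm_alphabet (tm_comp M N)"
    using M N by (auto simp: tm_comp_def wf_tm_def)
  ultimately show ?thesis
    unfolding wf_tm_def by blast
qed

lemma tm_comp_step1:
  assumes "valid_config M (q, tps)" "q \<noteq> tm_halt M" "tm_step M (q, tps) = (q', tps')"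
    "wf_tm M"
  shows "tm_step (tm_comp M N) (2 * q, tps @ rest) = (2 * q', tps' @ rest)"
proof -
  obtain acts where d: "tm_delta M q (map tape_read tps) = (q', acts)"
    and tps': "tps' = map2 tape_act acts tps"
    using assms by (auto simp: tm_step_def split: prod.splits)
  have len: "length tps = tm_tapes M" and q: "q \<in> tm_states M"
    using assms by (auto simp: valid_config_def)
  have alph: "set (map tape_read tps) \<subseteq> tm_alphabet M"
    using valid_config_read[OF assms(1)] by simp
  have "length acts = tm_tapes M"
    using assms(2,4) d len q alph unfolding wf_tm_def by (metis length_map)
  moreover have "2 * q \<noteq> 2 * tm_halt N + 1"
    by presburger
  ultimately show ?thesis
    using alph d tps' len assms(2) by (simp add: tm_step_def tm_comp_def Let_def)
qed

lemma tm_comp_step2: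
  assumes "valid_config N (q, tp # tps)" "q \<noteq> tm_halt N" "tm_step N (q, tp # tps) = (q', tps')"
    "wf_tm N" "wf_tm M" "length mid = tm_tapes M - 1"
  shows "tm_step (tm_comp M N) (2 * q + 1, tp # mid @ tps) = (2 * q' + 1, hd tps' # mid @ tl tps')"
proof -
  obtain acts where d: "tm_delta N q (map tape_read (tp # tps)) = (q', acts)"
    and tps': "tps' = map2 tape_act acts (tp # tps)"
    using assms by (auto simp: tm_step_def split: prod.splits)
  have len: "length (tp # tps) = tm_tapes N" and q: "q \<in> tm_states N"
    using assms by (auto simp: valid_config_def)
  have alph: "set (map tape_read (tp # tps)) \<subseteq> tm_alphabet N"
    using valid_config_read[OF assms(1)] by simp
  have "length acts = tm_tapes N"
    using assms(2,4) d len q alph unfolding wf_tm_def by (metis length_map)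
  then obtain a as where acts: "acts = a # as"
    using len by (cases acts) auto
  obtain k where k: "tm_tapes M = Suc k"
    using assms(5) by (cases "tm_tapes M") (auto simp: wf_tm_def)
  show ?thesis
    using alph d tps' assms(2,6) acts k by (simp add: tm_step_def tm_comp_def Let_def)
qed

text \<open>Only \<open>t' \<le> t\<close> can be claimed: \<open>M\<close> may have halted before
  step \<open>t\<close> and idles from then on, whereas the composed machine does not stop in the
  halting state of \<open>M\<close>.\<close>

lemma tm_comp_run1:
  assumes M: "wf_tm M"
  shows "valid_config M c \<Longrightarrow> (tm_step M ^^ t) c = (tm_halt M, tps') \<Longrightarrow>
    \<exists>t'\<le>t. (tm_step (tm_comp M N) ^^ t') (2 * fst c, snd c @ rest) = (2 * tm_halt M, tps' @ rest)"
proof (induction t arbitrary: c)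
  case (Suc t)
  obtain q tps where c: "c = (q, tps)"
    by fastforce
  show ?case
  proof (cases "q = tm_halt M")
    case True
    then have "c = (tm_halt M, tps')"
      using tm_steps_halted[of c M "Suc t"] Suc.prems(2) c by simp
    then show ?thesis
      by (intro exI[of _ 0]) auto
  next
    case False
    obtain q1 tps1 where s: "tm_step M (q, tps) = (q1, tps1)"
      by fastforce
    have "(tm_step M ^^ t) (q1, tps1) = (tm_halt M, tps')"
      using Suc.prems(2) s c by (simp add: funpow_swap1)
    with Suc.IH valid_config_step[OF M Suc.prems(1)] c s
    obtain t' where "t' \<le> t"
      "(tm_step (tm_comp M N) ^^ t') (2 * q1, tps1 @ rest) = (2 * tm_halt M, tps' @ rest)"
      by fastforce
    moreover have "tm_step (tm_comp M N) (2 * q, tps @ rest) = (2 * q1, tps1 @ rest)"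
      using tm_comp_step1 Suc.prems(1) c False s M by blast
    ultimately show ?thesis
      using c by (intro exI[of _ "Suc t'"]) (simp add: funpow_swap1)
  qed
qed (auto intro: exI[of _ 0])

text \<open>\<open>mid\<close> is whatever \<open>M\<close> left on its work tapes. \<open>N\<close>
  neither reads nor writes it, so only its length matters.\<close>

lemma tm_comp_run2:
  assumes M: "wf_tm M" and N: "wf_tm N" and mid: "length mid = tm_tapes M - 1"
  shows "valid_config N (q, tp # tps) \<Longrightarrow> (tm_step N ^^ t) (q, tp # tps) = (tm_halt N, tp' # tps') \<Longrightarrow>
    \<exists>t'\<le>t. (tm_step (tm_comp M N) ^^ t') (2 * q + 1, tp # mid @ tps) = (2 * tm_halt N + 1, tp' # mid @ tps')"
proof (induction t arbitrary: q tp tps)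
  case (Suc t)
  show ?case
  proof (cases "q = tm_halt N")
    case True
    then have "(q, tp # tps) = (tm_halt N, tp' # tps')"
      using tm_steps_halted[of "(q, tp # tps)" N "Suc t"] Suc.prems(2) by simp
    then show ?thesis
      by (intro exI[of _ 0]) auto
  next
    case False
    obtain q1 tpss where s: "tm_step N (q, tp # tps) = (q1, tpss)"
      by fastforce
    have v: "valid_config N (q1, tpss)"
      using valid_config_step[OF N Suc.prems(1)] s by simp
    then have "length tpss = tm_tapes N" "tm_tapes N \<ge> 1"
      using N by (auto simp: valid_config_def wf_tm_def)
    then obtain tp1 tps1 where t: "tpss = tp1 # tps1"
      by (cases tpss) auto
    have "(tm_step N ^^ t) (q1, tp1 # tps1) = (tm_halt N, tp' # tps')"
      using Suc.prems(2) s t by (simp add: funpow_swap1)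
    with Suc.IH v t obtain t' where "t' \<le> t"
      "(tm_step (tm_comp M N) ^^ t') (2 * q1 + 1, tp1 # mid @ tps1) = (2 * tm_halt N + 1, tp' # mid @ tps')"
      by blast
    moreover have "tm_step (tm_comp M N) (2 * q + 1, tp # mid @ tps) = (2 * q1 + 1, tp1 # mid @ tps1)"
      using tm_comp_step2[OF Suc.prems(1) False s N M mid] t by simp
    ultimately show ?thesis
      by (intro exI[of _ "Suc t'"]) (simp add: funpow_swap1)
  qed
qed (auto intro: exI[of _ 0])

lemma polytime_computable_comp:
  assumes f: "polytime_computable f" and g: "polytime_computable g"
  shows "polytime_computable (\<lambda>w. g (f w))"
proof -
  obtain M p where M: "wf_tm M" and
    p: "\<And>w. \<exists>t \<le> poly p (length w). \<exists>tps. (tm_step M ^^ t) (tm_init M w) = (tm_halt M, tape_of (f w) # tps)"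
    using f unfolding polytime_computable_def by auto
  obtain N q where N: "wf_tm N" and
    q: "\<And>w. \<exists>t \<le> poly q (length w). \<exists>tps. (tm_step N ^^ t) (tm_init N w) = (tm_halt N, tape_of (g w) # tps)"
    using g unfolding polytime_computable_def by auto
  let ?C = "tm_comp M N"
  \<comment> \<open>\<open>p\<close> bounds the run of \<open>M\<close>, the summand 1 pays for the
    jump, and \<open>q\<close> is taken at the bound on the output length given by
    \<open>output_length_le\<close>.\<close>
  define r where "r = p + 1 + pcompose q ([:0, 1:] + p + 1)"
  have "\<exists>t \<le> poly r (length w). \<exists>tps. (tm_step ?C ^^ t) (tm_init ?C w) = (tm_halt ?C, tape_of (g (f w)) # tps)" for w
  proof -
    obtain t1 tps1 where t1: "t1 \<le> poly p (length w)"
      and run1: "(tm_step M ^^ t1) (tm_init M w) = (tm_halt M, tape_of (f w) # tps1)"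
      using p by blast
    obtain t2 tps2 where t2: "t2 \<le> poly q (length (f w))"
      and run2: "(tm_step N ^^ t2) (tm_init N (f w)) = (tm_halt N, tape_of (g (f w)) # tps2)"
      using q by blast
    let ?rest = "replicate (tm_tapes N - 1) (tape_of [])"
    have init: "tm_init ?C w = (2 * fst (tm_init M w), snd (tm_init M w) @ ?rest)"
      using M N by (simp add: tm_init_def tm_comp_def wf_tm_def replicate_add[symmetric])
    obtain s1 where s1: "s1 \<le> t1"
      "(tm_step ?C ^^ s1) (tm_init ?C w) = (2 * tm_halt M, tape_of (f w) # tps1 @ ?rest)"
      using tm_comp_run1[OF M valid_config_init[OF M] run1, of N ?rest] init by auto
    have mid: "length tps1 = tm_tapes M - 1"
    proof -
      have "valid_config M ((tm_step M ^^ t1) (tm_init M w))"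
        by (induction t1) (auto simp: valid_config_init valid_config_step M)
      then show ?thesis
        by (auto simp: run1 valid_config_def)
    qed
    have jump: "tm_step ?C (2 * tm_halt M, tps) = (2 * tm_start N + 1, tps)" for tps
    proof -
      have "2 * tm_halt M \<noteq> 2 * tm_halt N + 1"
        by presburger
      then show ?thesis
        by (simp add: tm_step_def tm_comp_def Let_def)
    qed
    obtain s2 where s2: "s2 \<le> t2" "(tm_step ?C ^^ s2) (2 * tm_start N + 1, tape_of (f w) # tps1 @ ?rest) =
        (2 * tm_halt N + 1, tape_of (g (f w)) # tps1 @ tps2)"
      using tm_comp_run2[OF M N mid, of "tm_start N" "tape_of (f w)" ?rest t2] run2
        valid_config_init[OF N, of "f w"] by (auto simp: tm_init_def)
    have "(tm_step ?C ^^ (s2 + Suc s1)) (tm_init ?C w) = (2 * tm_halt N + 1, tape_of (g (f w)) # tps1 @ tps2)"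
      unfolding funpow_add comp_apply funpow.simps s1 jump s2 ..
    moreover have "tm_halt ?C = 2 * tm_halt N + 1"
      by (simp add: tm_comp_def)
    moreover have "s2 + Suc s1 \<le> poly r (length w)"
    proof -
      have "length (f w) \<le> length w + poly p (length w) + 1"
        using output_length_le[OF run1] t1 by simp
      from poly_mono_nat[OF this, of q] show ?thesis
        using s1(1) s2(1) t1 t2 by (simp add: r_def poly_pcompose)
    qed
    ultimately show ?thesis
      by metis
  qed
  with wf_tm_comp[OF M N] show ?thesis
    unfolding polytime_computable_def by blast
qed

lemma poly_reducible_trans: "A \<le>\<^sub>P B \<Longrightarrow> B \<le>\<^sub>P C \<Longrightarrow> A \<le>\<^sub>P C"
  unfolding poly_reducible_def using polytime_computable_comp by blast

section \<open>While programs on tapes\<close>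

datatype com =
    Put nat "bool option" dir
  | Go nat dir
  | Seq com com
  | Cond nat "symbol \<Rightarrow> bool" com com
  | While nat "symbol \<Rightarrow> bool" com

type_synonym store = "nat \<Rightarrow> tape"

fun sym :: "bool option \<Rightarrow> symbol" where
  "sym None = Blank"
| "sym (Some b) = Bit b"

text \<open>The number is the exact number of steps of the compiled program, including its jumps.\<close>

inductive run :: "com \<Rightarrow> store \<Rightarrow> nat \<Rightarrow> store \<Rightarrow> bool" where
  Put: "run (Put i b d) \<sigma> 1 (\<sigma>(i := tape_act (sym b, d) (\<sigma> i)))"
| Go: "run (Go i d) \<sigma> 1 (\<sigma>(i := tape_act (tape_read (\<sigma> i), d) (\<sigma> i)))"
| Seq: "run c\<^sub>1 \<sigma> t\<^sub>1 \<sigma>\<^sub>1 \<Longrightarrow> run c\<^sub>2 \<sigma>\<^sub>1 t\<^sub>2 \<sigma>\<^sub>2 \<Longrightarrow> run (Seq c\<^sub>1 c\<^sub>2) \<sigma> (t\<^sub>1 + t\<^sub>2) \<sigma>\<^sub>2"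
| CondT: "P (tape_read (\<sigma> i)) \<Longrightarrow> run c\<^sub>1 \<sigma> t \<sigma>' \<Longrightarrow> run (Cond i P c\<^sub>1 c\<^sub>2) \<sigma> (t + 2) \<sigma>'"
| CondF: "\<not> P (tape_read (\<sigma> i)) \<Longrightarrow> run c\<^sub>2 \<sigma> t \<sigma>' \<Longrightarrow> run (Cond i P c\<^sub>1 c\<^sub>2) \<sigma> (t + 1) \<sigma>'"
| WhileT: "P (tape_read (\<sigma> i)) \<Longrightarrow> run c \<sigma> t\<^sub>1 \<sigma>\<^sub>1 \<Longrightarrow> run (While i P c) \<sigma>\<^sub>1 t\<^sub>2 \<sigma>\<^sub>2 \<Longrightarrow>
    run (While i P c) \<sigma> (t\<^sub>1 + t\<^sub>2 + 2) \<sigma>\<^sub>2"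
| WhileF: "\<not> P (tape_read (\<sigma> i)) \<Longrightarrow> run (While i P c) \<sigma> 1 \<sigma>"

section \<open>Compilation to code with absolute addresses\<close>

datatype instr = IPut nat "bool option" dir | IGo nat dir | IBranch nat "symbol \<Rightarrow> bool" nat

primrec csize :: "com \<Rightarrow> nat" where
  "csize (Put i b d) = 1"
| "csize (Go i d) = 1"
| "csize (Seq c\<^sub>1 c\<^sub>2) = csize c\<^sub>1 + csize c\<^sub>2"
| "csize (Cond i P c\<^sub>1 c\<^sub>2) = csize c\<^sub>1 + csize c\<^sub>2 + 2"
| "csize (While i P c) = csize c + 2"

primrec creg :: "com \<Rightarrow> nat" where
  "creg (Put i b d) = i"
| "creg (Go i d) = i"
| "creg (Seq c\<^sub>1 c\<^sub>2) = max (creg c\<^sub>1) (creg c\<^sub>2)"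
| "creg (Cond i P c\<^sub>1 c\<^sub>2) = max i (max (creg c\<^sub>1) (creg c\<^sub>2))"
| "creg (While i P c) = max i (creg c)"

text \<open>
  \<open>compile c a\<close> is code to be placed at address \<open>a\<close>. \<open>IBranch i P b\<close>
  jumps to the absolute address \<open>b\<close> if the symbol on tape \<open>i\<close> violates \<open>P\<close>.
\<close>

primrec compile :: "com \<Rightarrow> nat \<Rightarrow> instr list" where
  "compile (Put i b d) a = [IPut i b d]"
| "compile (Go i d) a = [IGo i d]"
| "compile (Seq c\<^sub>1 c\<^sub>2) a = compile c\<^sub>1 a @ compile c\<^sub>2 (a + csize c\<^sub>1)"
| "compile (Cond i P c\<^sub>1 c\<^sub>2) a =
     IBranch i P (a + csize c\<^sub>1 + 2) # compile c\<^sub>1 (a + 1) @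
     IBranch i (\<lambda>_. False) (a + csize c\<^sub>1 + csize c\<^sub>2 + 2) # compile c\<^sub>2 (a + csize c\<^sub>1 + 2)"
| "compile (While i P c) a =
     IBranch i P (a + csize c + 2) # compile c (a + 1) @ [IBranch i (\<lambda>_. False) a]"

lemma length_compile [simp]: "length (compile c a) = csize c"
  by (induction c arbitrary: a) auto

fun wf_instr :: "nat \<Rightarrow> nat \<Rightarrow> instr \<Rightarrow> bool" where
  "wf_instr k n (IPut i b d) \<longleftrightarrow> i < k"
| "wf_instr k n (IGo i d) \<longleftrightarrow> i < k"
| "wf_instr k n (IBranch i P a) \<longleftrightarrow> i < k \<and> a \<le> n"

lemma wf_compile:
  "creg c < k \<Longrightarrow> a + csize c \<le> n \<Longrightarrow> ins \<in> set (compile c a) \<Longrightarrow> wf_instr k n ins"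
proof (induction c arbitrary: a)
  case (Seq c1 c2)
  then show ?case
    using Seq.IH(1)[of a] Seq.IH(2)[of "a + csize c1"] by auto
next
  case (Cond i P c1 c2)
  then show ?case
    using Cond.IH(1)[of "a + 1"] Cond.IH(2)[of "a + csize c1 + 2"] by auto
next
  case (While i P c)
  then show ?case
    using While.IH[of "a + 1"] by auto
qed auto

fun instr_delta :: "instr \<Rightarrow> nat \<Rightarrow> symbol list \<Rightarrow> nat \<times> (symbol \<times> dir) list" where
  "instr_delta (IPut i b d) q ss = (Suc q, (stay ss)[i := (sym b, d)])"
| "instr_delta (IGo i d) q ss = (Suc q, (stay ss)[i := (ss ! i, d)])"
| "instr_delta (IBranch i P a) q ss = (if P (ss ! i) then Suc q else a, stay ss)"

text \<open>Addresses serve as states. The halting state is the address just past the code, so a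
  program halts by running off its end or by jumping there.\<close>

definition tm_of :: "instr list \<Rightarrow> nat \<Rightarrow> tm" where
  "tm_of is k = \<lparr>
     tm_tapes = k,
     tm_states = {..length is},
     tm_alphabet = {Blank, Bit False, Bit True},
     tm_start = 0,
     tm_halt = length is,
     tm_delta = (\<lambda>q. instr_delta (is ! q) q) \<rparr>"

lemma wf_tm_of:
  assumes "k \<ge> 1" and wf: "\<forall>ins \<in> set is. wf_instr k (length is) ins"
  shows "wf_tm (tm_of is k)"
proof -
  let ?A = "{Blank, Bit False, Bit True}"
  have sym: "sym b \<in> ?A" for b
    by (cases b) auto
  have upd: "fst ` set ((stay ss)[i := (s, d)]) \<subseteq> ?A" if "set ss \<subseteq> ?A" "s \<in> ?A" for ss i s d
  proof -
    have "set ((stay ss)[i := (s, d)]) \<subseteq> insert (s, d) (set (stay ss))"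
      by (rule set_update_subset_insert)
    then show ?thesis
      using that by fastforce
  qed
  have "q' \<le> length is \<and> length acts = k \<and> fst ` set acts \<subseteq> ?A"
    if "q < length is" "length ss = k" "set ss \<subseteq> ?A" "instr_delta (is ! q) q ss = (q', acts)" for q ss q' acts
  proof -
    have w: "wf_instr k (length is) (is ! q)"
      using wf that by simp
    show ?thesis
    proof (cases "is ! q")
      case (IPut i b d)
      then show ?thesis
        using that(1,2,4) upd[OF that(3) sym, of i b d] by auto
    next
      case (IGo i d)
      then have "ss ! i \<in> ?A"
        using w that(2,3) by (metis nth_mem subsetD wf_instr.simps(2))
      then show ?thesis
        using IGo that(1,2,4) upd[OF that(3), of "ss ! i" i d] by auto
    next
      case (IBranch i P a)
      have "fst ` set (stay ss) \<subseteq> ?A"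
        using that(3) by (simp add: image_image)
      then show ?thesis
        using IBranch w that(1,2,4) by (cases "P (ss ! i)") (auto simp del: set_map)
    qed
  qed
  then show ?thesis
    using assms(1) unfolding wf_tm_def tm_of_def by (simp add: le_less)
qed

lemma map2_act_update:
  assumes "i < k"
  shows "map2 tape_act ((stay (map tape_read (map \<sigma> [0..<k])))[i := a]) (map \<sigma> [0..<k])
    = map (\<sigma>(i := tape_act a (\<sigma> i))) [0..<k]"
  by (rule nth_equalityI) (use assms in \<open>auto simp: nth_list_update\<close>)

lemma map2_act_stay:
  "map2 tape_act (stay (map tape_read (map \<sigma> [0..<k]))) (map \<sigma> [0..<k]) = map \<sigma> [0..<k]"
  by (rule nth_equalityI) auto

lemma tm_step_Put:
  assumes "is ! q = IPut i b d" "q < length is" "i < k"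
  shows "tm_step (tm_of is k) (q, map \<sigma> [0..<k]) = (Suc q, map (\<sigma>(i := tape_act (sym b, d) (\<sigma> i))) [0..<k])"
  using assms map2_act_update[OF assms(3), of \<sigma> "(sym b, d)"] by (simp add: tm_step_def tm_of_def)

lemma tm_step_Go:
  assumes "is ! q = IGo i d" "q < length is" "i < k"
  shows "tm_step (tm_of is k) (q, map \<sigma> [0..<k]) =
    (Suc q, map (\<sigma>(i := tape_act (tape_read (\<sigma> i), d) (\<sigma> i))) [0..<k])"
  using assms map2_act_update[OF assms(3), of \<sigma> "(tape_read (\<sigma> i), d)"]
  by (simp add: tm_step_def tm_of_def)

lemma tm_step_Branch:
  assumes "is ! q = IBranch i P a" "q < length is" "i < k"
  shows "tm_step (tm_of is k) (q, map \<sigma> [0..<k]) =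
    (if P (tape_read (\<sigma> i)) then Suc q else a, map \<sigma> [0..<k])"
  using assms map2_act_stay[of \<sigma> k] by (simp add: tm_step_def tm_of_def)

definition code_at :: "instr list \<Rightarrow> nat \<Rightarrow> instr list \<Rightarrow> bool" where
  "code_at is a js \<longleftrightarrow> a + length js \<le> length is \<and> (\<forall>k < length js. is ! (a + k) = js ! k)"

lemma code_at_Cons: "code_at is a (j # js) \<longleftrightarrow> a < length is \<and> is ! a = j \<and> code_at is (Suc a) js"
  by (auto simp: code_at_def All_less_Suc2 nth_Cons)

lemma code_at_append: "code_at is a (js @ ks) \<longleftrightarrow> code_at is a js \<and> code_at is (a + length js) ks"
proof -
  have "(\<forall>k < m + n. P k) \<longleftrightarrow> (\<forall>k < m. P k) \<and> (\<forall>k < n. P (m + k))" for m n :: nat and P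
    by (auto, metis le_add_diff_inverse nat_add_left_cancel_less not_less)
  then show ?thesis
    by (auto simp: code_at_def nth_append add.assoc)
qed

text \<open>The code may stand anywhere in a larger program, so that the induction applies to
  subprograms. The configuration after the block is then in general not a halting one and cannot be
  padded with idle steps, which is why the step count has to be exact.\<close>

lemma compile_correct:
  assumes "run c \<sigma> t \<sigma>'"
  shows "creg c < k \<Longrightarrow> code_at is a (compile c a) \<Longrightarrow>
    (tm_step (tm_of is k) ^^ t) (a, map \<sigma> [0..<k]) = (a + csize c, map \<sigma>' [0..<k])"
  using assms
proof (induction arbitrary: a)
  case (Put i b d \<sigma>)
  then show ?case
    by (simp add: code_at_Cons tm_step_Put)
next
  case (Go i d \<sigma>)
  then show ?case
    by (simp add: code_at_Cons tm_step_Go)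
next
  case (Seq c1 \<sigma> t1 \<sigma>1 c2 t2 \<sigma>2)
  then show ?case
    by (simp add: code_at_append add.commute[of t1] funpow_add add.assoc)
next
  case (CondT P \<sigma> i c1 t \<sigma>' c2)
  then have "(tm_step (tm_of is k) ^^ (1 + (t + 1))) (a, map \<sigma> [0..<k]) =
      (a + csize (Cond i P c1 c2), map \<sigma>' [0..<k])"
    unfolding funpow_add by (simp add: code_at_append code_at_Cons tm_step_Branch funpow_swap1)
  then show ?case
    by (simp only: add_2_eq_Suc' One_nat_def add_Suc add_Suc_right add_0 add_0_right)
next
  case (CondF P \<sigma> i c2 t \<sigma>' c1)
  then show ?case
    unfolding funpow_add by (simp add: code_at_append code_at_Cons tm_step_Branch funpow_swap1)
next
  case (WhileT P \<sigma> i c t1 \<sigma>1 t2 \<sigma>2)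
  have *: "code_at is (Suc a) (compile c (Suc a))" "is ! a = IBranch i P (a + csize c + 2)" "a < length is"
     "is ! (Suc a + csize c) = IBranch i (\<lambda>_. False) a" "Suc a + csize c < length is" "i < k" "creg c < k"
    using WhileT.prems by (auto simp: code_at_append code_at_Cons)
  \<comment> \<open>\<open>funpow_add\<close> performs the right summand first: the test, the body,
    the jump back and the remaining rounds.\<close>
  have "(tm_step (tm_of is k) ^^ (t2 + (1 + (t1 + 1)))) (a, map \<sigma> [0..<k]) =
      (a + csize (While i P c), map \<sigma>2 [0..<k])"
    unfolding funpow_add using WhileT.IH(1)[of "Suc a"] WhileT.IH(2)[OF WhileT.prems] WhileT.hyps * 
    by (simp add: tm_step_Branch)
  then show ?case
    by (simp add: algebra_simps)
next
  case (WhileF P \<sigma> i c)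
  then show ?case
    by (simp add: code_at_Cons tm_step_Branch)
qed

lemma run_computes:
  assumes c: "\<And>w. \<exists>t \<le> poly p (length w). \<exists>\<sigma>. run c ((\<lambda>_. tape_of [])(0 := tape_of w)) t \<sigma> \<and> \<sigma> 0 = tape_of (f w)"
  shows "polytime_computable f"
proof -
  define k where "k = Suc (creg c)"
  let ?M = "tm_of (compile c 0) k"
  have ups: "[0..<k] = 0 # [1..<k]"
    by (simp add: k_def upt_conv_Cons del: upt_Suc)
  have "wf_tm ?M"
    by (rule wf_tm_of) (auto simp: k_def intro: wf_compile)
  moreover have "\<exists>t \<le> poly p (length w). \<exists>tps. (tm_step ?M ^^ t) (tm_init ?M w) = (tm_halt ?M, tape_of (f w) # tps)" for w
  proof -
    let ?\<sigma> = "(\<lambda>_. tape_of [])(0 := tape_of w)"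
    obtain t \<sigma> where t: "t \<le> poly p (length w)" and r: "run c ?\<sigma> t \<sigma>" "\<sigma> 0 = tape_of (f w)"
      using c by blast
    have "(tm_step ?M ^^ t) (0, map ?\<sigma> [0..<k]) = (0 + csize c, map \<sigma> [0..<k])"
      by (rule compile_correct[OF r(1)]) (auto simp: k_def code_at_def)
    moreover have "tm_init ?M w = (0, map ?\<sigma> [0..<k])"
      unfolding tm_init_def ups by (auto simp: tm_of_def intro!: nth_equalityI)
    moreover have "tm_halt ?M = csize c"
      by (simp add: tm_of_def)
    ultimately show ?thesis
      using t r(2) ups by auto
  qed
  ultimately show ?thesis
    unfolding polytime_computable_def by blast
qed

section \<open>Stacks\<close>

text \<open>Exact step counts matter to the compiler only; from here on upper bounds suffice, and
  they may be weakened freely.\<close>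

definition runs :: "com \<Rightarrow> store \<Rightarrow> nat \<Rightarrow> store \<Rightarrow> bool" where
  "runs c \<sigma> T \<sigma>' \<longleftrightarrow> (\<exists>t\<le>T. run c \<sigma> t \<sigma>')"

lemma runs_mono: "runs c \<sigma> T \<sigma>' \<Longrightarrow> T \<le> T' \<Longrightarrow> runs c \<sigma> T' \<sigma>'"
  by (meson le_trans runs_def)

lemma runs_Seq: "runs c\<^sub>1 \<sigma> T\<^sub>1 \<sigma>\<^sub>1 \<Longrightarrow> runs c\<^sub>2 \<sigma>\<^sub>1 T\<^sub>2 \<sigma>\<^sub>2 \<Longrightarrow> runs (Seq c\<^sub>1 c\<^sub>2) \<sigma> (T\<^sub>1 + T\<^sub>2) \<sigma>\<^sub>2"
  unfolding runs_def by (meson add_mono run.Seq)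

lemma runs_Cond:
  "runs (if P (tape_read (\<sigma> i)) then c\<^sub>1 else c\<^sub>2) \<sigma> T \<sigma>' \<Longrightarrow> runs (Cond i P c\<^sub>1 c\<^sub>2) \<sigma> (T + 2) \<sigma>'"
proof (cases "P (tape_read (\<sigma> i))")
  case True
  then show "runs (if P (tape_read (\<sigma> i)) then c\<^sub>1 else c\<^sub>2) \<sigma> T \<sigma>' \<Longrightarrow> ?thesis"
    unfolding runs_def using run.CondT[of P \<sigma> i] by (metis add_mono order_refl)
next
  case False
  then show "runs (if P (tape_read (\<sigma> i)) then c\<^sub>1 else c\<^sub>2) \<sigma> T \<sigma>' \<Longrightarrow> ?thesis"
    unfolding runs_def using run.CondF[of P \<sigma> i] by (metis add_mono one_le_numeral)
qed

lemma runs_WhileF: "\<not> P (tape_read (\<sigma> i)) \<Longrightarrow> runs (While i P c) \<sigma> 1 \<sigma>"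
  unfolding runs_def using run.WhileF by blast

lemma runs_WhileT:
  assumes "P (tape_read (\<sigma> i))" "runs c \<sigma> T\<^sub>1 \<sigma>\<^sub>1" "runs (While i P c) \<sigma>\<^sub>1 T\<^sub>2 \<sigma>\<^sub>2"
  shows "runs (While i P c) \<sigma> (T\<^sub>1 + T\<^sub>2 + 2) \<sigma>\<^sub>2"
proof -
  obtain t\<^sub>1 t\<^sub>2 where "t\<^sub>1 \<le> T\<^sub>1" "run c \<sigma> t\<^sub>1 \<sigma>\<^sub>1" "t\<^sub>2 \<le> T\<^sub>2" "run (While i P c) \<sigma>\<^sub>1 t\<^sub>2 \<sigma>\<^sub>2"
    using assms unfolding runs_def by blast
  then show ?thesis
    using run.WhileT[of P \<sigma> i c t\<^sub>1 \<sigma>\<^sub>1 t\<^sub>2 \<sigma>\<^sub>2] assms(1)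
    unfolding runs_def by (intro exI[of _ "t\<^sub>1 + t\<^sub>2 + 2"]) auto
qed

text \<open>The bottom of a stack is on cell \<open>-1\<close> and the head is on its top.\<close>

definition stk :: "bool list \<Rightarrow> tape" where
  "stk u = (\<lambda>j. if - int (length u) \<le> j \<and> j < 0 then Bit (u ! nat (j + int (length u))) else Blank,
            - int (length u))"

lemma tape_of_Nil: "tape_of [] = stk []"
  by (auto simp: tape_of_def stk_def fun_eq_iff)

lemma read_stk [simp]:
  "tape_read (stk []) = Blank"
  "tape_read (stk (b # u)) = Bit b"
  by (auto simp: tape_read_def stk_def)

definition push :: "nat \<Rightarrow> bool \<Rightarrow> com" where
  "push i b = Seq (Go i Move_Left) (Put i (Some b) Stay)"

definition pop :: "nat \<Rightarrow> com" where
  "pop i = Put i None Move_Right"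

lemma snd_stk [simp]: "snd (stk u) = - int (length u)"
  by (simp add: stk_def)

lemma stk_Cons: "stk (b # u) = ((fst (stk u))(- int (length u) - 1 := Bit b), - int (length u) - 1)"
proof -
  have "(b # u) ! nat (j + int (length (b # u))) = u ! nat (j + int (length u))" if "- int (length u) \<le> j" for j
  proof -
    have "nat (j + int (length (b # u))) = Suc (nat (j + int (length u)))"
      using that by simp
    then show ?thesis
      by simp
  qed
  then show ?thesis
    by (auto simp: stk_def fun_eq_iff)
qed

lemma stk_below: "fst (stk u) (- int (length u) - 1) = Blank"
  by (simp add: stk_def)

lemma runs_push:
  assumes "\<sigma> i = stk u"
  shows "runs (push i b) \<sigma> 2 (\<sigma>(i := stk (b # u)))"
proof -
  have "tape_act (Bit b, Stay) (tape_act (tape_read (stk u), Move_Left) (stk u)) = stk (b # u)"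
    by (simp add: tape_act_def tape_read_def stk_Cons)
  then have "run (push i b) \<sigma> (1 + 1) (\<sigma>(i := stk (b # u)))"
    unfolding push_def using run.Seq[OF run.Go[where i = i and d = Move_Left and \<sigma> = \<sigma>]
        run.Put[where i = i and b = "Some b" and d = Stay]] assms by simp
  then show ?thesis
    unfolding runs_def by (metis one_add_one order_refl)
qed

lemma runs_pop:
  assumes "\<sigma> i = stk (b # u)"
  shows "runs (pop i) \<sigma> 1 (\<sigma>(i := stk u))"
proof -
  have "tape_act (Blank, Move_Right) (stk (b # u)) = stk u"
    using stk_below[of u] by (auto simp: tape_act_def stk_Cons prod_eq_iff)
  then show ?thesis
    using run.Put[of i None Move_Right \<sigma>] assms unfolding runs_def pop_def by auto
qed

section \<open>Loops that consume a stack\<close>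

definition each :: "nat \<Rightarrow> com \<Rightarrow> com \<Rightarrow> com" where
  "each i c\<^sub>1 c\<^sub>0 = While i (\<lambda>s. s \<noteq> Blank) (Cond i (\<lambda>s. s = Bit True) (Seq (pop i) c\<^sub>1) (Seq (pop i) c\<^sub>0))"

text \<open>\<open>J u\<close> is the loop invariant while \<open>u\<close> is left on the stack.
  The 5 extra steps per bit are 2 for the loop, 2 for the conditional and 1 for the pop.\<close>

lemma runs_each:
  assumes J: "\<And>u \<sigma>. J u \<sigma> \<Longrightarrow> \<sigma> i = stk u"
    and step: "\<And>b u \<sigma>. J (b # u) \<sigma> \<Longrightarrow> \<exists>\<sigma>'. runs (if b then c\<^sub>1 else c\<^sub>0) (\<sigma>(i := stk u)) T \<sigma>' \<and> J u \<sigma>'"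
  shows "J u \<sigma> \<Longrightarrow> \<exists>\<sigma>'. runs (each i c\<^sub>1 c\<^sub>0) \<sigma> ((T + 5) * length u + 1) \<sigma>' \<and> J [] \<sigma>'"
proof (induction u arbitrary: \<sigma>)
  case Nil
  then show ?case
    using J[OF Nil] runs_WhileF[of "\<lambda>s. s \<noteq> Blank" \<sigma> i] unfolding each_def by auto
next
  case (Cons b u)
  obtain \<sigma>1 where 1: "runs (if b then c\<^sub>1 else c\<^sub>0) (\<sigma>(i := stk u)) T \<sigma>1" "J u \<sigma>1"
    using step[OF Cons.prems] by blast
  obtain \<sigma>2 where 2: "runs (each i c\<^sub>1 c\<^sub>0) \<sigma>1 ((T + 5) * length u + 1) \<sigma>2" "J [] \<sigma>2"
    using Cons.IH[OF 1(2)] by blast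
  have \<sigma>: "\<sigma> i = stk (b # u)"
    using J[OF Cons.prems] .
  have "runs (Seq (pop i) (if b then c\<^sub>1 else c\<^sub>0)) \<sigma> (1 + T) \<sigma>1"
    using runs_Seq[OF runs_pop 1(1)] \<sigma> by blast
  then have "runs (Cond i (\<lambda>s. s = Bit True) (Seq (pop i) c\<^sub>1) (Seq (pop i) c\<^sub>0)) \<sigma> (1 + T + 2) \<sigma>1"
    by (intro runs_Cond) (use \<sigma> in auto)
  then have "runs (each i c\<^sub>1 c\<^sub>0) \<sigma> ((1 + T + 2) + ((T + 5) * length u + 1) + 2) \<sigma>2"
    unfolding each_def using \<sigma> 2(1)[unfolded each_def] by (intro runs_WhileT) auto
  moreover have "(1 + T + 2) + ((T + 5) * length u + 1) + 2 = (T + 5) * length (b # u) + 1"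
    by (simp add: algebra_simps)
  ultimately show ?case
    using 2(2) by (metis (no_types))
qed

definition clear :: "nat \<Rightarrow> com" where
  "clear i = each i (Go i Stay) (Go i Stay)"

lemma runs_skip: "runs (Go i Stay) \<sigma> 1 \<sigma>"
  using run.Go[of i Stay \<sigma>] unfolding runs_def by auto

lemma runs_clear:
  assumes "\<sigma> i = stk u"
  shows "runs (clear i) \<sigma> (6 * length u + 1) (\<sigma>(i := stk []))"
proof -
  define J where [simp]: "J = (\<lambda>v \<sigma>'. \<sigma>' = \<sigma>(i := stk v))"
  have J1: "J w \<tau> \<Longrightarrow> \<tau> i = stk w" for w \<tau>
    by auto
  have J2: "\<exists>\<sigma>'. runs (if b then Go i Stay else Go i Stay) (\<tau>(i := stk w)) 1 \<sigma>' \<and> J w \<sigma>'"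
    if "J (b # w) \<tau>" for b w \<tau>
    using that runs_skip by (intro exI[of _ "\<tau>(i := stk w)"]) auto
  have J3: "J u \<sigma>"
    using assms by auto
  have "\<exists>\<sigma>'. runs ((clear i)) \<sigma> (((1 + 5) * length u + 1)) \<sigma>' \<and> J [] \<sigma>'"
    unfolding clear_def by (rule runs_each[of J]) (fact J1 J2 J3)+
  then show ?thesis
    by auto
qed

text \<open>Moving from stack to stack reverses the contents. A second move undoes this, so
  \<open>move\<close> and \<open>copy\<close> need an empty third stack.\<close>

definition rmove :: "nat \<Rightarrow> nat \<Rightarrow> com" where
  "rmove i j = each i (push j True) (push j False)"

lemma runs_rmove:
  assumes "\<sigma> i = stk u" "\<sigma> j = stk v" "i \<noteq> j"
  shows "runs (rmove i j) \<sigma> (7 * length u + 1) (\<sigma>(i := stk [], j := stk (rev u @ v)))"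
proof -
  define J where [simp]: "J = (\<lambda>w \<sigma>'. \<exists>p. u = p @ w \<and> \<sigma>' = \<sigma>(i := stk w, j := stk (rev p @ v)))"
  have J2: "\<exists>\<sigma>'. runs (if b then push j True else push j False) (\<tau>(i := stk w)) 2 \<sigma>' \<and> J w \<sigma>'"
    if J: "J (b # w) \<tau>" for b w \<tau>
  proof -
    obtain p where p: "u = p @ b # w" "\<tau> = \<sigma>(i := stk (b # w), j := stk (rev p @ v))"
      using J unfolding J_def by blast
    have "runs (push j b) (\<tau>(i := stk w)) 2 ((\<tau>(i := stk w))(j := stk (b # rev p @ v)))"
      by (rule runs_push) (use p(2) assms(3) in simp)
    moreover have "J w ((\<tau>(i := stk w))(j := stk (b # rev p @ v)))"
      unfolding J_def by (rule exI[of _ "p @ [b]"]) (use p in auto)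
    ultimately show ?thesis
      by (cases b) auto
  qed
  have J3: "J u \<sigma>"
    unfolding J_def using assms by (intro exI[of _ "[]"]) auto
  have J1: "J w \<tau> \<Longrightarrow> \<tau> i = stk w" for w \<tau>
    using assms by auto
  have "\<exists>\<sigma>'. runs ((rmove i j)) \<sigma> (((2 + 5) * length u + 1)) \<sigma>' \<and> J [] \<sigma>'"
    unfolding rmove_def by (rule runs_each[of J]) (fact J1 J2 J3)+
  then show ?thesis
    by auto
qed

definition rmove2 :: "nat \<Rightarrow> nat \<Rightarrow> nat \<Rightarrow> com" where
  "rmove2 i j k = each i (Seq (push j True) (push k True)) (Seq (push j False) (push k False))"

lemma runs_rmove2:
  assumes "\<sigma> i = stk u" "\<sigma> j = stk v" "\<sigma> k = stk v'" "i \<noteq> j" "i \<noteq> k" "j \<noteq> k"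
  shows "runs (rmove2 i j k) \<sigma> (9 * length u + 1)
    (\<sigma>(i := stk [], j := stk (rev u @ v), k := stk (rev u @ v')))"
proof -
  define J where [simp]: "J = (\<lambda>w \<sigma>'. \<exists>p. u = p @ w \<and> \<sigma>' = \<sigma>(i := stk w, j := stk (rev p @ v), k := stk (rev p @ v')))"
  have J2: "\<exists>\<sigma>'. runs (if b then Seq (push j True) (push k True) else Seq (push j False) (push k False))
        (\<tau>(i := stk w)) 4 \<sigma>' \<and> J w \<sigma>'"
    if J: "J (b # w) \<tau>" for b w \<tau>
  proof -
    obtain p where p: "u = p @ b # w" "\<tau> = \<sigma>(i := stk (b # w), j := stk (rev p @ v), k := stk (rev p @ v'))"
      using J unfolding J_def by blast
    define \<tau>1 where "\<tau>1 = (\<tau>(i := stk w))(j := stk (b # rev p @ v))"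
    have "runs (push j b) (\<tau>(i := stk w)) 2 \<tau>1"
      unfolding \<tau>1_def by (rule runs_push) (use p(2) assms in simp)
    moreover have "runs (push k b) \<tau>1 2 (\<tau>1(k := stk (b # rev p @ v')))"
      by (rule runs_push) (use p(2) assms in \<open>simp add: \<tau>1_def\<close>)
    ultimately have "runs (Seq (push j b) (push k b)) (\<tau>(i := stk w)) 4 (\<tau>1(k := stk (b # rev p @ v')))"
      using runs_Seq by fastforce
    moreover have "J w (\<tau>1(k := stk (b # rev p @ v')))"
      unfolding J_def by (rule exI[of _ "p @ [b]"]) (use p assms in \<open>auto simp: \<tau>1_def fun_eq_iff\<close>)
    ultimately show ?thesis
      by (cases b) auto
  qed
  have J3: "J u \<sigma>"
    unfolding J_def using assms by (intro exI[of _ "[]"]) auto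
  have J1: "J w \<tau> \<Longrightarrow> \<tau> i = stk w" for w \<tau>
    using assms by auto
  have "\<exists>\<sigma>'. runs ((rmove2 i j k)) \<sigma> (((4 + 5) * length u + 1)) \<sigma>' \<and> J [] \<sigma>'"
    unfolding rmove2_def by (rule runs_each[of J]) (fact J1 J2 J3)+
  then show ?thesis
    by auto
qed

definition move :: "nat \<Rightarrow> nat \<Rightarrow> nat \<Rightarrow> com" where
  "move i j k = Seq (rmove i k) (rmove k j)"

lemma runs_move:
  assumes "\<sigma> i = stk u" "\<sigma> j = stk v" "\<sigma> k = stk []" "i \<noteq> j" "i \<noteq> k" "j \<noteq> k"
  shows "runs (move i j k) \<sigma> (14 * length u + 2) (\<sigma>(i := stk [], j := stk (u @ v)))"
proof -
  define \<sigma>1 where "\<sigma>1 = \<sigma>(i := stk [], k := stk (rev u))"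
  have "runs (rmove i k) \<sigma> (7 * length u + 1) \<sigma>1"
    using runs_rmove[of \<sigma> i u k "[]"] assms by (simp add: \<sigma>1_def)
  moreover have "runs (rmove k j) \<sigma>1 (7 * length u + 1) (\<sigma>1(k := stk [], j := stk (u @ v)))"
    using runs_rmove[of \<sigma>1 k "rev u" j v] assms by (simp add: \<sigma>1_def)
  moreover have "\<sigma>1(k := stk [], j := stk (u @ v)) = \<sigma>(i := stk [], j := stk (u @ v))"
    using assms by (auto simp: \<sigma>1_def fun_eq_iff)
  ultimately show ?thesis
    using runs_Seq[of "rmove i k" \<sigma> _ \<sigma>1] unfolding move_def by (force intro: runs_mono)
qed

definition copy :: "nat \<Rightarrow> nat \<Rightarrow> nat \<Rightarrow> com" where
  "copy i j k = Seq (rmove i k) (rmove2 k i j)"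

lemma runs_copy:
  assumes "\<sigma> i = stk u" "\<sigma> j = stk []" "\<sigma> k = stk []" "i \<noteq> j" "i \<noteq> k" "j \<noteq> k"
  shows "runs (copy i j k) \<sigma> (16 * length u + 2) (\<sigma>(j := stk u))"
proof -
  define \<sigma>1 where "\<sigma>1 = \<sigma>(i := stk [], k := stk (rev u))"
  have "runs (rmove i k) \<sigma> (7 * length u + 1) \<sigma>1"
    using runs_rmove[of \<sigma> i u k "[]"] assms by (simp add: \<sigma>1_def)
  moreover have "runs (rmove2 k i j) \<sigma>1 (9 * length u + 1) (\<sigma>1(k := stk [], i := stk u, j := stk u))"
    using runs_rmove2[of \<sigma>1 k "rev u" i "[]" j "[]"] assms by (simp add: \<sigma>1_def)
  moreover have "\<sigma>1(k := stk [], i := stk u, j := stk u) = \<sigma>(j := stk u)"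
    using assms by (auto simp: \<sigma>1_def fun_eq_iff)
  ultimately show ?thesis
    using runs_Seq[of "rmove i k" \<sigma> _ \<sigma>1] unfolding copy_def by (force intro: runs_mono)
qed

text \<open>A self-delimiting form: \<open>True\<close> announces a further bit and
  \<open>False\<close> ends the word. Hence a quoted word can be split off from the top of a stack
  whatever lies below it.\<close>

fun quote :: "bool list \<Rightarrow> bool list" where
  "quote [] = [False]"
| "quote (b # u) = True # b # quote u"

lemma length_quote [simp]: "length (quote u) = 2 * length u + 1"
  by (induction u) auto

text \<open>A stack is filled from the end of the word: the terminator goes first, and each bit goes
  before its marker. Since the source is read from its top, the quoted word is the reversed
  one.\<close>

definition rquote :: "nat \<Rightarrow> nat \<Rightarrow> com" where
  "rquote i j = Seq (push j False)
     (each i (Seq (push j True) (push j True)) (Seq (push j False) (push j True)))"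

lemma runs_rquote:
  assumes "\<sigma> i = stk u" "\<sigma> j = stk v" "i \<noteq> j"
  shows "runs (rquote i j) \<sigma> (9 * length u + 3) (\<sigma>(i := stk [], j := stk (quote (rev u) @ v)))"
proof -
  \<comment> \<open>The target stack after the bits \<open>p\<close> have been moved. In this form
    one more bit at the end of \<open>p\<close> visibly adds two bits on top.\<close>
  define f where "f p = concat (map (\<lambda>b. [True, b]) (rev p)) @ False # v" for p
  have f: "f p = quote (rev p) @ v" for p
  proof -
    have "quote u = concat (map (\<lambda>b. [True, b]) u) @ [False]" for u
      by (induction u) auto
    then show ?thesis
      by (simp add: f_def)
  qed
  let ?\<sigma> = "\<sigma>(j := stk (False # v))"
  define J where [simp]: "J = (\<lambda>w \<sigma>'. \<exists>p. u = p @ w \<and> \<sigma>' = \<sigma>(i := stk w, j := stk (f p)))"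
  have J2: "\<exists>\<sigma>'. runs (if b then Seq (push j True) (push j True) else Seq (push j False) (push j True))
        (\<tau>(i := stk w)) 4 \<sigma>' \<and> J w \<sigma>'"
    if J: "J (b # w) \<tau>" for b w \<tau>
  proof -
    obtain p where p: "u = p @ b # w" "\<tau> = \<sigma>(i := stk (b # w), j := stk (f p))"
      using J unfolding J_def by blast
    define \<tau>1 where "\<tau>1 = (\<tau>(i := stk w))(j := stk (b # f p))"
    have "runs (push j b) (\<tau>(i := stk w)) 2 \<tau>1"
      unfolding \<tau>1_def by (rule runs_push) (use p(2) assms in simp)
    moreover have "runs (push j True) \<tau>1 2 (\<tau>1(j := stk (True # b # f p)))"
      by (rule runs_push) (use p(2) assms in \<open>simp add: \<tau>1_def\<close>)
    ultimately have "runs (Seq (push j b) (push j True)) (\<tau>(i := stk w)) 4 (\<tau>1(j := stk (True # b # f p)))"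
      using runs_Seq by fastforce
    moreover have "J w (\<tau>1(j := stk (True # b # f p)))"
      unfolding J_def by (rule exI[of _ "p @ [b]"]) (use p assms in \<open>auto simp: \<tau>1_def fun_eq_iff f_def\<close>)
    ultimately show ?thesis
      by (cases b) auto
  qed
  have J3: "J u ?\<sigma>"
    unfolding J_def using assms by (intro exI[of _ "[]"]) (auto simp: f_def)
  have J1: "J w \<tau> \<Longrightarrow> \<tau> i = stk w" for w \<tau>
    using assms by auto
  have "\<exists>\<sigma>'. runs (each i (Seq (push j True) (push j True)) (Seq (push j False) (push j True))) ?\<sigma> ((4 + 5) * length u + 1) \<sigma>' \<and> J [] \<sigma>'"
    by (rule runs_each[of J]) (fact J1 J2 J3)+
  then have "runs (each i (Seq (push j True) (push j True)) (Seq (push j False) (push j True)))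
      ?\<sigma> (9 * length u + 1) (\<sigma>(i := stk [], j := stk (f u)))"
    by auto
  from runs_Seq[OF runs_push[of \<sigma> j v False] this] assms show ?thesis
    unfolding rquote_def f by (simp add: algebra_simps eval_nat_numeral)
qed

definition runquote :: "nat \<Rightarrow> nat \<Rightarrow> com" where
  "runquote i j = Seq (While i (\<lambda>s. s = Bit True)
     (Seq (pop i) (Cond i (\<lambda>s. s = Bit True) (Seq (pop i) (push j True)) (Seq (pop i) (push j False))))) (pop i)"

lemma runs_runquote:
  assumes "\<sigma> i = stk (quote u @ v)" "\<sigma> j = stk w" "i \<noteq> j"
  shows "runs (runquote i j) \<sigma> (8 * length u + 2) (\<sigma>(i := stk v, j := stk (rev u @ w)))"
proof -
  let ?B = "Seq (pop i) (Cond i (\<lambda>s. s = Bit True) (Seq (pop i) (push j True)) (Seq (pop i) (push j False)))"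
  have "\<sigma> i = stk (quote u @ v) \<Longrightarrow> \<sigma> j = stk w \<Longrightarrow>
    runs (While i (\<lambda>s. s = Bit True) ?B) \<sigma> (8 * length u + 1) (\<sigma>(i := stk (False # v), j := stk (rev u @ w)))"
  proof (induction u arbitrary: \<sigma> w)
    case Nil
    then have "\<sigma>(i := stk (False # v), j := stk (rev [] @ w)) = \<sigma>"
      by auto
    moreover have "runs (While i (\<lambda>s. s = Bit True) ?B) \<sigma> 1 \<sigma>"
      by (rule runs_WhileF) (use Nil in simp)
    ultimately show ?case
      by (simp only: list.size mult_0_right add_0)
  next
    case (Cons b u)
    define \<sigma>1 where "\<sigma>1 = \<sigma>(i := stk (b # quote u @ v))"
    define \<sigma>2 where "\<sigma>2 = \<sigma>1(i := stk (quote u @ v))"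
    define \<sigma>3 where "\<sigma>3 = \<sigma>2(j := stk (b # w))"
    have 1: "runs (pop i) \<sigma> 1 \<sigma>1"
      unfolding \<sigma>1_def by (rule runs_pop) (use Cons.prems in simp)
    have 2: "runs (pop i) \<sigma>1 1 \<sigma>2"
      unfolding \<sigma>2_def by (rule runs_pop) (simp add: \<sigma>1_def)
    have 3: "runs (push j b) \<sigma>2 2 \<sigma>3"
      unfolding \<sigma>3_def by (rule runs_push) (use Cons.prems assms(3) in \<open>simp add: \<sigma>1_def \<sigma>2_def\<close>)
    have "runs (Cond i (\<lambda>s. s = Bit True) (Seq (pop i) (push j True)) (Seq (pop i) (push j False))) \<sigma>1 (1 + 2 + 2) \<sigma>3"
      by (rule runs_Cond) (use runs_Seq[OF 2 3] in \<open>auto simp: \<sigma>1_def\<close>)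
    then have B: "runs ?B \<sigma> 6 \<sigma>3"
      by (rule runs_mono[OF runs_Seq[OF 1]]) simp
    have "runs (While i (\<lambda>s. s = Bit True) ?B) \<sigma>3 (8 * length u + 1)
        (\<sigma>3(i := stk (False # v), j := stk (rev u @ b # w)))"
      by (rule Cons.IH) (use assms(3) in \<open>simp_all add: \<sigma>2_def \<sigma>3_def\<close>)
    moreover have "\<sigma>3(i := stk (False # v), j := stk (rev u @ b # w)) =
        \<sigma>(i := stk (False # v), j := stk (rev (b # u) @ w))"
      by (auto simp: \<sigma>1_def \<sigma>2_def \<sigma>3_def fun_eq_iff)
    ultimately have "runs (While i (\<lambda>s. s = Bit True) ?B) \<sigma> (6 + (8 * length u + 1) + 2)
        (\<sigma>(i := stk (False # v), j := stk (rev (b # u) @ w)))"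
      using B Cons.prems by (intro runs_WhileT) auto
    then show ?case
      by (rule runs_mono) simp
  qed
  then have "runs (While i (\<lambda>s. s = Bit True) ?B) \<sigma> (8 * length u + 1) (\<sigma>(i := stk (False # v), j := stk (rev u @ w)))"
    using assms by blast
  moreover have "runs (pop i) (\<sigma>(i := stk (False # v), j := stk (rev u @ w))) 1
      ((\<sigma>(i := stk (False # v), j := stk (rev u @ w)))(i := stk v))"
    by (rule runs_pop) (use assms in simp)
  ultimately have "runs (runquote i j) \<sigma> (8 * length u + 1 + 1) ((\<sigma>(i := stk (False # v), j := stk (rev u @ w)))(i := stk v))"
    unfolding runquote_def by (rule runs_Seq)
  moreover have "(\<sigma>(i := stk (False # v), j := stk (rev u @ w)))(i := stk v) = \<sigma>(i := stk v, j := stk (rev u @ w))"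
    using assms(3) by (auto simp: fun_eq_iff)
  ultimately show ?thesis
    by simp
qed

primrec pushes :: "nat \<Rightarrow> bool list \<Rightarrow> com" where
  "pushes i [] = Go i Stay"
| "pushes i (b # u) = Seq (pushes i u) (push i b)"

lemma runs_pushes:
  assumes "\<sigma> i = stk []"
  shows "runs (pushes i u) \<sigma> (2 * length u + 1) (\<sigma>(i := stk u))"
proof (induction u)
  case Nil
  have "\<sigma>(i := stk []) = \<sigma>"
    using assms by auto
  then show ?case
    using runs_skip[of i \<sigma>] by simp
next
  case (Cons b u)
  have "runs (Seq (pushes i u) (push i b)) \<sigma> (2 * length u + 1 + 2) ((\<sigma>(i := stk u))(i := stk (b # u)))"
    by (rule runs_Seq[OF Cons.IH runs_push]) simp
  then show ?case
    by (simp only: pushes.simps fun_upd_upd) (erule runs_mono, simp)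
qed

section \<open>Polynomial-time functions on data types\<close>

text \<open>The bounds need not be polynomials themselves, so the step counts of concrete programs
  can be used as they arise.\<close>

definition pbounded :: "(nat \<Rightarrow> nat) \<Rightarrow> bool" where
  "pbounded T \<longleftrightarrow> (\<exists>p :: nat poly. \<forall>n. T n \<le> poly p n)"

named_theorems pbounded_intros

lemma pbounded_poly [pbounded_intros]:
  assumes "pbounded T"
  shows "pbounded (\<lambda>n. poly p (T n))"
proof -
  obtain q where q: "\<And>n. T n \<le> poly q n"
    using assms unfolding pbounded_def by blast
  have "poly p (T n) \<le> poly (pcompose p q) n" for n
    unfolding poly_pcompose by (rule poly_mono_nat) (rule q)
  then show ?thesis
    unfolding pbounded_def by blast
qed

lemma pbounded_const [pbounded_intros]: "pbounded (\<lambda>n. k)"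
  unfolding pbounded_def by (rule exI[of _ "[:k:]"]) simp

lemma pbounded_id [pbounded_intros]: "pbounded (\<lambda>n. n)"
  unfolding pbounded_def by (rule exI[of _ "[:0, 1:]"]) simp

lemma pbounded_add [pbounded_intros]: "pbounded S \<Longrightarrow> pbounded T \<Longrightarrow> pbounded (\<lambda>n. S n + T n)"
  unfolding pbounded_def by (metis add_mono poly_add)

lemma pbounded_mult [pbounded_intros]: "pbounded S \<Longrightarrow> pbounded T \<Longrightarrow> pbounded (\<lambda>n. S n * T n)"
  unfolding pbounded_def by (metis mult_le_mono poly_mult)

lemma pbounded_Suc [pbounded_intros]: "pbounded T \<Longrightarrow> pbounded (\<lambda>n. Suc (T n))"
  using pbounded_add[OF _ pbounded_const[of 1]] by simp

section \<open>Codes of data as bit strings\<close>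

class data =
  fixes code :: "'a \<Rightarrow> bool list"

abbreviation csz :: "'a :: data \<Rightarrow> nat" where
  "csz a \<equiv> length (code a)"

instantiation unit :: data
begin
definition code_unit :: "unit \<Rightarrow> bool list" where "code_unit u = []"
instance ..
end

instantiation bool :: data
begin
definition code_bool :: "bool \<Rightarrow> bool list" where "code_bool b = [b]"
instance ..
end

text \<open>Unary with \<open>False\<close>, which is \<open>quote []\<close>: a number gets the
  same code as the list of that many units, and arithmetic becomes list processing.\<close>

instantiation nat :: data
begin
definition code_nat :: "nat \<Rightarrow> bool list" where "code_nat n = replicate n False"
instance ..
end

text \<open>Only the first component needs a delimiter; the second one extends to the end of the
  code.\<close>

instantiation prod :: (data, data) data
begin
definition code_prod :: "'a \<times> 'b \<Rightarrow> bool list" where "code_prod p = quote (code (fst p)) @ code (snd p)"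
instance ..
end

instantiation list :: (data) data
begin
definition code_list :: "'a list \<Rightarrow> bool list" where "code_list xs = concat (map (\<lambda>x. quote (code x)) xs)"
instance ..
end

instantiation option :: (data) data
begin
definition code_option :: "'a option \<Rightarrow> bool list" where
  "code_option x = (case x of None \<Rightarrow> [] | Some a \<Rightarrow> quote (code a))"
instance ..
end

lemma code_simps [simp]:
  "code () = []"
  "code t = [t]"
  "code (0 :: nat) = []"
  "code (Suc n) = False # code n"
  "code (m + n :: nat) = code m @ code n"
  "code (a, b) = quote (code a) @ code b"
  "code ([] :: 'a list) = []"
  "code (x # xs) = quote (code x) @ code xs"
  "code (xs @ ys) = code xs @ code ys"
  "code (None :: 'a option) = []"
  "code (Some x) = quote (code x)"
  for t :: bool and m n :: nat and a :: "'a :: data" and b :: "'b :: data" and x :: "'a :: data"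
  by (simp_all add: code_unit_def code_bool_def code_nat_def code_prod_def code_list_def code_option_def replicate_add)

lemma quote_neq_Nil [simp]: "quote u \<noteq> []"
  by (cases u) auto

lemma csz_nat [simp]: "csz (n :: nat) = n"
  by (simp add: code_nat_def)

lemma code_Nil_iff [simp]:
  "code n = [] \<longleftrightarrow> n = 0"
  "code xs = [] \<longleftrightarrow> xs = []"
  "code ov = [] \<longleftrightarrow> ov = None"
  for n :: nat and xs :: "'a :: data list" and ov :: "'b :: data option"
  by (cases n; cases xs; cases ov; simp)+

section \<open>Functions computed by programs in polynomial time\<close>

definition computes :: "com \<Rightarrow> nat \<Rightarrow> nat \<Rightarrow> bool list \<Rightarrow> bool list \<Rightarrow> bool" where
  "computes c d T u v \<longleftrightarrow>
     (\<forall>\<sigma>. \<sigma> d = stk u \<longrightarrow> (\<forall>r>d. \<sigma> r = stk []) \<longrightarrow> runs c \<sigma> T (\<sigma>(d := stk v)))"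

text \<open>
  Argument and result are in register \<open>d\<close>. Registers below \<open>d\<close> belong to the caller,
  those above are empty and may be used.
\<close>

definition FPon :: "'a set \<Rightarrow> ('a :: data \<Rightarrow> 'b :: data) \<Rightarrow> bool" where
  "FPon A f \<longleftrightarrow> (\<forall>d. \<exists>c T. pbounded T \<and>
     (\<forall>a\<in>A. csz (f a) \<le> T (csz a) \<and> computes c d (T (csz a)) (code a) (code (f a))))"

abbreviation FP :: "('a :: data \<Rightarrow> 'b :: data) \<Rightarrow> bool" where
  "FP \<equiv> FPon UNIV"

lemma computes_mono: "computes c d T u v \<Longrightarrow> T \<le> T' \<Longrightarrow> computes c d T' u v"
  unfolding computes_def by (meson runs_mono)

lemma computesD:
  "computes c d T u v \<Longrightarrow> \<sigma> d = stk u \<Longrightarrow> (\<And>r. r > d \<Longrightarrow> \<sigma> r = stk []) \<Longrightarrow>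
    runs c \<sigma> T (\<sigma>(d := stk v))"
  unfolding computes_def by blast

lemma FPon_witness:
  assumes "pbounded S" "pbounded T"
    "\<And>a. a \<in> A \<Longrightarrow> csz (f a) \<le> S (csz a) \<and> computes c d (T (csz a)) (code a) (code (f a))"
  shows "\<exists>c S T. pbounded S \<and> pbounded T \<and>
     (\<forall>a\<in>A. csz (f a) \<le> S (csz a) \<and> computes c d (T (csz a)) (code a) (code (f a)))"
  using assms by blast

text \<open>Size and time may be bounded separately here; their sum is the common bound that
  \<open>FPon_def\<close> asks for.\<close>

lemma FPonI:
  assumes "\<And>d. \<exists>c S T. pbounded S \<and> pbounded T \<and>
     (\<forall>a\<in>A. csz (f a) \<le> S (csz a) \<and> computes c d (T (csz a)) (code a) (code (f a)))"
  shows "FPon A f"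
  unfolding FPon_def
proof
  fix d
  obtain c S T where *: "pbounded S" "pbounded T"
    "\<And>a. a \<in> A \<Longrightarrow> csz (f a) \<le> S (csz a) \<and> computes c d (T (csz a)) (code a) (code (f a))"
    using assms[of d] by blast
  have "pbounded (\<lambda>n. S n + T n)"
    by (intro pbounded_intros *)
  moreover have "csz (f a) \<le> S (csz a) + T (csz a) \<and> computes c d (S (csz a) + T (csz a)) (code a) (code (f a))"
    if "a \<in> A" for a
    using *(3)[OF that] by (auto intro: computes_mono)
  ultimately show "\<exists>c T. pbounded T \<and>
     (\<forall>a\<in>A. csz (f a) \<le> T (csz a) \<and> computes c d (T (csz a)) (code a) (code (f a)))"
    by blast
qed

lemma FPonD:
  assumes "FPon A f"
  shows "\<exists>c p. (\<forall>a\<in>A. csz (f a) \<le> poly p (csz a)) \<and>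
    (\<forall>a\<in>A. computes c d (poly p (csz a)) (code a) (code (f a)))"
proof -
  obtain c T where T: "pbounded T"
    "\<And>a. a \<in> A \<Longrightarrow> csz (f a) \<le> T (csz a) \<and> computes c d (T (csz a)) (code a) (code (f a))"
    using assms unfolding FPon_def by blast
  obtain p where "\<And>n. T n \<le> poly p n"
    using T(1) unfolding pbounded_def by blast
  then have "csz (f a) \<le> poly p (csz a)" "computes c d (poly p (csz a)) (code a) (code (f a))" if "a \<in> A" for a
    using T(2)[OF that] by (blast intro: order_trans computes_mono)+
  then show ?thesis
    by blast
qed

lemma FP_size:
  assumes "FPon A f"
  obtains p where "\<And>a. a \<in> A \<Longrightarrow> csz (f a) \<le> poly p (csz a)"
  using FPonD[OF assms, of 0] by blast

lemma FPon_subset: "FPon A f \<Longrightarrow> B \<subseteq> A \<Longrightarrow> FPon B f"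
  unfolding FPon_def by (meson subsetD)

lemma FPon_cong: "FPon A f \<Longrightarrow> (\<And>a. a \<in> A \<Longrightarrow> f a = g a) \<Longrightarrow> FPon A g"
  unfolding FPon_def by metis

text \<open>
  As, for instance, \<open>x # xs\<close> and \<open>(x, xs)\<close> have the same code, the constructors and
  destructors of most types need no programs of their own.
\<close>

lemma FPon_recode:
  assumes "FPon A f" and "\<And>b. b \<in> B \<Longrightarrow> \<phi> b \<in> A \<and> code b = code (\<phi> b) \<and> code (g b) = code (f (\<phi> b))"
  shows "FPon B g"
  using assms unfolding FPon_def by metis

named_theorems FP_intros

lemma FP_id [FP_intros]: "FPon A (\<lambda>x. x)"
proof (rule FPonI)
  fix d
  have "computes (Go d Stay) d 1 u u" for u
    unfolding computes_def using runs_skip by (metis fun_upd_triv)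
  then show "\<exists>c S T. pbounded S \<and> pbounded T \<and>
      (\<forall>a\<in>A. csz a \<le> S (csz a) \<and> computes c d (T (csz a)) (code a) (code a))"
    by (intro FPon_witness[where c = "Go d Stay" and S = "\<lambda>n. n" and T = "\<lambda>n. 1"]) (auto intro: pbounded_intros)
qed

lemma computes_Seq:
  "computes c\<^sub>1 d T\<^sub>1 u v \<Longrightarrow> computes c\<^sub>2 d T\<^sub>2 v w \<Longrightarrow> computes (Seq c\<^sub>1 c\<^sub>2) d (T\<^sub>1 + T\<^sub>2) u w"
  unfolding computes_def by (metis fun_upd_same fun_upd_other fun_upd_upd less_irrefl runs_Seq)

lemma FPon_comp:
  assumes f: "FPon A f" and g: "FPon B g" and AB: "\<And>x. x \<in> A \<Longrightarrow> f x \<in> B"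
  shows "FPon A (\<lambda>x. g (f x))"
proof (rule FPonI)
  fix d
  obtain c p where c: "\<And>a. a \<in> A \<Longrightarrow> csz (f a) \<le> poly p (csz a)"
    "\<And>a. a \<in> A \<Longrightarrow> computes c d (poly p (csz a)) (code a) (code (f a))"
    using FPonD[OF f, of "d"] by blast
  obtain c' q where c': "\<And>a. a \<in> B \<Longrightarrow> csz (g a) \<le> poly q (csz a)"
    "\<And>a. a \<in> B \<Longrightarrow> computes c' d (poly q (csz a)) (code a) (code (g a))"
    using FPonD[OF g, of "d"] by blast
  have "csz (g (f a)) \<le> poly q (poly p (csz a)) \<and>
     computes (Seq c c') d (poly p (csz a) + poly q (poly p (csz a))) (code a) (code (g (f a)))" if a: "a \<in> A" for a
  proof -
    have "poly q (csz (f a)) \<le> poly q (poly p (csz a))"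
      by (rule poly_mono_nat[OF c(1)[OF a]])
    then show ?thesis
      using c'(1)[OF AB[OF a]] computes_mono[OF computes_Seq[OF c(2)[OF a] c'(2)[OF AB[OF a]]]] by auto
  qed
  then show "\<exists>c S T. pbounded S \<and> pbounded T \<and>
      (\<forall>a\<in>A. csz (g (f a)) \<le> S (csz a) \<and> computes c d (T (csz a)) (code a) (code (g (f a))))"
    by (intro FPon_witness[where c = "Seq c c'" and S = "\<lambda>n. poly q (poly p n)" and T = "\<lambda>n. poly p n + poly q (poly p n)"])
       (auto intro!: pbounded_intros)
qed

lemma FP_comp: "FP g \<Longrightarrow> FPon A f \<Longrightarrow> FPon A (\<lambda>x. g (f x))"
  by (rule FPon_comp) auto

lemma FP_const [FP_intros]: "FPon A (\<lambda>x. k)"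
proof (rule FPonI)
  fix d
  have *: "computes (Seq (clear d) (pushes d (code k))) d ((6 * length u + 1) + (2 * csz k + 1)) u (code k)" for u
    unfolding computes_def
  proof (intro allI impI)
    fix \<sigma> :: store
    assume "\<sigma> d = stk u"
    from runs_Seq[OF runs_clear[of \<sigma> d u, OF this] runs_pushes[of "\<sigma>(d := stk [])" d "code k"]]
    show "runs (Seq (clear d) (pushes d (code k))) \<sigma> ((6 * length u + 1) + (2 * csz k + 1)) (\<sigma>(d := stk (code k)))"
      by (metis fun_upd_same fun_upd_upd)
  qed
  show "\<exists>c S T. pbounded S \<and> pbounded T \<and>
      (\<forall>a\<in>A. csz k \<le> S (csz a) \<and> computes c d (T (csz a)) (code a) (code k))"
    by (intro FPon_witness[where c = "Seq (clear d) (pushes d (code k))" and S = "\<lambda>n. csz k" and T = "\<lambda>n. (6 * n + 1) + (2 * csz k + 1)"])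
       (use *[of "code _"] in \<open>auto intro!: pbounded_intros\<close>)
qed

text \<open>\<open>f\<close> runs on a copy of the argument in \<open>d + 1\<close>, and its result
  waits there while \<open>g\<close> runs on another copy in \<open>d + 2\<close>. This is why
  \<open>FPon\<close> demands a program for every base register.\<close>

lemma FP_Pair [FP_intros]:
  assumes f: "FPon A f" and g: "FPon A g"
  shows "FPon A (\<lambda>x. (f x, g x))"
proof (rule FPonI)
  fix d
  obtain c p where c: "\<And>a. a \<in> A \<Longrightarrow> csz (f a) \<le> poly p (csz a)"
    "\<And>a. a \<in> A \<Longrightarrow> computes c (d + 1) (poly p (csz a)) (code a) (code (f a))"
    using FPonD[OF f, of "d + 1"] by blast
  obtain c' q where c': "\<And>a. a \<in> A \<Longrightarrow> csz (g a) \<le> poly q (csz a)"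
    "\<And>a. a \<in> A \<Longrightarrow> computes c' (d + 2) (poly q (csz a)) (code a) (code (g a))"
    using FPonD[OF g, of "d + 2"] by blast
  let ?c = "Seq (copy d (d+1) (d+2)) (Seq c (Seq (copy d (d+2) (d+3)) (Seq c' (Seq (clear d)
    (Seq (move (d+2) d (d+3)) (Seq (rmove (d+1) (d+2)) (rquote (d+2) d)))))))"
  let ?T = "\<lambda>n. (16 * n + 2) + (poly p n + ((16 * n + 2) + (poly q n + ((6 * n + 1) + ((14 * poly q n + 2) +
    ((7 * poly p n + 1) + (9 * poly p n + 3)))))))"
  have "computes ?c d (?T (csz a)) (code a) (code (f a, g a))" if a: "a \<in> A" for a
    unfolding computes_def
  proof (intro allI impI)
    fix \<sigma> :: store
    assume \<sigma>: "\<sigma> d = stk (code a)" "\<forall>r>d. \<sigma> r = stk []"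
    define u F G where [simp]: "u = code a" "F = code (f a)" "G = code (g a)"
    define \<sigma>1 where "\<sigma>1 = \<sigma>(d+1 := stk u)"
    define \<sigma>2 where "\<sigma>2 = \<sigma>1(d+1 := stk F)"
    define \<sigma>3 where "\<sigma>3 = \<sigma>2(d+2 := stk u)"
    define \<sigma>4 where "\<sigma>4 = \<sigma>3(d+2 := stk G)"
    define \<sigma>5 where "\<sigma>5 = \<sigma>4(d := stk [])"
    define \<sigma>6 where "\<sigma>6 = \<sigma>5(d+2 := stk [], d := stk (G @ []))"
    \<comment> \<open>The reversal of \<open>F\<close> by \<open>rmove\<close> is cancelled by the
      one in \<open>rquote\<close>.\<close>
    define \<sigma>7 where "\<sigma>7 = \<sigma>6(d+1 := stk [], d+2 := stk (rev F @ []))"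
    define \<sigma>8 where "\<sigma>8 = \<sigma>7(d+2 := stk [], d := stk (quote (rev (rev F)) @ G))"
    note defs = \<sigma>1_def \<sigma>2_def \<sigma>3_def \<sigma>4_def \<sigma>5_def \<sigma>6_def \<sigma>7_def
    have 1: "runs (copy d (d+1) (d+2)) \<sigma> (16 * csz a + 2) \<sigma>1"
      using runs_copy[of \<sigma> d u "d+1" "d+2"] \<sigma> by (simp add: \<sigma>1_def)
    have 2: "runs c \<sigma>1 (poly p (csz a)) \<sigma>2"
      unfolding \<sigma>2_def u_F_G_def by (rule computesD[OF c(2)[OF a]]) (use \<sigma> in \<open>simp_all add: \<sigma>1_def\<close>)
    have 3: "runs (copy d (d+2) (d+3)) \<sigma>2 (16 * csz a + 2) \<sigma>3"
      using runs_copy[of \<sigma>2 d u "d+2" "d+3"] \<sigma> by (simp add: \<sigma>1_def \<sigma>2_def \<sigma>3_def)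
    have 4: "runs c' \<sigma>3 (poly q (csz a)) \<sigma>4"
      unfolding \<sigma>4_def u_F_G_def by (rule computesD[OF c'(2)[OF a]]) (use \<sigma> in \<open>simp_all add: \<sigma>1_def \<sigma>2_def \<sigma>3_def\<close>)
    have 5: "runs (clear d) \<sigma>4 (6 * length u + 1) \<sigma>5"
      unfolding \<sigma>5_def by (rule runs_clear) (use \<sigma> in \<open>simp add: defs\<close>)
    have 6: "runs (move (d+2) d (d+3)) \<sigma>5 (14 * length G + 2) \<sigma>6"
      unfolding \<sigma>6_def by (rule runs_move) (use \<sigma> in \<open>simp_all add: defs\<close>)
    have 7: "runs (rmove (d+1) (d+2)) \<sigma>6 (7 * length F + 1) \<sigma>7"
      unfolding \<sigma>7_def by (rule runs_rmove) (use \<sigma> in \<open>simp_all add: defs\<close>)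
    have 8: "runs (rquote (d+2) d) \<sigma>7 (9 * length (rev F) + 3) \<sigma>8"
      unfolding \<sigma>8_def by (rule runs_rquote) (use \<sigma> in \<open>simp_all add: defs\<close>)
    have eq: "\<sigma>8 = \<sigma>(d := stk (code (f a, g a)))"
      using \<sigma> by (auto simp: defs \<sigma>8_def fun_eq_iff)
    show "runs ?c \<sigma> (?T (csz a)) (\<sigma>(d := stk (code (f a, g a))))"
      unfolding eq[symmetric]
      by (rule runs_mono[OF runs_Seq[OF 1 runs_Seq[OF 2 runs_Seq[OF 3 runs_Seq[OF 4 runs_Seq[OF 5 runs_Seq[OF 6
            runs_Seq[OF 7 8]]]]]]]])
         (use c(1)[OF a] c'(1)[OF a] in simp)
  qed
  moreover have "csz (f a, g a) \<le> 2 * poly p (csz a) + 1 + poly q (csz a)" if "a \<in> A" for a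
    using c(1)[OF that] c'(1)[OF that] by simp
  moreover have "pbounded ?T" "pbounded (\<lambda>n. 2 * poly p n + 1 + poly q n)"
    by (intro pbounded_intros)+
  ultimately show "\<exists>c S T. pbounded S \<and> pbounded T \<and>
      (\<forall>a\<in>A. csz (f a, g a) \<le> S (csz a) \<and> computes c d (T (csz a)) (code a) (code (f a, g a)))"
    by blast
qed

lemma FP_fst_prim: "FP (fst :: 'a :: data \<times> 'b :: data \<Rightarrow> 'a)"
proof (rule FPonI)
  fix d
  let ?c = "Seq (runquote d (d+1)) (Seq (clear d) (rmove (d+1) d))"
  let ?T = "\<lambda>n. (8 * n + 2) + ((6 * n + 1) + (7 * n + 1))"
  have "computes ?c d (?T (csz x)) (code x) (code (fst x))" for x :: "'a \<times> 'b"
    unfolding computes_def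
  proof (intro allI impI)
    fix \<sigma> :: store
    assume \<sigma>: "\<sigma> d = stk (code x)" "\<forall>r>d. \<sigma> r = stk []"
    define u v where "u = code (fst x)" "v = code (snd x)"
    have x: "code x = quote u @ v"
      by (simp add: u_v_def code_prod_def)
    define \<sigma>1 where "\<sigma>1 = \<sigma>(d := stk v, d+1 := stk (rev u @ []))"
    define \<sigma>2 where "\<sigma>2 = \<sigma>1(d := stk [])"
    define \<sigma>3 where "\<sigma>3 = \<sigma>2(d+1 := stk [], d := stk (rev (rev u) @ []))"
    have 1: "runs (runquote d (d+1)) \<sigma> (8 * length u + 2) \<sigma>1"
      unfolding \<sigma>1_def by (rule runs_runquote) (use \<sigma> x in simp_all)
    have 2: "runs (clear d) \<sigma>1 (6 * length v + 1) \<sigma>2"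
      unfolding \<sigma>2_def by (rule runs_clear) (simp add: \<sigma>1_def)
    have 3: "runs (rmove (d+1) d) \<sigma>2 (7 * length (rev u) + 1) \<sigma>3"
      unfolding \<sigma>3_def by (rule runs_rmove) (simp_all add: \<sigma>1_def \<sigma>2_def)
    have eq: "\<sigma>3 = \<sigma>(d := stk (code (fst x)))"
      using \<sigma> by (auto simp: \<sigma>1_def \<sigma>2_def \<sigma>3_def u_v_def fun_eq_iff)
    show "runs ?c \<sigma> (?T (csz x)) (\<sigma>(d := stk (code (fst x))))"
      unfolding eq[symmetric] by (rule runs_mono[OF runs_Seq[OF 1 runs_Seq[OF 2 3]]]) (simp add: x)
  qed
  moreover have "csz (fst x) \<le> csz x" for x :: "'a \<times> 'b"
    by (simp add: code_prod_def)
  moreover have "pbounded ?T" "pbounded (\<lambda>n. n)"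
    by (intro pbounded_intros)+
  ultimately show "\<exists>c S T. pbounded S \<and> pbounded T \<and>
      (\<forall>x :: 'a \<times> 'b \<in> UNIV. csz (fst x) \<le> S (csz x) \<and> computes c d (T (csz x)) (code x) (code (fst x)))"
    by blast
qed

lemma FP_snd_prim: "FP (snd :: 'a :: data \<times> 'b :: data \<Rightarrow> 'b)"
proof (rule FPonI)
  fix d
  let ?c = "Seq (runquote d (d+1)) (clear (d+1))"
  let ?T = "\<lambda>n. (8 * n + 2) + (6 * n + 1)"
  have "computes ?c d (?T (csz x)) (code x) (code (snd x))" for x :: "'a \<times> 'b"
    unfolding computes_def
  proof (intro allI impI)
    fix \<sigma> :: store
    assume \<sigma>: "\<sigma> d = stk (code x)" "\<forall>r>d. \<sigma> r = stk []"
    define u v where "u = code (fst x)" "v = code (snd x)"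
    have x: "code x = quote u @ v"
      by (simp add: u_v_def code_prod_def)
    define \<sigma>1 where "\<sigma>1 = \<sigma>(d := stk v, d+1 := stk (rev u @ []))"
    define \<sigma>2 where "\<sigma>2 = \<sigma>1(d+1 := stk [])"
    have 1: "runs (runquote d (d+1)) \<sigma> (8 * length u + 2) \<sigma>1"
      unfolding \<sigma>1_def by (rule runs_runquote) (use \<sigma> x in simp_all)
    have 2: "runs (clear (d+1)) \<sigma>1 (6 * length (rev u) + 1) \<sigma>2"
      unfolding \<sigma>2_def by (rule runs_clear) (simp add: \<sigma>1_def)
    have eq: "\<sigma>2 = \<sigma>(d := stk (code (snd x)))"
      using \<sigma> by (auto simp: \<sigma>1_def \<sigma>2_def u_v_def fun_eq_iff)
    show "runs ?c \<sigma> (?T (csz x)) (\<sigma>(d := stk (code (snd x))))"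
      unfolding eq[symmetric] by (rule runs_mono[OF runs_Seq[OF 1 2]]) (simp add: x)
  qed
  moreover have "csz (snd x) \<le> csz x" for x :: "'a \<times> 'b"
    by (simp add: code_prod_def)
  moreover have "pbounded ?T" "pbounded (\<lambda>n. n)"
    by (intro pbounded_intros)+
  ultimately show "\<exists>c S T. pbounded S \<and> pbounded T \<and>
      (\<forall>x :: 'a \<times> 'b \<in> UNIV. csz (snd x) \<le> S (csz x) \<and> computes c d (T (csz x)) (code x) (code (snd x)))"
    by blast
qed

lemmas FP_fst [FP_intros] = FP_comp[OF FP_fst_prim]
lemmas FP_snd [FP_intros] = FP_comp[OF FP_snd_prim]

text \<open>One test on codes that serves for the empty list, for zero and for
  \<open>None\<close>.\<close>

lemma FP_code_Nil_prim: "FP (\<lambda>x :: 'a :: data. code x = [])"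
proof (rule FPonI)
  fix d
  let ?c = "Cond d (\<lambda>s. s = Blank) (push d True) (Seq (clear d) (push d False))"
  let ?T = "\<lambda>n. (6 * n + 1) + 2 + 2"
  have "computes ?c d (?T (length u)) u [u = []]" for u
    unfolding computes_def
  proof (intro allI impI)
    fix \<sigma> :: store
    assume \<sigma>: "\<sigma> d = stk u" "\<forall>r>d. \<sigma> r = stk []"
    have "runs (push d True) \<sigma> 2 (\<sigma>(d := stk [u = []]))" if "u = []"
      using runs_push[of \<sigma> d "[]" True] that \<sigma> by simp
    moreover have "runs (Seq (clear d) (push d False)) \<sigma> ((6 * length u + 1) + 2) (\<sigma>(d := stk [u = []]))" if "u \<noteq> []"
      using runs_Seq[OF runs_clear[of \<sigma> d u] runs_push[of _ d "[]" False]] that \<sigma> by simp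
    ultimately have "runs (if tape_read (\<sigma> d) = Blank then push d True else Seq (clear d) (push d False))
        \<sigma> ((6 * length u + 1) + 2) (\<sigma>(d := stk [u = []]))"
      using \<sigma> by (cases u) (auto intro: runs_mono)
    then show "runs ?c \<sigma> (?T (length u)) (\<sigma>(d := stk [u = []]))"
      by (rule runs_Cond)
  qed
  moreover have "pbounded ?T" "pbounded (\<lambda>n. 1)"
    by (intro pbounded_intros)+
  ultimately show "\<exists>c S T. pbounded S \<and> pbounded T \<and>
      (\<forall>a :: 'a \<in> UNIV. csz (code a = []) \<le> S (csz a) \<and> computes c d (T (csz a)) (code a) (code (code a = [])))"
    by (intro FPon_witness[where c = ?c and S = "\<lambda>n. 1" and T = ?T]) auto
qed

lemmas FP_code_Nil = FP_comp[OF FP_code_Nil_prim]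

text \<open>Each branch only has to be computable where it is taken. Together with domains this
  allows partial operations such as \<open>hd\<close> to be treated first on the arguments where
  recoding applies.\<close>

lemma FPon_if:
  assumes b: "FPon A b" and f: "FPon (A \<inter> {x. b x}) f" and g: "FPon (A \<inter> {x. \<not> b x}) g"
  shows "FPon A (\<lambda>x. if b x then f x else g x)"
proof (rule FPonI)
  fix d
  obtain c r where c: "\<And>a. a \<in> A \<Longrightarrow> computes c (d+1) (poly r (csz a)) (code a) (code (b a))"
    using FPonD[OF b, of "d+1"] by blast
  obtain c1 p where c1: "\<And>a. a \<in> A \<inter> {x. b x} \<Longrightarrow> csz (f a) \<le> poly p (csz a)"
    "\<And>a. a \<in> A \<inter> {x. b x} \<Longrightarrow> computes c1 d (poly p (csz a)) (code a) (code (f a))"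
    using FPonD[OF f, of "d"] by blast
  obtain c2 q where c2: "\<And>a. a \<in> A \<inter> {x. \<not> b x} \<Longrightarrow> csz (g a) \<le> poly q (csz a)"
    "\<And>a. a \<in> A \<inter> {x. \<not> b x} \<Longrightarrow> computes c2 d (poly q (csz a)) (code a) (code (g a))"
    using FPonD[OF g, of "d"] by blast
  let ?c = "Seq (copy d (d+1) (d+2)) (Seq c (Cond (d+1) (\<lambda>s. s = Bit True) (Seq (pop (d+1)) c1) (Seq (pop (d+1)) c2)))"
  let ?T = "\<lambda>n. (16 * n + 2) + (poly r n + (1 + (poly p n + poly q n) + 2))"
  let ?h = "\<lambda>x. if b x then f x else g x"
  have "computes ?c d (?T (csz a)) (code a) (code (?h a))" if a: "a \<in> A" for a
    unfolding computes_def
  proof (intro allI impI)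
    fix \<sigma> :: store
    assume \<sigma>: "\<sigma> d = stk (code a)" "\<forall>r>d. \<sigma> r = stk []"
    define \<sigma>1 where "\<sigma>1 = \<sigma>(d+1 := stk (code a))"
    define \<sigma>2 where "\<sigma>2 = \<sigma>1(d+1 := stk [b a])"
    have 1: "runs (copy d (d+1) (d+2)) \<sigma> (16 * csz a + 2) \<sigma>1"
      using runs_copy[of \<sigma> d "code a" "d+1" "d+2"] \<sigma> by (simp add: \<sigma>1_def)
    have 2: "runs c \<sigma>1 (poly r (csz a)) \<sigma>2"
      unfolding \<sigma>2_def code_simps(2)[symmetric]
      by (rule computesD[OF c[OF a]]) (use \<sigma> in \<open>simp_all add: \<sigma>1_def\<close>)
    have "\<sigma>2(d+1 := stk []) = \<sigma>"
      using \<sigma> by (auto simp: \<sigma>1_def \<sigma>2_def)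
    then have 3: "runs (pop (d+1)) \<sigma>2 1 \<sigma>"
      using runs_pop[of \<sigma>2 "d+1" "b a" "[]"] by (simp add: \<sigma>2_def)
    have "runs (if b a then c1 else c2) \<sigma> (poly p (csz a) + poly q (csz a)) (\<sigma>(d := stk (code (?h a))))"
    proof (cases "b a")
      case True
      then have "runs c1 \<sigma> (poly p (csz a)) (\<sigma>(d := stk (code (f a))))"
        using c1(2)[of a] a \<sigma> unfolding computes_def by blast
      then show ?thesis
        using True by (auto intro: runs_mono)
    next
      case False
      then have "runs c2 \<sigma> (poly q (csz a)) (\<sigma>(d := stk (code (g a))))"
        using c2(2)[of a] a \<sigma> unfolding computes_def by blast
      then show ?thesis
        using False by (auto intro: runs_mono)
    qed
    from runs_Seq[OF 3 this]
    have "runs (Cond (d+1) (\<lambda>s. s = Bit True) (Seq (pop (d+1)) c1) (Seq (pop (d+1)) c2)) \<sigma>2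
        (1 + (poly p (csz a) + poly q (csz a)) + 2) (\<sigma>(d := stk (code (?h a))))"
      by (intro runs_Cond) (auto simp: \<sigma>2_def)
    then show "runs ?c \<sigma> (?T (csz a)) (\<sigma>(d := stk (code (?h a))))"
      using runs_Seq 1 2 by blast
  qed
  moreover have "csz (?h a) \<le> poly p (csz a) + poly q (csz a)" if a: "a \<in> A" for a
    using c1(1)[of a] c2(1)[of a] a by auto
  moreover have "pbounded ?T" "pbounded (\<lambda>n. poly p n + poly q n)"
    by (intro pbounded_intros)+
  ultimately show "\<exists>c S T. pbounded S \<and> pbounded T \<and>
      (\<forall>a\<in>A. csz (?h a) \<le> S (csz a) \<and> computes c d (T (csz a)) (code a) (code (?h a)))"
    by blast
qed

text \<open>The code of \<open>n x\<close> is a counter that loses one bit per round. As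
  \<open>q\<close> bounds all intermediate results, every round takes at most
  \<open>poly p (poly q (csz x))\<close> steps apart from the loop overhead.\<close>

lemma FP_iterate:
  fixes F :: "'a :: data \<Rightarrow> 'a" and n :: "'a \<Rightarrow> 'b :: data"
  assumes F: "FP F" and n: "FPon A n"
    and q: "\<And>x i. x \<in> A \<Longrightarrow> i \<le> csz (n x) \<Longrightarrow> csz ((F ^^ i) x) \<le> poly q (csz x)"
  shows "FPon A (\<lambda>x. (F ^^ csz (n x)) x)"
proof (rule FPonI)
  fix d
  obtain c p where c: "\<And>a. csz (F a) \<le> poly p (csz a)"
    "\<And>a. computes c (d+1) (poly p (csz a)) (code a) (code (F a))"
    using FPonD[OF F, of "d+1"] by blast
  obtain c' r where c': "\<And>a. a \<in> A \<Longrightarrow> csz (n a) \<le> poly r (csz a)"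
    "\<And>a. a \<in> A \<Longrightarrow> computes c' (d+1) (poly r (csz a)) (code a) (code (n a))"
    using FPonD[OF n, of "d+1"] by blast
  let ?W = "While d (\<lambda>s. s \<noteq> Blank) (Seq (pop d) c)"
  let ?c = "Seq (copy d (d+1) (d+2)) (Seq c' (Seq (move d (d+2) (d+3)) (Seq (move (d+1) d (d+3))
    (Seq (move (d+2) (d+1) (d+3)) (Seq ?W (move (d+1) d (d+2)))))))"
  let ?T = "\<lambda>n. (16 * n + 2) + (poly r n + ((14 * n + 2) + ((14 * poly r n + 2) + ((14 * n + 2) +
    (((poly p (poly q n) + 3) * poly r n + 1) + (14 * poly q n + 2))))))"
  \<comment> \<open>After \<open>i\<close> rounds the counter still holds \<open>w\<close>. A round
    costs 3 steps besides \<open>c\<close>: 1 for the pop and 2 for the loop.\<close>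
  have loop: "runs ?W \<sigma> ((poly p (poly q (csz x)) + 3) * length w + 1)
      (\<sigma>(d := stk [], d+1 := stk (code ((F ^^ (i + length w)) x))))"
    if x: "x \<in> A" and "i + length w \<le> csz (n x)" "\<sigma> d = stk w" "\<sigma> (d+1) = stk (code ((F ^^ i) x))" "\<forall>r>d+1. \<sigma> r = stk []"
    for w i x \<sigma>
    using that(2-)
  proof (induction w arbitrary: i \<sigma>)
    case Nil
    then have "\<sigma>(d := stk [], d+1 := stk (code ((F ^^ (i + 0)) x))) = \<sigma>"
      by auto
    moreover have "runs ?W \<sigma> 1 \<sigma>"
      by (rule runs_WhileF) (use Nil in simp)
    ultimately show ?case
      by (simp only: list.size mult_0_right add_0)
  next
    case (Cons b w)
    define y where "y = (F ^^ i) x"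
    define \<sigma>1 where "\<sigma>1 = \<sigma>(d := stk w)"
    define \<sigma>2 where "\<sigma>2 = \<sigma>1(d+1 := stk (code (F y)))"
    have 1: "runs (pop d) \<sigma> 1 \<sigma>1"
      unfolding \<sigma>1_def by (rule runs_pop) (use Cons.prems in simp)
    have "csz y \<le> poly q (csz x)"
      unfolding y_def by (rule q[OF x]) (use Cons.prems in simp)
    moreover have "runs c \<sigma>1 (poly p (csz y)) \<sigma>2"
      unfolding \<sigma>2_def by (rule computesD[of c]) (use Cons.prems c(2) in \<open>simp_all add: \<sigma>1_def y_def\<close>)
    ultimately have 2: "runs c \<sigma>1 (poly p (poly q (csz x))) \<sigma>2"
      using poly_mono_nat runs_mono by blast
    have 3: "runs ?W \<sigma>2 ((poly p (poly q (csz x)) + 3) * length w + 1)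
        (\<sigma>2(d := stk [], d+1 := stk (code ((F ^^ (Suc i + length w)) x))))"
      by (rule Cons.IH) (use Cons.prems in \<open>auto simp: \<sigma>1_def \<sigma>2_def y_def\<close>)
    have 4: "\<sigma>2(d := stk [], d+1 := stk (code ((F ^^ (Suc i + length w)) x))) =
        \<sigma>(d := stk [], d+1 := stk (code ((F ^^ (i + length (b # w))) x)))"
      by (auto simp: \<sigma>1_def \<sigma>2_def)
    show ?case
      unfolding 4[symmetric]
      by (rule runs_mono[OF runs_WhileT[OF _ runs_Seq[OF 1 2] 3]]) (use Cons.prems in simp_all)
  qed
  have "computes ?c d (?T (csz x)) (code x) (code ((F ^^ csz (n x)) x))" if x: "x \<in> A" for x
    unfolding computes_def
  proof (intro allI impI)
    fix \<sigma> :: store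
    assume \<sigma>: "\<sigma> d = stk (code x)" "\<forall>r>d. \<sigma> r = stk []"
    define u v w where "u = code x" "v = code (n x)" "w = code ((F ^^ csz (n x)) x)"
    define \<sigma>1 where "\<sigma>1 = \<sigma>(d+1 := stk u)"
    define \<sigma>2 where "\<sigma>2 = \<sigma>1(d+1 := stk v)"
    define \<sigma>3 where "\<sigma>3 = \<sigma>2(d := stk [], d+2 := stk (u @ []))"
    define \<sigma>4 where "\<sigma>4 = \<sigma>3(d+1 := stk [], d := stk (v @ []))"
    define \<sigma>5 where "\<sigma>5 = \<sigma>4(d+2 := stk [], d+1 := stk (u @ []))"
    define \<sigma>6 where "\<sigma>6 = \<sigma>5(d := stk [], d+1 := stk w)"
    define \<sigma>7 where "\<sigma>7 = \<sigma>6(d+1 := stk [], d := stk (w @ []))"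
    note defs = \<sigma>1_def \<sigma>2_def \<sigma>3_def \<sigma>4_def \<sigma>5_def \<sigma>6_def
    have 1: "runs (copy d (d+1) (d+2)) \<sigma> (16 * length u + 2) \<sigma>1"
      unfolding \<sigma>1_def by (rule runs_copy) (use \<sigma> in \<open>simp_all add: u_v_w_def\<close>)
    have 2: "runs c' \<sigma>1 (poly r (csz x)) \<sigma>2"
      unfolding \<sigma>2_def u_v_w_def
      by (rule computesD[of c']) (use \<sigma> c'(2)[OF x] in \<open>simp_all add: \<sigma>1_def u_v_w_def\<close>)
    have 3: "runs (move d (d+2) (d+3)) \<sigma>2 (14 * length u + 2) \<sigma>3"
      unfolding \<sigma>3_def by (rule runs_move) (use \<sigma> in \<open>simp_all add: u_v_w_def defs\<close>)
    have 4: "runs (move (d+1) d (d+3)) \<sigma>3 (14 * length v + 2) \<sigma>4"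
      unfolding \<sigma>4_def by (rule runs_move) (use \<sigma> in \<open>simp_all add: defs\<close>)
    have 5: "runs (move (d+2) (d+1) (d+3)) \<sigma>4 (14 * length u + 2) \<sigma>5"
      unfolding \<sigma>5_def by (rule runs_move) (use \<sigma> in \<open>simp_all add: defs\<close>)
    have 6: "runs ?W \<sigma>5 ((poly p (poly q (csz x)) + 3) * csz (n x) + 1) \<sigma>6"
      using loop[of x 0 "code (n x)" \<sigma>5] x \<sigma> by (simp add: defs u_v_w_def)
    have 7: "runs (move (d+1) d (d+2)) \<sigma>6 (14 * length w + 2) \<sigma>7"
      unfolding \<sigma>7_def by (rule runs_move) (use \<sigma> in \<open>simp_all add: defs\<close>)
    have eq: "\<sigma>7 = \<sigma>(d := stk w)"
      using \<sigma> by (auto simp: defs \<sigma>7_def fun_eq_iff)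
    have "length w \<le> poly q (csz x)"
      unfolding u_v_w_def by (rule q) (use x in simp_all)
    moreover have "length u = csz x" "length v \<le> poly r (csz x)" "csz (n x) \<le> poly r (csz x)"
      using c'(1)[OF x] by (simp_all add: u_v_w_def)
    ultimately have "runs ?c \<sigma> (?T (csz x)) \<sigma>7"
      by (intro runs_mono[OF runs_Seq[OF 1 runs_Seq[OF 2 runs_Seq[OF 3 runs_Seq[OF 4 runs_Seq[OF 5
            runs_Seq[OF 6 7]]]]]]] add_mono mult_le_mono order_refl) simp_all
    then show "runs ?c \<sigma> (?T (csz x)) (\<sigma>(d := stk (code ((F ^^ csz (n x)) x))))"
      unfolding eq u_v_w_def .
  qed
  moreover have "csz ((F ^^ csz (n x)) x) \<le> poly q (csz x)" if "x \<in> A" for x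
    by (rule q) (use that in simp_all)
  moreover have "pbounded ?T" "pbounded (\<lambda>n. poly q n)"
    by (intro pbounded_intros)+
  ultimately show "\<exists>c S T. pbounded S \<and> pbounded T \<and>
      (\<forall>x\<in>A. csz ((F ^^ csz (n x)) x) \<le> S (csz x) \<and> computes c d (T (csz x)) (code x) (code ((F ^^ csz (n x)) x)))"
    by blast
qed

subsection \<open>Lists and numbers\<close>

lemma FP_if [FP_intros]: "FP b \<Longrightarrow> FP f \<Longrightarrow> FP g \<Longrightarrow> FP (\<lambda>x. if b x then f x else g x)"
  by (rule FPon_if) (auto intro: FPon_subset)

lemma FP_not [FP_intros]:
  assumes "FP b"
  shows "FP (\<lambda>x. \<not> b x)"
proof -
  have "FP (\<lambda>x. if b x then False else True)"
    by (intro FP_if assms FP_const)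
  then show ?thesis
    by (rule FPon_cong) simp
qed

lemma FP_conj [FP_intros]:
  assumes "FP b" "FP c"
  shows "FP (\<lambda>x. b x \<and> c x)"
proof -
  have "FP (\<lambda>x. if b x then c x else False)"
    by (intro FP_if assms FP_const)
  then show ?thesis
    by (rule FPon_cong) simp
qed

lemma FP_disj [FP_intros]:
  assumes "FP b" "FP c"
  shows "FP (\<lambda>x. b x \<or> c x)"
proof -
  have "FP (\<lambda>x. if b x then True else c x)"
    by (intro FP_if assms FP_const)
  then show ?thesis
    by (rule FPon_cong) simp
qed

lemma FP_null [FP_intros]:
  fixes l :: "'a :: data \<Rightarrow> 'b :: data list"
  shows "FP l \<Longrightarrow> FP (\<lambda>x. l x = [])"
  using FP_code_Nil[of UNIV l] by simp

lemma FP_is_None [FP_intros]: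
  fixes l :: "'a :: data \<Rightarrow> 'b :: data option"
  shows "FP l \<Longrightarrow> FP (\<lambda>x. l x = None)"
  using FP_code_Nil[of UNIV l] by simp

lemma FP_eq_0:
  fixes l :: "'a :: data \<Rightarrow> nat"
  shows "FP l \<Longrightarrow> FP (\<lambda>x. l x = 0)"
  using FP_code_Nil[of UNIV l] by simp

lemma FP_Cons [FP_intros]:
  assumes "FP f" "FP g"
  shows "FP (\<lambda>x. f x # g x)"
  by (rule FPon_recode[OF FP_Pair[OF assms], where \<phi> = "\<lambda>x. x"]) simp

lemma FP_hd [FP_intros]:
  fixes f :: "'a :: data \<Rightarrow> 'b :: data list"
  assumes f: "FP f"
  shows "FP (\<lambda>x. hd (f x))"
proof (rule FP_comp[OF _ f])
  have "FPon {l. l \<noteq> []} (hd :: 'b list \<Rightarrow> 'b)"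
  proof (rule FPon_recode[OF FP_fst_prim[where 'a = 'b and 'b = "'b list"], where \<phi> = "\<lambda>l. (hd l, tl l)"])
    fix b :: "'b list"
    assume "b \<in> {l. l \<noteq> []}"
    then show "(hd b, tl b) \<in> UNIV \<and> code b = code (hd b, tl b) \<and> code (hd b) = code (fst (hd b, tl b))"
      by (cases b) auto
  qed
  \<comment> \<open>\<open>hd []\<close> is some fixed value, so a constant function covers the
    empty list.\<close>
  then have "FP (\<lambda>l :: 'b list. if l = [] then hd [] else hd l)"
    by (intro FPon_if FP_null FP_id FP_const) (simp add: Int_def)
  then show "FP (hd :: 'b list \<Rightarrow> 'b)"
    by (rule FPon_cong) auto
qed

lemma FP_tl [FP_intros]:
  fixes f :: "'a :: data \<Rightarrow> 'b :: data list"
  assumes f: "FP f"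
  shows "FP (\<lambda>x. tl (f x))"
proof (rule FP_comp[OF _ f])
  have "FPon {l. l \<noteq> []} (tl :: 'b list \<Rightarrow> 'b list)"
  proof (rule FPon_recode[OF FP_snd_prim[where 'a = 'b and 'b = "'b list"], where \<phi> = "\<lambda>l. (hd l, tl l)"])
    fix b :: "'b list"
    assume "b \<in> {l. l \<noteq> []}"
    then show "(hd b, tl b) \<in> UNIV \<and> code b = code (hd b, tl b) \<and> code (tl b) = code (snd (hd b, tl b))"
      by (cases b) auto
  qed
  then have "FP (\<lambda>l :: 'b list. if l = [] then [] else tl l)"
    by (intro FPon_if FP_null FP_id FP_const) (simp add: Int_def)
  then show "FP (tl :: 'b list \<Rightarrow> 'b list)"
    by (rule FPon_cong) auto
qed

abbreviation units :: "nat \<Rightarrow> unit list" where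
  "units n \<equiv> replicate n ()"

lemma code_units [simp]: "code (units n) = code n"
  by (induction n) auto

lemma FP_units [FP_intros]:
  assumes "FP f"
  shows "FP (\<lambda>x. units (f x))"
  by (rule FPon_recode[OF assms, where \<phi> = "\<lambda>x. x"]) simp

lemma FP_Suc [FP_intros]:
  assumes "FP f"
  shows "FP (\<lambda>x. Suc (f x))"
  by (rule FPon_recode[OF FP_Cons[OF FP_const[of _ "()"] FP_units[OF assms]], where \<phi> = "\<lambda>x. x"]) simp

lemma FP_Some [FP_intros]:
  assumes "FP f"
  shows "FP (\<lambda>x. Some (f x))"
  by (rule FPon_recode[OF FP_Cons[OF assms FP_const[of _ "[]"]], where \<phi> = "\<lambda>x. x"]) simp

lemma FP_the [FP_intros]:
  fixes f :: "'a :: data \<Rightarrow> 'b :: data option"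
  assumes f: "FP f"
  shows "FP (\<lambda>x. the (f x))"
proof (rule FP_comp[OF _ f])
  have "FP (hd :: 'b list \<Rightarrow> 'b)"
    using FP_hd[OF FP_id] .
  then have "FPon {v. v \<noteq> None} (the :: 'b option \<Rightarrow> 'b)"
    by (rule FPon_recode[where \<phi> = "\<lambda>v. [the v]"]) auto
  then have "FP (\<lambda>v :: 'b option. if v = None then the None else the v)"
    by (intro FPon_if FP_is_None FP_id FP_const) (simp add: Int_def)
  then show "FP (the :: 'b option \<Rightarrow> 'b)"
    by (rule FPon_cong) auto
qed

text \<open>\<open>FP\<close> speaks of functions of one argument, so the binary \<open>h\<close>
  enters in uncurried form; the rules for folds, \<open>map\<close> and \<open>list_all\<close> do
  the same.\<close>

lemma FP_case_option [FP_intros]: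
  assumes "FP f" "FP g" "FP (\<lambda>p. h (fst p) (snd p))"
  shows "FP (\<lambda>x. case f x of None \<Rightarrow> g x | Some a \<Rightarrow> h x a)"
proof -
  have "FP (\<lambda>x. h (fst (x, the (f x))) (snd (x, the (f x))))"
    by (rule FP_comp[OF assms(3)]) (intro FP_intros assms)
  then have "FP (\<lambda>x. if f x = None then g x else h x (the (f x)))"
    by (intro FP_intros assms) simp
  then show ?thesis
    by (rule FPon_cong) (auto split: option.splits)
qed

section \<open>Folds with bounded accumulators\<close>

lemma csz_append_le:
  "csz (take i l) \<le> csz l" "csz (drop i l) \<le> csz l" for l :: "'a :: data list"
  using code_simps(9)[of "take i l" "drop i l"] by simp_all

lemma length_le_csz: "length l \<le> csz l" for l :: "'a :: data list"
  by (induction l) auto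

text \<open>The fold becomes an iteration on the argument, the remaining list and the accumulator.
  The rounds are counted by the code of the list, which is at least as long as the list, so
  \<open>F\<close> has to be idle once the list is exhausted.\<close>

lemma FP_foldl:
  fixes step :: "'a :: data \<Rightarrow> 's :: data \<Rightarrow> 'b :: data \<Rightarrow> 's"
  assumes step: "FP (\<lambda>p. step (fst p) (fst (snd p)) (snd (snd p)))"
    and init: "FP init" and l: "FP l" and T: "pbounded T"
    and bound: "\<And>x i. csz (foldl (step x) (init x) (take i (l x))) \<le> T (csz x)"
  shows "FP (\<lambda>x. foldl (step x) (init x) (l x))"
proof -
  define F where "F p = (if fst (snd p) = [] then p
      else (fst p, tl (fst (snd p)), step (fst p) (snd (snd p)) (hd (fst (snd p)))))"
    for p :: "'a \<times> 'b list \<times> 's"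
  define start where "start x = (x, l x, init x)" for x
  obtain r where r: "\<And>x. csz (l x) \<le> poly r (csz x)"
    using FP_size[OF l] by auto
  obtain q where q: "\<And>n. 2 * n + 1 + (2 * poly r n + 1 + T n) \<le> poly q n"
  proof -
    have "pbounded (\<lambda>n. 2 * n + 1 + (2 * poly r n + 1 + T n))"
      by (intro pbounded_intros T)
    then obtain q where "\<forall>n. 2 * n + 1 + (2 * poly r n + 1 + T n) \<le> poly q n"
      unfolding pbounded_def by (elim exE)
    then show ?thesis
      by (intro that) (erule spec)
  qed
  have iter: "(F ^^ i) (start x) = (x, drop i (l x), foldl (step x) (init x) (take i (l x)))" for i x
  proof (induction i)
    case (Suc i)
    then show ?case
      by (cases "i < length (l x)")
         (auto simp: F_def take_Suc_conv_app_nth hd_drop_conv_nth drop_Suc tl_drop)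
  qed (simp add: start_def)
  have F: "FP F"
    unfolding F_def
  proof (intro FP_if FP_null FP_Pair FP_tl FP_fst FP_snd FP_id)
    have "FP (\<lambda>p :: 'a \<times> 'b list \<times> 's. (fst p, snd (snd p), hd (fst (snd p))))"
      by (intro FP_Pair FP_fst FP_snd FP_hd FP_id)
    from FP_comp[OF step this]
    show "FP (\<lambda>p :: 'a \<times> 'b list \<times> 's. step (fst p) (snd (snd p)) (hd (fst (snd p))))"
      by simp
  qed
  have n: "FPon (range start) (\<lambda>p. fst (snd p))"
    by (intro FP_fst FP_snd FP_id)
  have size: "csz ((F ^^ i) p) \<le> poly q (csz p)"
    if "p \<in> range start" "i \<le> csz (fst (snd p))" for i p
  proof -
    obtain x where p: "p = start x"
      using \<open>p \<in> range start\<close> by blast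
    have "csz ((F ^^ i) p) \<le> 2 * csz x + 1 + (2 * csz (l x) + 1 + T (csz x))"
      unfolding p iter using csz_append_le(2)[of i "l x"] bound[where x = x and i = i] by simp
    also have "\<dots> \<le> 2 * csz x + 1 + (2 * poly r (csz x) + 1 + T (csz x))"
      using r[of x] by simp
    also have "\<dots> \<le> poly q (csz x)"
      using q .
    \<comment> \<open>\<open>x\<close> is a component of the state \<open>p\<close>, so its code is
      no longer than that of \<open>p\<close>.\<close>
    also have "\<dots> \<le> poly q (csz p)"
      by (rule poly_mono_nat) (simp add: p start_def)
    finally show ?thesis .
  qed
  have *: "FPon (range start) (\<lambda>p. (F ^^ csz (fst (snd p))) p)"
    by (rule FP_iterate[OF F n size])
  have "FP start"
    unfolding start_def by (intro FP_Pair FP_id l init)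
  from FPon_comp[OF this *] have "FP (\<lambda>x. (F ^^ csz (fst (snd (start x)))) (start x))"
    by blast
  then have "FP (\<lambda>x. snd (snd ((F ^^ csz (fst (snd (start x)))) (start x))))"
    by (intro FP_snd)
  then show ?thesis
    by (rule FPon_cong) (simp add: iter, simp add: start_def length_le_csz)
qed

text \<open>Increments that depend on \<open>x\<close> and the current element, but not on the
  accumulator, add up to a polynomial; repeated doubling is thereby excluded.\<close>

lemma FP_foldl_growth:
  fixes step :: "'a :: data \<Rightarrow> 's :: data \<Rightarrow> 'b :: data \<Rightarrow> 's"
  assumes step: "FP (\<lambda>p. step (fst p) (fst (snd p)) (snd (snd p)))"
    and init: "FP init" and l: "FP l"
    and growth: "\<And>x s a. csz (step x s a) \<le> csz s + poly g (csz (x, a))"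
  shows "FP (\<lambda>x. foldl (step x) (init x) (l x))"
proof -
  obtain r where r: "\<And>x. csz (l x) \<le> poly r (csz x)"
    using FP_size[OF l] by auto
  obtain q where q: "\<And>x. csz (init x) \<le> poly q (csz x)"
    using FP_size[OF init] by auto
  \<comment> \<open>At most \<open>poly r n\<close> elements are processed, and the pair of
    \<open>x\<close> with any of them has a code of length at most
    \<open>2 * n + 1 + poly r n\<close>.\<close>
  define T where "T n = poly q n + poly r n * poly g (2 * n + 1 + poly r n)" for n
  have "csz (foldl (step x) (init x) (take i (l x))) \<le> T (csz x)" for x i
  proof -
    have "csz (foldl (step x) s m) \<le> csz s + length m * poly g (2 * csz x + 1 + csz m)" for s m
    proof (induction m arbitrary: s)
      case (Cons a m)
      have "csz (foldl (step x) s (a # m)) \<le> csz (step x s a) + length m * poly g (2 * csz x + 1 + csz m)"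
        using Cons by simp
      also have "\<dots> \<le> csz s + poly g (csz (x, a)) + length m * poly g (2 * csz x + 1 + csz m)"
        using growth[of x s a] by simp
      also have "\<dots> \<le> csz s + poly g (2 * csz x + 1 + csz (a # m)) + length m * poly g (2 * csz x + 1 + csz (a # m))"
        by (intro add_mono mult_le_mono poly_mono_nat) simp_all
      finally show ?case
        by (simp add: algebra_simps)
    qed simp
    note this[of "init x" "take i (l x)"]
    also have "csz (init x) + length (take i (l x)) * poly g (2 * csz x + 1 + csz (take i (l x))) \<le> T (csz x)"
      unfolding T_def
    proof (intro add_mono mult_le_mono poly_mono_nat order_refl)
      show "length (take i (l x)) \<le> poly r (csz x)"
        using length_le_csz[of "l x"] r[of x] by simp
      show "csz (take i (l x)) \<le> poly r (csz x)"
        using csz_append_le(1)[of i "l x"] r[of x] by simp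
    qed (rule q)
    finally show ?thesis .
  qed
  moreover have "pbounded T"
    unfolding T_def by (intro pbounded_intros)
  ultimately show ?thesis
    by (intro FP_foldl[OF step init l, of T])
qed

section \<open>List and number operations as folds\<close>

lemma FP_rev [FP_intros]:
  fixes f :: "'a :: data \<Rightarrow> 'b :: data list"
  assumes f: "FP f"
  shows "FP (\<lambda>x. rev (f x))"
proof -
  \<comment> \<open>The new entry is quoted and adds \<open>2 * csz a + 1\<close> bits, whence
    \<open>[:1, 2:]\<close>.\<close>
  have "FP (\<lambda>x. foldl (\<lambda>s a. a # s) [] (f x))"
    by (intro FP_foldl_growth[where g = "[:1, 2:]"] FP_intros f) simp
  moreover have "foldl (\<lambda>s a. a # s) s l = rev l @ s" for s l :: "'b list"
    by (induction l arbitrary: s) auto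
  ultimately show ?thesis
    by simp
qed

lemma FP_append [FP_intros]:
  fixes f g :: "'a :: data \<Rightarrow> 'b :: data list"
  assumes f: "FP f" and g: "FP g"
  shows "FP (\<lambda>x. f x @ g x)"
proof -
  have "FP (\<lambda>x. foldl (\<lambda>s a. a # s) (g x) (rev (f x)))"
    by (intro FP_foldl_growth[where g = "[:1, 2:]"] FP_intros f g) simp
  moreover have "foldl (\<lambda>s a. a # s) s l = rev l @ s" for s l :: "'b list"
    by (induction l arbitrary: s) auto
  ultimately show ?thesis
    by simp
qed

lemma FP_map [FP_intros]:
  fixes f :: "'a :: data \<Rightarrow> 'b :: data \<Rightarrow> 'c :: data"
  assumes f: "FP (\<lambda>p. f (fst p) (snd p))" and l: "FP l"
  shows "FP (\<lambda>x. map (f x) (l x))"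
proof -
  obtain p where p: "\<And>x a. csz (f x a) \<le> poly p (csz (x, a))"
    using FP_size[OF f] by (metis UNIV_I fst_conv snd_conv)
  have "FP (\<lambda>y :: 'a \<times> 'c list \<times> 'b. (fst y, snd (snd y)))"
    by (intro FP_intros)
  from FP_comp[OF f this] have "FP (\<lambda>y :: 'a \<times> 'c list \<times> 'b. f (fst y) (snd (snd y)))"
    by simp
  then have "FP (\<lambda>x. foldl (\<lambda>s a. f x a # s) [] (l x))"
  proof (intro FP_foldl_growth[where g = "[:1:] + [:2:] * p"] FP_Cons FP_const FP_fst FP_snd FP_id l)
    fix x a and s :: "'c list"
    show "csz (f x a # s) \<le> csz s + poly ([:1:] + [:2:] * p) (csz (x, a))"
      using p[of x a] by simp
  qed
  then have "FP (\<lambda>x. rev (foldl (\<lambda>s a. f x a # s) [] (l x)))"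
    by (rule FP_rev)
  moreover have "foldl (\<lambda>s a. f x a # s) s m = rev (map (f x) m) @ s" for x s m
    by (induction m arbitrary: s) auto
  ultimately show ?thesis
    by simp
qed

lemma FP_concat [FP_intros]:
  fixes f :: "'a :: data \<Rightarrow> 'b :: data list list"
  assumes f: "FP f"
  shows "FP (\<lambda>x. concat (f x))"
proof -
  have "FP (\<lambda>x. foldl (\<lambda>s a. s @ a) [] (f x))"
    by (intro FP_foldl_growth[where g = "[:0, 1:]"] FP_intros f) simp
  moreover have "foldl (\<lambda>s a. s @ a) s l = s @ concat l" for s and l :: "'b list list"
    by (induction l arbitrary: s) auto
  ultimately show ?thesis
    by simp
qed

lemma FP_list_all [FP_intros]:
  fixes P :: "'a :: data \<Rightarrow> 'b :: data \<Rightarrow> bool"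
  assumes P: "FP (\<lambda>p. P (fst p) (snd p))" and l: "FP l"
  shows "FP (\<lambda>x. list_all (P x) (l x))"
proof -
  have "FP (\<lambda>y :: 'a \<times> bool \<times> 'b. (fst y, snd (snd y)))"
    by (intro FP_intros)
  from FP_comp[OF P this] have "FP (\<lambda>y :: 'a \<times> bool \<times> 'b. P (fst y) (snd (snd y)))"
    by simp
  then have "FP (\<lambda>x. foldl (\<lambda>s a. s \<and> P x a) True (l x))"
    by (intro FP_foldl_growth[where g = 0] FP_conj FP_const FP_fst FP_snd FP_id l) (simp_all add: code_bool_def)
  moreover have "foldl (\<lambda>s a. s \<and> P x a) s m \<longleftrightarrow> s \<and> list_all (P x) m" for x s m
    by (induction m arbitrary: s) auto
  ultimately show ?thesis
    by simp
qed

lemma FP_length [FP_intros]: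
  fixes f :: "'a :: data \<Rightarrow> 'b :: data list"
  assumes f: "FP f"
  shows "FP (\<lambda>x. length (f x))"
proof -
  have "FP (\<lambda>x. foldl (\<lambda>s a. Suc s) 0 (f x))"
    by (intro FP_foldl_growth[where g = "[:1:]"] FP_intros f) simp
  moreover have "foldl (\<lambda>s a. Suc s) k l = k + length l" for k and l :: "'b list"
    by (induction l arbitrary: k) auto
  ultimately show ?thesis
    by simp
qed

lemma FP_add [FP_intros]:
  fixes f g :: "'a :: data \<Rightarrow> nat"
  assumes f: "FP f" and g: "FP g"
  shows "FP (\<lambda>x. f x + g x)"
  by (rule FPon_recode[OF FP_append[OF FP_units[OF f] FP_units[OF g]], where \<phi> = "\<lambda>x. x"]) simp

lemma FP_mult [FP_intros]:
  fixes f g :: "'a :: data \<Rightarrow> nat"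
  assumes f: "FP f" and g: "FP g"
  shows "FP (\<lambda>x. f x * g x)"
proof -
  have "FP (\<lambda>p :: 'a \<times> unit. g (fst p))"
    by (rule FP_comp[OF g]) (intro FP_intros)
  then have "FP (\<lambda>x. concat (map (\<lambda>u. units (g x)) (units (f x))))"
    by (intro FP_concat FP_map FP_units f)
  then have "FP (\<lambda>x. length (concat (map (\<lambda>u. units (g x)) (units (f x)))))"
    by (rule FP_length)
  then show ?thesis
    by (rule FPon_cong) (simp add: length_concat sum_list_replicate)
qed

lemma FP_drop [FP_intros]:
  fixes l :: "'a :: data \<Rightarrow> 'b :: data list"
  assumes n: "FP n" and l: "FP l"
  shows "FP (\<lambda>x. drop (n x) (l x))"
proof -
  have "csz (tl s) \<le> csz s" for s :: "'b list"
    by (cases s) auto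
  then have "FP (\<lambda>x. foldl (\<lambda>s u. tl s) (l x) (units (n x)))"
    by (intro FP_foldl_growth[where g = 0] FP_tl FP_fst FP_snd FP_id FP_units n l) simp
  moreover have "foldl (\<lambda>s u. tl s) s (units k) = drop k s" for k and s :: "'b list"
    by (induction k arbitrary: s) (auto simp: drop_Suc)
  ultimately show ?thesis
    by simp
qed

lemma FP_diff [FP_intros]:
  fixes f g :: "'a :: data \<Rightarrow> nat"
  assumes f: "FP f" and g: "FP g"
  shows "FP (\<lambda>x. f x - g x)"
  by (rule FPon_recode[OF FP_drop[OF g FP_units[OF f]], where \<phi> = "\<lambda>x. x"]) simp

lemma FP_take [FP_intros]:
  fixes l :: "'a :: data \<Rightarrow> 'b :: data list"
  assumes n: "FP n" and l: "FP l"
  shows "FP (\<lambda>x. take (n x) (l x))"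
proof -
  have "FP (\<lambda>x. rev (drop (length (l x) - n x) (rev (l x))))"
    by (intro FP_rev FP_drop FP_diff FP_length n l)
  moreover have "rev (drop (length m - k) (rev m)) = take k m" for k and m :: "'b list"
    by (cases "k \<le> length m") (auto simp: drop_rev)
  ultimately show ?thesis
    by simp
qed

lemma FP_le [FP_intros]:
  fixes f g :: "'a :: data \<Rightarrow> nat"
  assumes f: "FP f" and g: "FP g"
  shows "FP (\<lambda>x. f x \<le> g x)"
  using FP_eq_0[OF FP_diff[OF f g]] by simp

lemma FP_less [FP_intros]:
  fixes f g :: "'a :: data \<Rightarrow> nat"
  assumes f: "FP f" and g: "FP g"
  shows "FP (\<lambda>x. f x < g x)"
  using FP_le[OF FP_Suc[OF f] g] by (simp add: Suc_le_eq)

lemma FP_eq [FP_intros]: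
  fixes f g :: "'a :: data \<Rightarrow> nat"
  assumes f: "FP f" and g: "FP g"
  shows "FP (\<lambda>x. f x = g x)"
proof -
  have "FP (\<lambda>x. f x \<le> g x \<and> g x \<le> f x)"
    by (intro FP_conj FP_le f g)
  then show ?thesis
    by (rule FPon_cong) auto
qed

text \<open>The appended number is the current length, so the increment depends on the accumulator
  and \<open>FP_foldl_growth\<close> does not apply. Instead, \<open>k\<close> entries of at most
  \<open>2 * k + 1\<close> bits each give a direct quadratic bound.\<close>

lemma FP_upt [FP_intros]:
  fixes n :: "'a :: data \<Rightarrow> nat"
  assumes n: "FP n"
  shows "FP (\<lambda>x. [0..<n x])"
proof -
  have eq: "foldl (\<lambda>s u. s @ [length s]) [] (units k) = [0..<k]" for k
  proof (induction k)
    case (Suc k)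
    then show ?case
      unfolding replicate_Suc replicate_append_same[symmetric] by simp
  qed simp
  obtain r where r: "\<And>x. n x \<le> poly r (csz x)"
    using FP_size[OF n] by auto
  have size: "csz [0..<k] \<le> k * (2 * k + 1)" for k :: nat
  proof (induction k)
    case (Suc k)
    then show ?case
      by (simp add: algebra_simps)
  qed simp
  have "FP (\<lambda>x. foldl (\<lambda>s u. s @ [length s]) [] (units (n x)))"
  proof (rule FP_foldl)
    show "csz (foldl (\<lambda>s u. s @ [length s]) [] (take i (units (n x)))) \<le>
        poly r (csz x) * (2 * poly r (csz x) + 1)" for x i
    proof -
      have "min i (n x) * (2 * min i (n x) + 1) \<le> poly r (csz x) * (2 * poly r (csz x) + 1)"
        by (intro mult_le_mono add_mono order_refl) (use r[of x] in auto)
      with size[of "min i (n x)"] show ?thesis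
        unfolding take_replicate eq by (rule order_trans)
    qed
    show "pbounded (\<lambda>k. poly r k * (2 * poly r k + 1))"
      by (intro pbounded_intros)
  qed (intro FP_intros n)+
  then show ?thesis
    unfolding eq .
qed

lemma FP_replicate [FP_intros]:
  fixes f :: "'a :: data \<Rightarrow> 'b :: data"
  assumes n: "FP n" and f: "FP f"
  shows "FP (\<lambda>x. replicate (n x) (f x))"
proof -
  have "FP (\<lambda>p :: 'a \<times> unit. f (fst p))"
    by (rule FP_comp[OF f]) (intro FP_intros)
  then have "FP (\<lambda>x. map (\<lambda>u. f x) (units (n x)))"
    by (intro FP_map FP_units n)
  then show ?thesis
    by simp
qed

subsection \<open>From programs to Turing machines\<close>

text \<open>Input and output lie to the right of cell 0 and are scanned without being consumed, in
  contrast to stacks, so the head position is a separate parameter.\<close>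

definition word_tape :: "bool list \<Rightarrow> int \<Rightarrow> tape" where
  "word_tape w k = (fst (tape_of w), k)"

lemma tape_of_word: "tape_of w = word_tape w 0"
  by (simp add: word_tape_def tape_of_def)

lemma read_word_tape:
  "tape_read (word_tape w k) = (if 0 \<le> k \<and> k < int (length w) then Bit (w ! nat k) else Blank)"
  by (simp add: tape_read_def word_tape_def tape_of_def)

lemma write_word_tape: "tape_act (Bit b, d) (word_tape w (int (length w))) =
    word_tape (w @ [b]) (int (length w) + dir_offset d)"
  by (auto simp: tape_act_def word_tape_def tape_of_def fun_eq_iff nth_append)

lemma erase_word_tape: "tape_act (Blank, d) (word_tape (w @ [b]) (int (length w))) =
    word_tape w (int (length w) + dir_offset d)"
  by (auto simp: tape_act_def word_tape_def tape_of_def fun_eq_iff nth_append)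

lemma runs_Go_word:
  "\<sigma> i = word_tape w k \<Longrightarrow> runs (Go i d) \<sigma> 1 (\<sigma>(i := word_tape w (k + dir_offset d)))"
  using run.Go[of i d \<sigma>] unfolding runs_def
  by (auto simp: tape_act_def tape_read_def word_tape_def)

lemma runs_Put_word:
  "\<sigma> i = word_tape w (int (length w)) \<Longrightarrow>
    runs (Put i (Some b) d) \<sigma> 1 (\<sigma>(i := word_tape (w @ [b]) (int (length w) + dir_offset d)))"
  using run.Put[of i "Some b" d \<sigma>] unfolding runs_def by (auto simp: write_word_tape)

lemma runs_erase_word:
  "\<sigma> i = word_tape (w @ [b]) (int (length w)) \<Longrightarrow>
    runs (Put i None d) \<sigma> 1 (\<sigma>(i := word_tape w (int (length w) + dir_offset d)))"
  using run.Put[of i None d \<sigma>] unfolding runs_def by (auto simp: erase_word_tape)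

lemma runs_scan_right:
  "k \<le> length w \<Longrightarrow> \<sigma> i = word_tape w (int k) \<Longrightarrow>
    runs (While i (\<lambda>s. s \<noteq> Blank) (Go i Move_Right)) \<sigma> (3 * (length w - k) + 1)
      (\<sigma>(i := word_tape w (int (length w))))"
proof (induction "length w - k" arbitrary: k \<sigma>)
  case 0
  then have "\<sigma>(i := word_tape w (int (length w))) = \<sigma>"
    by auto
  moreover have "runs (While i (\<lambda>s. s \<noteq> Blank) (Go i Move_Right)) \<sigma> 1 \<sigma>"
    by (rule runs_WhileF) (use 0 in \<open>simp add: read_word_tape\<close>)
  ultimately show ?case
    using 0 by (metis runs_mono le_add2)
next
  case (Suc n)
  let ?\<tau> = "\<sigma>(i := word_tape w (int k + 1))"
  have "runs (Go i Move_Right) \<sigma> 1 ?\<tau>"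
    using runs_Go_word[of \<sigma> i w "int k" Move_Right] Suc.prems(2) by simp
  moreover have "runs (While i (\<lambda>s. s \<noteq> Blank) (Go i Move_Right)) ?\<tau> (3 * (length w - Suc k) + 1)
      (?\<tau>(i := word_tape w (int (length w))))"
    using Suc.hyps(2) by (intro Suc.hyps(1)) (auto simp: add.commute)
  moreover have "tape_read (\<sigma> i) \<noteq> Blank"
    using Suc by (simp add: read_word_tape)
  ultimately have "runs (While i (\<lambda>s. s \<noteq> Blank) (Go i Move_Right)) \<sigma>
      (1 + (3 * (length w - Suc k) + 1) + 2) (?\<tau>(i := word_tape w (int (length w))))"
    by (intro runs_WhileT)
  then show ?case
    using Suc.hyps(2) by (simp only: fun_upd_upd) (erule runs_mono, simp)
qed

lemma runs_scan_left:
  "k \<le> length w \<Longrightarrow> \<sigma> i = word_tape w (int k - 1) \<Longrightarrow>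
    runs (While i (\<lambda>s. s \<noteq> Blank) (Go i Move_Left)) \<sigma> (3 * k + 1) (\<sigma>(i := word_tape w (- 1)))"
proof (induction k arbitrary: \<sigma>)
  case 0
  then have "\<sigma>(i := word_tape w (- 1)) = \<sigma>"
    by auto
  moreover have "runs (While i (\<lambda>s. s \<noteq> Blank) (Go i Move_Left)) \<sigma> 1 \<sigma>"
    by (rule runs_WhileF) (use 0 in \<open>simp add: read_word_tape\<close>)
  ultimately show ?case
    by (simp only: mult_0_right add_0)
next
  case (Suc k)
  let ?\<tau> = "\<sigma>(i := word_tape w (int k - 1))"
  have "runs (Go i Move_Left) \<sigma> 1 ?\<tau>"
    using runs_Go_word[of \<sigma> i w "int k" Move_Left] Suc.prems(2) by simp
  moreover have "runs (While i (\<lambda>s. s \<noteq> Blank) (Go i Move_Left)) ?\<tau> (3 * k + 1) (?\<tau>(i := word_tape w (- 1)))"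
    using Suc.prems by (intro Suc.IH) auto
  moreover have "tape_read (\<sigma> i) \<noteq> Blank"
    using Suc by (simp add: read_word_tape)
  ultimately have "runs (While i (\<lambda>s. s \<noteq> Blank) (Go i Move_Left)) \<sigma>
      (1 + (3 * k + 1) + 2) (?\<tau>(i := word_tape w (- 1)))"
    by (intro runs_WhileT)
  then show ?case
    by (simp only: fun_upd_upd) (erule runs_mono, simp)
qed

text \<open>The word \<open>[True, b, False]\<close> is \<open>quote (code b)\<close>, pushed from
  its end. The input is read from right to left because the bit pushed last ends on top; erasing it
  on the way prepares tape 0 for the output.\<close>

definition load_bit :: "bool \<Rightarrow> com" where
  "load_bit b = Seq (push 1 False) (Seq (push 1 b) (Seq (push 1 True) (Put 0 None Move_Left)))"

definition load_loop :: com where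
  "load_loop = While 0 (\<lambda>s. s \<noteq> Blank) (Cond 0 (\<lambda>s. s = Bit True) (load_bit True) (load_bit False))"

lemma runs_load_loop:
  "\<sigma> 0 = word_tape w (int (length w) - 1) \<Longrightarrow> \<sigma> 1 = stk u \<Longrightarrow>
    runs load_loop \<sigma> (11 * length w + 1) (\<sigma>(0 := word_tape [] (- 1), 1 := stk (code w @ u)))"
proof (induction w arbitrary: u \<sigma> rule: rev_induct)
  case Nil
  then have "\<sigma>(0 := word_tape [] (- 1), 1 := stk (code ([] :: bool list) @ u)) = \<sigma>"
    by auto
  moreover have "runs load_loop \<sigma> 1 \<sigma>"
    unfolding load_loop_def by (rule runs_WhileF) (use Nil in \<open>simp add: read_word_tape\<close>)
  ultimately show ?case
    by (simp only: list.size mult_0_right add_0)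
next
  case (snoc b w)
  define \<sigma>1 where "\<sigma>1 = \<sigma>(1 := stk (False # u))"
  define \<sigma>2 where "\<sigma>2 = \<sigma>1(1 := stk (b # False # u))"
  define \<sigma>3 where "\<sigma>3 = \<sigma>2(1 := stk (True # b # False # u))"
  define \<sigma>4 where "\<sigma>4 = \<sigma>3(0 := word_tape w (int (length w) + dir_offset Move_Left))"
  have 0: "\<sigma> 0 = word_tape (w @ [b]) (int (length w))"
    using snoc.prems(1) by simp
  have 1: "runs (push 1 False) \<sigma> 2 \<sigma>1"
    unfolding \<sigma>1_def by (rule runs_push) (rule snoc.prems)
  have 2: "runs (push 1 b) \<sigma>1 2 \<sigma>2"
    unfolding \<sigma>2_def by (rule runs_push) (simp add: \<sigma>1_def)
  have 3: "runs (push 1 True) \<sigma>2 2 \<sigma>3"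
    unfolding \<sigma>3_def by (rule runs_push) (simp add: \<sigma>2_def)
  have 4: "runs (Put 0 None Move_Left) \<sigma>3 1 \<sigma>4"
    unfolding \<sigma>4_def by (rule runs_erase_word[of _ _ _ b]) (simp add: \<sigma>1_def \<sigma>2_def \<sigma>3_def 0)
  have "runs (load_bit b) \<sigma> (2 + (2 + (2 + 1))) \<sigma>4"
    unfolding load_bit_def by (rule runs_Seq[OF 1 runs_Seq[OF 2 runs_Seq[OF 3 4]]])
  then have "runs (Cond 0 (\<lambda>s. s = Bit True) (load_bit True) (load_bit False)) \<sigma> (2 + (2 + (2 + 1)) + 2) \<sigma>4"
    by (intro runs_Cond) (cases b; simp add: 0 read_word_tape)
  moreover have "runs load_loop \<sigma>4 (11 * length w + 1)
      (\<sigma>4(0 := word_tape [] (- 1), 1 := stk (code w @ True # b # False # u)))"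
    by (rule snoc.IH) (simp_all add: \<sigma>4_def \<sigma>3_def)
  moreover have "\<sigma>4(0 := word_tape [] (- 1), 1 := stk (code w @ True # b # False # u)) =
      \<sigma>(0 := word_tape [] (- 1), 1 := stk (code (w @ [b]) @ u))"
    by (auto simp: \<sigma>1_def \<sigma>2_def \<sigma>3_def \<sigma>4_def fun_eq_iff)
  moreover have "tape_read (\<sigma> 0) \<noteq> Blank"
    by (simp add: 0 read_word_tape)
  ultimately have "runs load_loop \<sigma> (2 + (2 + (2 + 1)) + 2 + (11 * length w + 1) + 2)
      (\<sigma>(0 := word_tape [] (- 1), 1 := stk (code (w @ [b]) @ u)))"
    unfolding load_loop_def by (intro runs_WhileT) simp_all
  then show ?case
    by (rule runs_mono) simp
qed

definition unload_bit :: "bool \<Rightarrow> com" where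
  "unload_bit b = Seq (pop 1) (Put 0 (Some b) Move_Right)"

text \<open>The three pops per round, one of them inside \<open>unload_bit\<close>, remove the
  marker, the bit and the terminator of one quoted entry.\<close>

definition unload_loop :: com where
  "unload_loop = While 1 (\<lambda>s. s \<noteq> Blank) (Seq (pop 1)
     (Seq (Cond 1 (\<lambda>s. s = Bit True) (unload_bit True) (unload_bit False)) (pop 1)))"

lemma runs_unload_loop:
  "\<sigma> 0 = word_tape w (int (length w)) \<Longrightarrow> \<sigma> 1 = stk (code v) \<Longrightarrow>
    runs unload_loop \<sigma> (8 * length v + 1) (\<sigma>(0 := word_tape (w @ v) (int (length (w @ v))), 1 := stk []))"
proof (induction v arbitrary: w \<sigma>)
  case Nil
  then have "\<sigma>(0 := word_tape (w @ []) (int (length (w @ []))), 1 := stk []) = \<sigma>"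
    by auto
  moreover have "runs unload_loop \<sigma> 1 \<sigma>"
    unfolding unload_loop_def by (rule runs_WhileF) (use Nil in simp)
  ultimately show ?case
    by (simp only: list.size mult_0_right add_0)
next
  case (Cons b v)
  define \<sigma>1 where "\<sigma>1 = \<sigma>(1 := stk (b # False # code v))"
  define \<sigma>2 where "\<sigma>2 = \<sigma>1(1 := stk (False # code v))"
  define \<sigma>3 where "\<sigma>3 = \<sigma>2(0 := word_tape (w @ [b]) (int (length w) + dir_offset Move_Right))"
  define \<sigma>4 where "\<sigma>4 = \<sigma>3(1 := stk (code v))"
  have 1: "runs (pop 1) \<sigma> 1 \<sigma>1"
    unfolding \<sigma>1_def by (rule runs_pop) (use Cons.prems in simp)
  have 2: "runs (pop 1) \<sigma>1 1 \<sigma>2"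
    unfolding \<sigma>2_def by (rule runs_pop) (simp add: \<sigma>1_def)
  have 3: "runs (Put 0 (Some b) Move_Right) \<sigma>2 1 \<sigma>3"
    unfolding \<sigma>3_def by (rule runs_Put_word) (simp add: \<sigma>1_def \<sigma>2_def Cons.prems)
  have 4: "runs (pop 1) \<sigma>3 1 \<sigma>4"
    unfolding \<sigma>4_def by (rule runs_pop) (simp add: \<sigma>2_def \<sigma>3_def)
  have "runs (unload_bit b) \<sigma>1 (1 + 1) \<sigma>3"
    unfolding unload_bit_def by (rule runs_Seq[OF 2 3])
  then have "runs (Cond 1 (\<lambda>s. s = Bit True) (unload_bit True) (unload_bit False)) \<sigma>1 (1 + 1 + 2) \<sigma>3"
    by (intro runs_Cond) (cases b; simp add: \<sigma>1_def)
  from runs_Seq[OF 1 runs_Seq[OF this 4]]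
  have "runs (Seq (pop 1) (Seq (Cond 1 (\<lambda>s. s = Bit True) (unload_bit True) (unload_bit False)) (pop 1)))
      \<sigma> (1 + (1 + 1 + 2 + 1)) \<sigma>4" .
  moreover have "runs unload_loop \<sigma>4 (8 * length v + 1)
      (\<sigma>4(0 := word_tape ((w @ [b]) @ v) (int (length ((w @ [b]) @ v))), 1 := stk []))"
    by (rule Cons.IH) (simp_all add: \<sigma>4_def \<sigma>3_def add.commute)
  moreover have "\<sigma>4(0 := word_tape ((w @ [b]) @ v) (int (length ((w @ [b]) @ v))), 1 := stk []) =
      \<sigma>(0 := word_tape (w @ b # v) (int (length (w @ b # v))), 1 := stk [])"
    by (auto simp: \<sigma>1_def \<sigma>2_def \<sigma>3_def \<sigma>4_def fun_eq_iff)
  moreover have "tape_read (\<sigma> 1) \<noteq> Blank"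
    using Cons.prems by simp
  ultimately have "runs unload_loop \<sigma> (1 + (1 + 1 + 2 + 1) + (8 * length v + 1) + 2)
      (\<sigma>(0 := word_tape (w @ b # v) (int (length (w @ b # v))), 1 := stk []))"
    unfolding unload_loop_def by (intro runs_WhileT) simp_all
  then show ?case
    by (rule runs_mono) simp
qed

lemma csz_word: "csz w = 3 * length w" for w :: "bool list"
  by (induction w) auto

text \<open>Base register 1 keeps tape 0 free for input and output. The last scan to the left and
  the step to the right put the head back on cell 0, as the definition of computability
  demands.\<close>

theorem FP_polytime_computable:
  fixes f :: "bool list \<Rightarrow> bool list"
  assumes f: "FP f"
  shows "polytime_computable f"
proof -
  obtain c p where p: "\<And>w. csz (f w) \<le> poly p (csz w)"
    and c: "\<And>w. computes c 1 (poly p (csz w)) (code w) (code (f w))"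
    using FPonD[OF f, of 1] by blast
  let ?L = "While 0 (\<lambda>s. s \<noteq> Blank) (Go 0 Move_Left)"
  let ?R = "While 0 (\<lambda>s. s \<noteq> Blank) (Go 0 Move_Right)"
  let ?c = "Seq ?R (Seq (Go 0 Move_Left) (Seq load_loop (Seq (Go 0 Move_Right) (Seq c
    (Seq unload_loop (Seq (Go 0 Move_Left) (Seq ?L (Go 0 Move_Right))))))))"
  \<comment> \<open>A word of length \<open>n\<close> has a code of length \<open>3 * n\<close>; 11
    and 8 are the costs per bit of loading and unloading.\<close>
  let ?T = "\<lambda>n. (3 * n + 1) + (1 + ((11 * n + 1) + (1 + (poly p (3 * n) +
    ((8 * poly p (3 * n) + 1) + (1 + ((3 * poly p (3 * n) + 1) + 1)))))))"
  have "pbounded ?T"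
    by (intro pbounded_intros)
  then obtain q where q: "\<And>n. ?T n \<le> poly q n"
    unfolding pbounded_def by (elim exE) blast
  have "\<exists>t \<le> poly q (length w). \<exists>\<sigma>. run ?c ((\<lambda>_. tape_of [])(0 := tape_of w)) t \<sigma> \<and> \<sigma> 0 = tape_of (f w)" for w
  proof -
    define v where "v = f w"
    define \<sigma>0 where "\<sigma>0 = (\<lambda>_ :: nat. tape_of [])(0 := tape_of w)"
    define \<sigma>1 where "\<sigma>1 = \<sigma>0(0 := word_tape w (int (length w)))"
    define \<sigma>2 where "\<sigma>2 = \<sigma>1(0 := word_tape w (int (length w) + dir_offset Move_Left))"
    define \<sigma>3 where "\<sigma>3 = \<sigma>2(0 := word_tape [] (- 1), 1 := stk (code w @ []))"
    define \<sigma>4 where "\<sigma>4 = \<sigma>3(0 := word_tape [] (- 1 + dir_offset Move_Right))"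
    define \<sigma>5 where "\<sigma>5 = \<sigma>4(1 := stk (code v))"
    define \<sigma>6 where "\<sigma>6 = \<sigma>5(0 := word_tape ([] @ v) (int (length ([] @ v))), 1 := stk [])"
    define \<sigma>7 where "\<sigma>7 = \<sigma>6(0 := word_tape v (int (length v) + dir_offset Move_Left))"
    define \<sigma>8 where "\<sigma>8 = \<sigma>7(0 := word_tape v (- 1))"
    define \<sigma>9 where "\<sigma>9 = \<sigma>8(0 := word_tape v (- 1 + dir_offset Move_Right))"
    have "length v \<le> csz v"
      by (simp add: csz_word)
    also have "csz v \<le> poly p (3 * length w)"
      using p[of w] by (simp add: v_def csz_word)
    finally have v: "length v \<le> poly p (3 * length w)" .
    have 1: "runs ?R \<sigma>0 (3 * (length w - 0) + 1) \<sigma>1"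
      unfolding \<sigma>1_def by (rule runs_scan_right) (simp_all add: v_def \<sigma>0_def tape_of_word)
    have 2: "runs (Go 0 Move_Left) \<sigma>1 1 \<sigma>2"
      unfolding \<sigma>2_def by (rule runs_Go_word) (simp add: \<sigma>1_def)
    have 3: "runs load_loop \<sigma>2 (11 * length w + 1) \<sigma>3"
      unfolding \<sigma>3_def by (rule runs_load_loop) (simp_all add: \<sigma>2_def \<sigma>1_def v_def \<sigma>0_def tape_of_Nil)
    have 4: "runs (Go 0 Move_Right) \<sigma>3 1 \<sigma>4"
      unfolding \<sigma>4_def by (rule runs_Go_word) (simp add: \<sigma>3_def)
    have 5: "runs c \<sigma>4 (poly p (csz w)) \<sigma>5"
      unfolding \<sigma>5_def v_def \<sigma>0_def
      by (rule computesD[OF c]) (simp_all add: \<sigma>4_def \<sigma>3_def \<sigma>2_def \<sigma>1_def v_def \<sigma>0_def tape_of_Nil)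
    have 6: "runs unload_loop \<sigma>5 (8 * length v + 1) \<sigma>6"
      unfolding \<sigma>6_def by (rule runs_unload_loop) (simp_all add: \<sigma>5_def \<sigma>4_def)
    have 7: "runs (Go 0 Move_Left) \<sigma>6 1 \<sigma>7"
      unfolding \<sigma>7_def by (rule runs_Go_word) (simp add: \<sigma>6_def)
    have 8: "runs ?L \<sigma>7 (3 * length v + 1) \<sigma>8"
      unfolding \<sigma>8_def by (rule runs_scan_left) (simp_all add: \<sigma>7_def)
    have 9: "runs (Go 0 Move_Right) \<sigma>8 1 \<sigma>9"
      unfolding \<sigma>9_def by (rule runs_Go_word) (simp add: \<sigma>8_def)
    have "runs ?c \<sigma>0 (?T (length w)) \<sigma>9"
      by (rule runs_mono[OF runs_Seq[OF 1 runs_Seq[OF 2 runs_Seq[OF 3 runs_Seq[OF 4 runs_Seq[OF 5 runs_Seq[OF 6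
            runs_Seq[OF 7 runs_Seq[OF 8 9]]]]]]]]]) (use v in \<open>simp add: csz_word\<close>)
    then have "runs ?c \<sigma>0 (poly q (length w)) \<sigma>9"
      using q runs_mono by blast
    moreover have "\<sigma>9 0 = tape_of v"
      by (simp add: \<sigma>9_def tape_of_word)
    ultimately show ?thesis
      unfolding runs_def v_def \<sigma>0_def by blast
  qed
  then show ?thesis
    by (rule run_computes)
qed

section \<open>The tournament circuit\<close>

subsection \<open>Relocation of gates\<close>

definition wf_gates :: "nat \<Rightarrow> gate list \<Rightarrow> bool" where
  "wf_gates n gs \<longleftrightarrow> (\<forall>k < length gs. wf_gate n k (gs ! k))"

text \<open>Input and gate positions have separate offsets: a copy of a circuit in a comparison
  block reads the second half of the input, whereas blocks placed one after another share the whole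
  input.\<close>

fun reloc :: "nat \<Rightarrow> nat \<Rightarrow> gate \<Rightarrow> gate" where
  "reloc a b (In i) = In (a + i)"
| "reloc a b (Const c) = Const c"
| "reloc a b (Not i) = Not (b + i)"
| "reloc a b (And i j) = And (b + i) (b + j)"
| "reloc a b (Or i j) = Or (b + i) (b + j)"

lemma reloc_0_0: "reloc 0 0 = (\<lambda>g. g)"
proof
  show "reloc 0 0 g = g" for g
    by (cases g) auto
qed

lemma wf_gate_reloc: "wf_gate n k g \<Longrightarrow> a + n \<le> n' \<Longrightarrow> wf_gate n' (b + k) (reloc a b g)"
  by (cases g) auto

lemma wf_gate_mono: "wf_gate n k g \<Longrightarrow> n \<le> n' \<Longrightarrow> wf_gate n' k g"
  by (cases g) auto

lemma wf_gates_snoc: "wf_gates n (gs @ [g]) \<longleftrightarrow> wf_gates n gs \<and> wf_gate n (length gs) g"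
  by (auto simp: wf_gates_def nth_append less_Suc_eq)

lemma wf_gates_mono: "wf_gates n gs \<Longrightarrow> n \<le> n' \<Longrightarrow> wf_gates n' gs"
  unfolding wf_gates_def using wf_gate_mono by blast

lemma wf_gates_append_reloc:
  assumes "wf_gates n' G" "wf_gates n B" "a + n \<le> n'"
  shows "wf_gates n' (G @ map (reloc a (length G)) B)"
  unfolding wf_gates_def
proof (intro allI impI)
  fix k
  assume k: "k < length (G @ map (reloc a (length G)) B)"
  show "wf_gate n' k ((G @ map (reloc a (length G)) B) ! k)"
  proof (cases "k < length G")
    case True
    then show ?thesis
      using assms(1) by (simp add: wf_gates_def nth_append)
  next
    case False
    then show ?thesis
      using k assms wf_gate_reloc[of n "k - length G" "B ! (k - length G)" a n' "length G"]
      by (simp add: wf_gates_def nth_append)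
  qed
qed

lemma gate_vals_Nil [simp]: "gate_vals x [] = []"
  by (simp add: gate_vals_def)

lemma gate_vals_snoc: "gate_vals x (gs @ [g]) = gate_vals x gs @ [gate_val x (gate_vals x gs) g]"
  by (simp add: gate_vals_def)

lemma length_gate_vals [simp]: "length (gate_vals x gs) = length gs"
  by (induction gs rule: rev_induct) (simp_all add: gate_vals_snoc)

lemma gate_vals_append_take: "take (length gs) (gate_vals x (gs @ hs)) = gate_vals x gs"
proof (induction hs rule: rev_induct)
  case (snoc h hs)
  then show ?case
    unfolding append_assoc[symmetric] gate_vals_snoc by simp
qed simp

lemma gate_vals_append_nth: "k < length gs \<Longrightarrow> gate_vals x (gs @ hs) ! k = gate_vals x gs ! k"
  by (metis gate_vals_append_take nth_take)

lemma gate_val_cong: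
  "wf_gate n k g \<Longrightarrow> (\<And>i. i < k \<Longrightarrow> vs ! i = vs' ! i) \<Longrightarrow> gate_val x vs g = gate_val x vs' g"
  by (cases g) auto

lemma gate_vals_nth:
  assumes "wf_gates n gs" "k < length gs"
  shows "gate_vals x gs ! k = gate_val x (gate_vals x gs) (gs ! k)"
proof -
  have gs: "gs = (take k gs @ [gs ! k]) @ drop (Suc k) gs"
    using assms(2) by (simp add: id_take_nth_drop)
  have len: "length (take k gs) = k"
    using assms(2) by simp
  have "gate_vals x gs ! k = gate_vals x (take k gs @ [gs ! k]) ! k"
    using assms(2) by (subst gs, intro gate_vals_append_nth) simp
  also have "\<dots> = gate_val x (gate_vals x (take k gs)) (gs ! k)"
    using len by (simp add: gate_vals_snoc nth_append)
  also have "\<dots> = gate_val x (gate_vals x gs) (gs ! k)"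
  proof (rule gate_val_cong)
    show "wf_gate n k (gs ! k)"
      using assms by (simp add: wf_gates_def)
    show "gate_vals x (take k gs) ! i = gate_vals x gs ! i" if "i < k" for i
      using gate_vals_append_nth[of i "take k gs" x "drop k gs"] that len by simp
  qed
  finally show ?thesis .
qed

text \<open>Relocated gates refer neither to gates of \<open>G\<close> nor to inputs outside the
  window starting at \<open>a\<close>, so \<open>B\<close> behaves as if it stood alone.\<close>

lemma gate_vals_append_reloc:
  assumes "wf_gates n B" and "\<And>i. i < n \<Longrightarrow> X ! (a + i) = x ! i"
  shows "gate_vals X (G @ map (reloc a (length G)) B) = gate_vals X G @ gate_vals x B"
  using assms(1)
proof (induction B rule: rev_induct)
  case (snoc g B)
  then have g: "wf_gate n (length B) g"
    and IH: "gate_vals X (G @ map (reloc a (length G)) B) = gate_vals X G @ gate_vals x B"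
    by (simp_all add: wf_gates_snoc)
  have "gate_val X (gate_vals X G @ gate_vals x B) (reloc a (length G) g) = gate_val x (gate_vals x B) g"
    using g assms(2) by (cases g) (simp_all add: nth_append)
  then show ?case
    using IH gate_vals_snoc[of X "G @ map (reloc a (length G)) B"] by (simp add: gate_vals_snoc)
qed simp

text \<open>Entries are accessed by \<open>hd\<close> and \<open>drop\<close> and offsets are
  recomputed from prefixes, so that the closure rules for list operations apply to the definition as
  it stands.\<close>

definition link :: "gate list list \<Rightarrow> gate list" where
  "link Bs = concat (map (\<lambda>i. map (reloc 0 (length (concat (take i Bs)))) (hd (drop i Bs))) [0..<length Bs])"

lemma link_Nil: "link [] = []"
  by (simp add: link_def)

lemma length_link: "length (link Bs) = length (concat Bs)"
proof -
  have "map (\<lambda>i. length (hd (drop i Bs))) [0..<length Bs] = map length Bs"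
    by (rule nth_equalityI) (auto simp: hd_drop_conv_nth)
  then show ?thesis
    by (simp add: link_def length_concat comp_def)
qed

lemma link_snoc: "link (Bs @ [B]) = link Bs @ map (reloc 0 (length (link Bs))) B"
proof -
  define F where "F i = map (reloc 0 (length (concat (take i (Bs @ [B]))))) (hd (drop i (Bs @ [B])))" for i
  have "map F [0..<length Bs] = map (\<lambda>i. map (reloc 0 (length (concat (take i Bs)))) (hd (drop i Bs))) [0..<length Bs]"
    unfolding F_def by (rule map_cong) (auto simp: hd_drop_conv_nth nth_append)
  then have "concat (map F [0..<length Bs]) = link Bs"
    by (simp only: link_def)
  moreover have "F (length Bs) = map (reloc 0 (length (link Bs))) B"
    by (simp add: F_def length_link)
  moreover have "link (Bs @ [B]) = concat (map F [0..<length Bs]) @ F (length Bs)"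
    unfolding link_def F_def by simp
  ultimately show ?thesis
    by simp
qed

lemma wf_gates_link: "\<forall>B \<in> set Bs. wf_gates n B \<Longrightarrow> wf_gates n (link Bs)"
proof (induction Bs rule: rev_induct)
  case (snoc B Bs)
  then show ?case
    unfolding link_snoc by (intro wf_gates_append_reloc) auto
qed (simp add: link_Nil wf_gates_def)

lemma gate_vals_link:
  "\<forall>B \<in> set Bs. wf_gates n B \<Longrightarrow> gate_vals x (link Bs) = concat (map (gate_vals x) Bs)"
proof (induction Bs rule: rev_induct)
  case (snoc B Bs)
  then show ?case
    unfolding link_snoc by (subst gate_vals_append_reloc[where n = n and x = x]) auto
qed (simp add: link_Nil)

text \<open>The last gate of a block carries its result; this is the place where the threshold
  circuit picks it up.\<close>

definition last_pos :: "gate list list \<Rightarrow> nat \<Rightarrow> nat" where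
  "last_pos Bs i = length (concat (take (Suc i) Bs)) - 1"

lemma nth_concat_last:
  assumes "i < length xss" "xss ! i \<noteq> []"
  shows "concat xss ! (length (concat (take (Suc i) xss)) - 1) = last (xss ! i)"
proof -
  let ?p = "concat (take (Suc i) xss)"
  have p: "?p = concat (take i xss) @ xss ! i"
    using assms(1) by (simp add: take_Suc_conv_app_nth)
  have "concat xss = ?p @ concat (drop (Suc i) xss)"
    by (metis append_take_drop_id concat_append)
  moreover have "?p \<noteq> []"
    using p assms(2) by simp
  ultimately have "concat xss ! (length ?p - 1) = last ?p"
    by (simp add: nth_append last_conv_nth)
  then show ?thesis
    using p assms(2) by simp
qed

lemma last_pos_less:
  assumes "i < length Bs" "Bs ! i \<noteq> []"
  shows "last_pos Bs i < length (link Bs)"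
proof -
  have "concat Bs = concat (take (Suc i) Bs) @ concat (drop (Suc i) Bs)"
    by (metis append_take_drop_id concat_append)
  moreover have "concat (take (Suc i) Bs) \<noteq> []"
    using assms by (simp add: take_Suc_conv_app_nth)
  ultimately show ?thesis
    unfolding length_link last_pos_def
    by (metis One_nat_def diff_less length_append length_greater_0_conv trans_less_add1 zero_less_one)
qed

lemma gate_vals_last_pos:
  assumes "\<forall>B \<in> set Bs. wf_gates n B" "i < length Bs" "Bs ! i \<noteq> []"
  shows "gate_vals x (link Bs) ! last_pos Bs i = last (gate_vals x (Bs ! i))"
proof -
  have "length (concat (take k (map (gate_vals x) Bs))) = length (concat (take k Bs))" for k
    by (simp add: length_concat take_map comp_def)
  moreover have "gate_vals x (Bs ! i) \<noteq> []"
    using assms(3) by (metis length_gate_vals length_0_conv)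
  ultimately show ?thesis
    using nth_concat_last[of i "map (gate_vals x) Bs"] assms(2) gate_vals_link[OF assms(1)]
    by (simp add: last_pos_def)
qed

subsection \<open>Comparison of the values of a circuit\<close>

text \<open>
  Both operands are scanned from the least significant bit: \<open>r\<close> is \<open>u \<ge> v\<close> if the
  initial value is \<open>True\<close>, and \<open>u > v\<close> if it is \<open>False\<close>. The stage at
  position \<open>p\<close> updates \<open>r\<close>, stored at \<open>p - 1\<close>, to
  \<open>(u \<and> \<not> v) \<or> (r \<and> (u \<or> \<not> v))\<close> for the bits \<open>u\<close> at \<open>i\<close> and \<open>v\<close> at \<open>N + i\<close>.
\<close>

definition cmp_stage :: "nat \<Rightarrow> nat \<Rightarrow> nat \<Rightarrow> gate list" where
  "cmp_stage N i p = [Not (N + i), And i p, Or i p, And (p - 1) (p + 2), Or (p + 1) (p + 3)]"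

text \<open>The outputs list the most significant bit first, hence \<open>rev os\<close>. Stage
  \<open>j\<close> occupies five gates from \<open>2 * N + 5 * j + 1\<close> on, so the gate just
  before it is the previous result or, for \<open>j = 0\<close>, the initial constant.\<close>

definition cmp_block :: "bool \<Rightarrow> nat \<Rightarrow> gate list \<Rightarrow> nat list \<Rightarrow> gate list" where
  "cmp_block b n gs os =
     (let N = length gs in
      gs @ map (reloc n N) gs @ [Const b] @
      concat (map (\<lambda>j. cmp_stage N (hd (drop j (rev os))) (2 * N + 5 * j + 1)) [0..<length os]))"

lemma nth_concat_uniform:
  "(\<And>i. i < n \<Longrightarrow> length (f i) = c) \<Longrightarrow> i < n \<Longrightarrow> e < c \<Longrightarrow> concat (map f [0..<n]) ! (i * c + e) = f i ! e"
  and length_concat_uniform: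
  "(\<And>i. i < n \<Longrightarrow> length (f i) = c) \<Longrightarrow> length (concat (map f [0..<n])) = n * c"
proof -
  have len: "(\<And>i. i < n \<Longrightarrow> length (f i) = c) \<Longrightarrow> length (concat (map f [0..<n])) = n * c" for n
    by (induction n) auto
  then show "(\<And>i. i < n \<Longrightarrow> length (f i) = c) \<Longrightarrow> length (concat (map f [0..<n])) = n * c" .
  show "(\<And>i. i < n \<Longrightarrow> length (f i) = c) \<Longrightarrow> i < n \<Longrightarrow> e < c \<Longrightarrow> concat (map f [0..<n]) ! (i * c + e) = f i ! e"
  proof (induction n)
    case (Suc n)
    have l: "length (concat (map f [0..<n])) = n * c"
      by (rule len) (use Suc.prems(1) in simp)
    show ?case
    proof (cases "i = n")
      case True
      then show ?thesis
        using l by (simp add: nth_append)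
    next
      case False
      then have "i < n"
        using Suc.prems by simp
      then have "Suc i * c \<le> n * c"
        by (intro mult_le_mono1) simp
      then have "i * c + e < n * c"
        using Suc.prems(3) by simp
      then show ?thesis
        using l Suc \<open>i < n\<close> by (simp add: nth_append)
    qed
  qed simp
qed

lemma length_cmp_stage: "length (cmp_stage N i p) = 5"
  by (simp add: cmp_stage_def)

lemma length_cmp_block: "length (cmp_block b n gs os) = 2 * length gs + 5 * length os + 1"
proof -
  have "length (concat (map (\<lambda>j. cmp_stage (length gs) (hd (drop j (rev os))) (2 * length gs + 5 * j + 1))
      [0..<length os])) = length os * 5"
    by (intro length_concat_uniform length_cmp_stage)
  then show ?thesis
    unfolding cmp_block_def Let_def length_append by simp
qed

lemma cmp_block_nth:
  "j < length os \<Longrightarrow> e < 5 \<Longrightarrow> cmp_block b n gs os ! (2 * length gs + 5 * j + 1 + e) =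
    cmp_stage (length gs) (rev os ! j) (2 * length gs + 5 * j + 1) ! e"
  "cmp_block b n gs os ! (2 * length gs) = Const b"
proof -
  let ?N = "length gs"
  let ?S = "concat (map (\<lambda>j. cmp_stage ?N (hd (drop j (rev os))) (2 * ?N + 5 * j + 1)) [0..<length os])"
  let ?P = "gs @ map (reloc n ?N) gs"
  have B: "cmp_block b n gs os = ?P @ Const b # ?S" and P: "length ?P = 2 * ?N"
    by (simp_all add: cmp_block_def Let_def)
  show "cmp_block b n gs os ! (2 * ?N) = Const b"
    unfolding B P[symmetric] by (rule nth_append_length)
  assume j: "j < length os" "e < 5"
  have "2 * ?N + 5 * j + 1 + e = length ?P + Suc (j * 5 + e)"
    unfolding P by simp
  then have "cmp_block b n gs os ! (2 * ?N + 5 * j + 1 + e) = (?P @ Const b # ?S) ! (length ?P + Suc (j * 5 + e))"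
    unfolding B by (rule arg_cong)
  also have "\<dots> = ?S ! (j * 5 + e)"
    by (simp only: nth_append_length_plus nth_Cons_Suc)
  also have "\<dots> = cmp_stage ?N (rev os ! j) (2 * ?N + 5 * j + 1) ! e"
  proof -
    have "?S ! (j * 5 + e) = cmp_stage ?N (hd (drop j (rev os))) (2 * ?N + 5 * j + 1) ! e"
      by (intro nth_concat_uniform length_cmp_stage j)
    then show ?thesis
      using j by (simp add: hd_drop_conv_nth)
  qed
  finally show "cmp_block b n gs os ! (2 * ?N + 5 * j + 1 + e) =
    cmp_stage ?N (rev os ! j) (2 * ?N + 5 * j + 1) ! e" .
qed

lemma less_5_cases: "e < 5 \<Longrightarrow> e = 0 \<or> e = 1 \<or> e = 2 \<or> e = 3 \<or> e = (4::nat)"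
  by auto

lemma wf_cmp_block:
  assumes gs: "wf_gates n gs" and os: "\<forall>i \<in> set os. i < length gs"
  shows "wf_gates (2 * n) (cmp_block b n gs os)"
  unfolding wf_gates_def
proof (intro allI impI)
  fix k
  assume k: "k < length (cmp_block b n gs os)"
  let ?N = "length gs"
  let ?P = "gs @ map (reloc n ?N) gs"
  have P: "wf_gates (2 * n) ?P" "length ?P = 2 * ?N"
    using wf_gates_append_reloc[of "2 * n" gs n gs n] wf_gates_mono[OF gs, of "2 * n"] gs by simp_all
  consider "k < 2 * ?N" | "k = 2 * ?N" | "k > 2 * ?N"
    by linarith
  then show "wf_gate (2 * n) k (cmp_block b n gs os ! k)"
  proof cases
    case 1
    then have "cmp_block b n gs os ! k = ?P ! k"
      using P(2) unfolding cmp_block_def Let_def append_assoc[symmetric, of gs "map _ _" "_ @ _"]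
      by (subst nth_append) simp
    then show ?thesis
      using 1 P unfolding wf_gates_def by simp
  next
    case 2
    then show ?thesis
      using cmp_block_nth(2) by simp
  next
    case 3
    define j e where "j = (k - 2 * ?N - 1) div 5" and "e = (k - 2 * ?N - 1) mod 5"
    have e: "e < 5" and j: "j < length os" and k: "k = 2 * ?N + 5 * j + 1 + e"
      using 3 k by (auto simp: j_def e_def length_cmp_block)
    have "rev os ! j < ?N"
      using os j by (metis length_rev nth_mem set_rev)
    then show ?thesis
      using cmp_block_nth(1)[OF j e, of b n gs] less_5_cases[OF e] unfolding k
      by (elim disjE) (simp_all add: cmp_stage_def)
  qed
qed

lemma horner_sum_bounds: "0 \<le> horner_sum of_bool (2::int) us" "horner_sum of_bool (2::int) us < 2 ^ length us"
  by (induction us) auto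

lemma horner_sum_snoc: "horner_sum of_bool (2::int) (us @ [u]) = horner_sum of_bool 2 us + 2 ^ length us * of_bool u"
  by (simp add: horner_sum_append)

text \<open>After \<open>j\<close> stages the result compares the numbers formed by the
  \<open>j\<close> lowest bits. These numbers are less than \<open>2 ^ j\<close>, so the next bit
  decides the comparison unless it is the same on both sides, in which case the previous result
  stands.\<close>

lemma cmp_block_value:
  assumes gs: "wf_gates n gs" and os: "\<forall>i \<in> set os. i < length gs"
    and x: "length x = n" and y: "length y = n"
  defines "cx \<equiv> binary_value (map ((!) (gate_vals x gs)) os)"
    and "cy \<equiv> binary_value (map ((!) (gate_vals y gs)) os)"
  shows "last (gate_vals (x @ y) (cmp_block b n gs os)) \<longleftrightarrow> (if b then cx \<ge> cy else cx > cy)"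
proof -
  let ?N = "length gs" and ?B = "cmp_block b n gs os"
  let ?P = "gs @ map (reloc n ?N) gs"
  define V where "V = gate_vals (x @ y) ?B"
  define us vs where "us = rev (map ((!) (gate_vals x gs)) os)" and "vs = rev (map ((!) (gate_vals y gs)) os)"
  have wfB: "wf_gates (2 * n) ?B"
    using wf_cmp_block[OF gs os] .
  \<comment> \<open>The first copy is viewed as a relocation by zero behind the empty list; the same
    lemma then shows that it depends on \<open>x\<close> only.\<close>
  have "gate_vals (x @ y) ([] @ map (reloc 0 (length ([] :: gate list))) gs) = gate_vals (x @ y) [] @ gate_vals x gs"
    by (rule gate_vals_append_reloc[OF gs]) (simp add: x nth_append)
  then have "gate_vals (x @ y) gs = gate_vals x gs"
    by (simp add: reloc_0_0)
  moreover have "gate_vals (x @ y) ?P = gate_vals (x @ y) gs @ gate_vals y gs"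
    by (rule gate_vals_append_reloc[OF gs]) (simp add: x[symmetric])
  ultimately have P: "gate_vals (x @ y) ?P = gate_vals x gs @ gate_vals y gs"
    by simp
  have VP: "V ! k = (gate_vals x gs @ gate_vals y gs) ! k" if "k < 2 * ?N" for k
    using gate_vals_append_nth[of k ?P "x @ y" "[Const b] @
      concat (map (\<lambda>j. cmp_stage ?N (hd (drop j (rev os))) (2 * ?N + 5 * j + 1)) [0..<length os])"] that
    by (simp add: V_def cmp_block_def Let_def P[symmetric])
  have Vk: "V ! k = gate_val (x @ y) V (?B ! k)" if "k < length ?B" for k
    unfolding V_def by (rule gate_vals_nth[OF wfB that])
  have "V ! (2 * ?N + 5 * j) \<longleftrightarrow>
      (if b then horner_sum of_bool (2::int) (take j us) \<ge> horner_sum of_bool 2 (take j vs)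
       else horner_sum of_bool (2::int) (take j us) > horner_sum of_bool 2 (take j vs))"
    if "j \<le> length os" for j
    using that
  proof (induction j)
    case 0
    then show ?case
      using Vk[of "2 * ?N"] by (simp add: length_cmp_block cmp_block_nth)
  next
    case (Suc j)
    then have j: "j < length os"
      by simp
    define p where "p = 2 * ?N + 5 * j + 1"
    define i where "i = rev os ! j"
    have i: "i < ?N"
      unfolding i_def using os j by (metis length_rev nth_mem set_rev)
    have S: "V ! (p + e) = gate_val (x @ y) V (cmp_stage ?N i p ! e)" if "e < 5" for e
      using Vk[of "p + e"] cmp_block_nth(1)[OF j that, of b n gs] j that
      by (simp add: p_def i_def length_cmp_block)
    have u: "V ! i = us ! j" and v: "V ! (?N + i) = vs ! j"
      using VP[of i] VP[of "?N + i"] i j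
      by (simp_all add: us_def vs_def i_def nth_append rev_map)
    have r: "V ! (p + 4) \<longleftrightarrow> (us ! j \<and> \<not> vs ! j) \<or> (V ! (2 * ?N + 5 * j) \<and> (us ! j \<or> \<not> vs ! j))"
    proof -
      have "p - 1 = 2 * ?N + 5 * j"
        by (simp add: p_def)
      then show ?thesis
        using S[of 0] S[of 1] S[of 2] S[of 3] S[of 4] u v
        by (simp add: cmp_stage_def eval_nat_numeral)
    qed
    have tu: "take (Suc j) us = take j us @ [us ! j]" and tv: "take (Suc j) vs = take j vs @ [vs ! j]"
      and len: "length (take j us) = j" "length (take j vs) = j"
      using j by (simp_all add: us_def vs_def take_Suc_conv_app_nth)
    have "2 * ?N + 5 * Suc j = p + 4"
      by (simp add: p_def)
    then have "V ! (2 * ?N + 5 * Suc j) = V ! (p + 4)"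
      by (rule arg_cong)
    then show ?case
      using r Suc.IH j horner_sum_bounds[of "take j us"] horner_sum_bounds[of "take j vs"]
      unfolding tu tv horner_sum_snoc len
      by (cases "us ! j"; cases "vs ! j") auto
  qed
  from this[of "length os"]
  have "V ! (2 * ?N + 5 * length os) \<longleftrightarrow> (if b then cx \<ge> cy else cx > cy)"
    by (simp add: cx_def cy_def binary_value_def us_def vs_def)
  moreover have "last V = V ! (2 * ?N + 5 * length os)"
  proof -
    have "length V = 2 * ?N + 5 * length os + 1"
      by (simp add: V_def length_cmp_block)
    then show ?thesis
      by (subst last_conv_nth) auto
  qed
  ultimately show ?thesis
    by (simp add: V_def)
qed

subsection \<open>The threshold circuit\<close>

text \<open>
  Cell \<open>(k, j)\<close> consists of two gates, the second of which tells whether at least \<open>j\<close> of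
  the first \<open>k\<close> bits are set. The bits are at the positions \<open>ps 0\<close>, \<open>ps 1\<close> and so on.
\<close>

definition cell_pos :: "nat \<Rightarrow> nat \<Rightarrow> nat \<Rightarrow> nat \<Rightarrow> nat" where
  "cell_pos N W k j = N + k * (Suc W * 2) + j * 2"

text \<open>At least \<open>j\<close> of \<open>k\<close> bits are set iff already \<open>j\<close>
  of the first \<open>k - 1\<close> are, or the last bit is set and \<open>j - 1\<close> of the
  others are. Constants are doubled so that all cells have the same width and positions follow a
  formula.\<close>

definition cell :: "nat \<Rightarrow> nat \<Rightarrow> (nat \<Rightarrow> nat) \<Rightarrow> nat \<Rightarrow> nat \<Rightarrow> gate list" where
  "cell N W ps k j =
     (if j = 0 then [Const True, Const True]
      else if k = 0 then [Const False, Const False]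
      else [And (ps (k - 1)) (cell_pos N W (k - 1) (j - 1) + 1),
            Or (cell_pos N W (k - 1) j + 1) (cell_pos N W k j)])"

definition threshold :: "nat \<Rightarrow> nat \<Rightarrow> nat \<Rightarrow> (nat \<Rightarrow> nat) \<Rightarrow> gate list" where
  "threshold N W M ps = concat (map (\<lambda>k. concat (map (\<lambda>j. cell N W ps k j) [0..<Suc W])) [0..<Suc M])"

lemma length_cell: "length (cell N W ps k j) = 2"
  by (simp add: cell_def)

lemma length_threshold: "length (threshold N W M ps) = Suc M * (Suc W * 2)"
  unfolding threshold_def by (intro length_concat_uniform length_cell)

lemma threshold_nth:
  assumes G: "length G = N" and k: "k \<le> M" and j: "j \<le> W" and e: "e < 2"
  shows "(G @ threshold N W M ps) ! (cell_pos N W k j + e) = cell N W ps k j ! e"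
proof -
  have "j * 2 + e < Suc W * 2"
    using j e by arith
  then have "concat (map (\<lambda>k. concat (map (cell N W ps k) [0..<Suc W])) [0..<Suc M]) ! (k * (Suc W * 2) + (j * 2 + e)) =
      concat (map (cell N W ps k) [0..<Suc W]) ! (j * 2 + e)"
    using k by (intro nth_concat_uniform length_concat_uniform length_cell) simp_all
  also have "\<dots> = cell N W ps k j ! e"
    using j e by (intro nth_concat_uniform length_cell) simp_all
  finally show ?thesis
    unfolding threshold_def[symmetric] cell_pos_def G[symmetric] add.assoc nth_append_length_plus .
qed

lemma cell_pos_less: "k \<le> M \<Longrightarrow> j \<le> W \<Longrightarrow> e < 2 \<Longrightarrow> cell_pos N W k j + e < N + Suc M * (Suc W * 2)"
proof -
  assume *: "k \<le> M" "j \<le> W" "e < 2"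
  have "k * (Suc W * 2) \<le> M * (Suc W * 2)"
    using *(1) by (rule mult_le_mono1)
  moreover have "j * 2 + e < Suc W * 2"
    using * by arith
  ultimately show ?thesis
    unfolding cell_pos_def by (simp only: mult_Suc)
qed

lemma cell_pos_exhaust:
  assumes "N \<le> p" "p < N + Suc M * (Suc W * 2)"
  obtains k j e where "k \<le> M" "j \<le> W" "e < 2" "p = cell_pos N W k j + e"
proof -
  define c where "c = Suc W * 2"
  define q where "q = p - N"
  have c: "c > 0"
    by (simp add: c_def)
  have "q < Suc M * c"
    using assms by (simp add: q_def c_def)
  then have "q div c < Suc M"
    by (simp add: less_mult_imp_div_less)
  moreover have "q mod c div 2 < Suc W"
    using c by (intro less_mult_imp_div_less) (simp add: c_def)
  moreover have "p = cell_pos N W (q div c) (q mod c div 2) + q mod c mod 2"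
    using assms(1) div_mult_mod_eq[of q c] div_mult_mod_eq[of "q mod c" 2]
    unfolding cell_pos_def c_def[symmetric] q_def by linarith
  ultimately show ?thesis
    using that[of "q div c" "q mod c div 2" "q mod c mod 2"] by simp
qed

lemma wf_threshold:
  assumes G: "wf_gates n G" "length G = N" and ps: "\<And>k. k < M \<Longrightarrow> ps k < N"
  shows "wf_gates n (G @ threshold N W M ps)"
  unfolding wf_gates_def
proof (intro allI impI)
  fix p
  assume p: "p < length (G @ threshold N W M ps)"
  show "wf_gate n p ((G @ threshold N W M ps) ! p)"
  proof (cases "p < N")
    case True
    then show ?thesis
      using G by (simp add: wf_gates_def nth_append)
  next
    case False
    then have "N \<le> p" "p < N + Suc M * (Suc W * 2)"
      using p G(2) by (simp_all add: length_threshold)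
    then obtain k j e where *: "k \<le> M" "j \<le> W" "e < 2" "p = cell_pos N W k j + e"
      by (rule cell_pos_exhaust)
    have "wf_gate n (cell_pos N W k j + e) (cell N W ps k j ! e)"
    proof (cases "j = 0 \<or> k = 0")
      case True
      then show ?thesis
        using *(3) by (auto simp: cell_def less_2_cases_iff)
    next
      case False
      then obtain k' j' where kj: "k = Suc k'" "j = Suc j'"
        by (meson not0_implies_Suc)
      then have "ps k' < N"
        using ps * by simp
      then show ?thesis
        using * kj by (auto simp: cell_def less_2_cases_iff cell_pos_def)
    qed
    then show ?thesis
      using threshold_nth[OF G(2) *(1-3)] *(4) by simp
  qed
qed

lemma threshold_value:
  assumes G: "wf_gates n G" "length G = N" and ps: "\<And>k. k < M \<Longrightarrow> ps k < N"
  shows "k \<le> M \<Longrightarrow> j \<le> W \<Longrightarrow> gate_vals x (G @ threshold N W M ps) ! (cell_pos N W k j + 1) \<longleftrightarrow>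
    j \<le> length (filter (\<lambda>i. gate_vals x G ! ps i) [0..<k])"
proof -
  define V where "V = gate_vals x (G @ threshold N W M ps)"
  have V: "V ! (cell_pos N W k j + e) = gate_val x V (cell N W ps k j ! e)"
    if "k \<le> M" "j \<le> W" "e < 2" for k j e
  proof -
    have "cell_pos N W k j + e < length (G @ threshold N W M ps)"
      using cell_pos_less[OF that] G(2) by (simp add: length_threshold)
    then have "V ! (cell_pos N W k j + e) = gate_val x V ((G @ threshold N W M ps) ! (cell_pos N W k j + e))"
      unfolding V_def by (intro gate_vals_nth[where n = n] wf_threshold G ps)
    then show ?thesis
      unfolding threshold_nth[OF G(2) that] .
  qed
  have "k \<le> M \<Longrightarrow> j \<le> W \<Longrightarrow> V ! (cell_pos N W k j + 1) \<longleftrightarrow>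
    j \<le> length (filter (\<lambda>i. gate_vals x G ! ps i) [0..<k])"
  proof (induction k arbitrary: j)
    case 0
    then show ?case
      using V[of 0 j 1] by (auto simp: cell_def)
  next
    case (Suc k)
    have ps': "V ! ps k = gate_vals x G ! ps k"
      unfolding V_def using G(2) ps[of k] Suc.prems by (intro gate_vals_append_nth) simp
    show ?case
    proof (cases j)
      case 0
      then show ?thesis
        using V[of "Suc k" j 1] Suc.prems by (simp add: cell_def)
    next
      case (Suc i)
      have "V ! (cell_pos N W (Suc k) j + 1) \<longleftrightarrow>
          V ! (cell_pos N W k j + 1) \<or> (V ! ps k \<and> V ! (cell_pos N W k i + 1))"
        using V[of "Suc k" j 1] V[of "Suc k" j 0] Suc.prems Suc by (auto simp: cell_def)
      then show ?thesis
        using Suc.IH[of j] Suc.IH[of i] Suc.prems Suc ps' by auto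
    qed
  qed
  then show "k \<le> M \<Longrightarrow> j \<le> W \<Longrightarrow> gate_vals x (G @ threshold N W M ps) ! (cell_pos N W k j + 1) \<longleftrightarrow>
    j \<le> length (filter (\<lambda>i. gate_vals x G ! ps i) [0..<k])"
    unfolding V_def .
qed

subsection \<open>Correctness of the tournament circuit\<close>

definition tournament_blocks :: "circuit list \<Rightarrow> gate list list" where
  "tournament_blocks Cs = concat (map (\<lambda>C.
     [cmp_block False (num_inputs C) (gates C) (outputs C), cmp_block True (num_inputs C) (gates C) (outputs C)]) Cs)"

text \<open>For \<open>m\<close> circuits the output is the cell for at least \<open>m + 1\<close>
  of all \<open>2 * m\<close> bits, so columns up to \<open>W = m + 1\<close> are enough.\<close>

definition tournament_circuit :: "circuit list \<Rightarrow> circuit" where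
  "tournament_circuit Cs =
     (let Bs = tournament_blocks Cs; N = length (link Bs); W = Suc (length Cs); M = 2 * length Cs in
      \<lparr>num_inputs = 2 * num_inputs (hd Cs),
       gates = link Bs @ threshold N W M (last_pos Bs),
       outputs = [cell_pos N W M W + 1]\<rparr>)"

lemma length_tournament_blocks: "length (tournament_blocks Cs) = 2 * length Cs"
  unfolding tournament_blocks_def by (induction Cs) simp_all

text \<open>The common number of inputs is read off the first circuit instead of being quantified,
  which makes the condition directly testable.\<close>

definition valid_circuits :: "circuit list \<Rightarrow> bool" where
  "valid_circuits Cs \<longleftrightarrow> Cs \<noteq> [] \<and> (\<forall>C \<in> set Cs. is_circuit (num_inputs (hd Cs)) (num_inputs (hd Cs)) C)"

lemma is_circuitD:
  assumes "is_circuit n m C"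
  shows "num_inputs C = n" "length (outputs C) = m" "wf_gates n (gates C)" "\<forall>i \<in> set (outputs C). i < length (gates C)"
  using assms by (auto simp: is_circuit_def wf_circuit_def wf_gates_def)

context
  fixes Cs n
  assumes Cs: "Cs \<noteq> []" "\<forall>C \<in> set Cs. is_circuit n n C"
begin

lemma num_inputs_hd: "num_inputs (hd Cs) = n"
  by (rule is_circuitD(1)[OF bspec[OF Cs(2) hd_in_set[OF Cs(1)]]])

lemma tournament_blocks_wf:
  assumes "B \<in> set (tournament_blocks Cs)"
  shows "wf_gates (2 * n) B \<and> B \<noteq> []"
proof -
  obtain C b where C: "C \<in> set Cs" and B: "B = cmp_block b (num_inputs C) (gates C) (outputs C)"
    using assms by (auto simp: tournament_blocks_def)
  note * = is_circuitD[OF Cs(2)[rule_format, OF C]]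
  show ?thesis
    using wf_cmp_block[OF *(3,4), of b] length_cmp_block[of b n "gates C" "outputs C"] *(1) B by auto
qed

lemma is_circuit_tournament: "is_circuit (2 * n) 1 (tournament_circuit Cs)"
proof -
  let ?Bs = "tournament_blocks Cs"
  define G where "G = link ?Bs @ threshold (length (link ?Bs)) (Suc (length Cs)) (2 * length Cs) (last_pos ?Bs)"
  have "wf_gates (2 * n) G"
    unfolding G_def
  proof (intro wf_threshold refl)
    show "wf_gates (2 * n) (link ?Bs)"
      by (rule wf_gates_link) (use tournament_blocks_wf in blast)
    show "last_pos ?Bs k < length (link ?Bs)" if "k < 2 * length Cs" for k
      by (rule last_pos_less) (use that tournament_blocks_wf length_tournament_blocks in auto)
  qed
  moreover have "cell_pos (length (link ?Bs)) (Suc (length Cs)) (2 * length Cs) (Suc (length Cs)) + 1 < length G"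
    unfolding G_def length_append length_threshold by (rule cell_pos_less) simp_all
  ultimately show ?thesis
    unfolding is_circuit_def wf_circuit_def tournament_circuit_def Let_def G_def[symmetric]
    by (simp add: wf_gates_def num_inputs_hd)
qed

lemma eval_tournament:
  assumes x: "length x = n" and y: "length y = n"
  shows "eval_circuit (tournament_circuit Cs) (x @ y) =
    [(\<Sum>i < length Cs. sgn (binary_value (eval_circuit (Cs ! i) x) - binary_value (eval_circuit (Cs ! i) y))) > 0]"
proof -
  let ?Bs = "tournament_blocks Cs" and ?m = "length Cs"
  let ?N = "length (link ?Bs)"
  let ?h = "\<lambda>B. last (gate_vals (x @ y) B)"
  let ?s = "\<lambda>C. sgn (binary_value (eval_circuit C x) - binary_value (eval_circuit C y))"
  have wf: "\<forall>B \<in> set ?Bs. wf_gates (2 * n) B" and ne: "i < length ?Bs \<Longrightarrow> ?Bs ! i \<noteq> []" for i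
    using tournament_blocks_wf nth_mem by blast+
  have "filter (\<lambda>i. gate_vals (x @ y) (link ?Bs) ! last_pos ?Bs i) [0..<2 * ?m] =
      filter (\<lambda>i. ?h (?Bs ! i)) [0..<2 * ?m]"
    by (rule filter_cong) (simp_all add: gate_vals_last_pos[OF wf _ ne] length_tournament_blocks)
  moreover have "length (filter (\<lambda>i. ?h (?Bs ! i)) [0..<2 * ?m]) = length (filter ?h (map ((!) ?Bs) [0..<2 * ?m]))"
    unfolding filter_map by (simp add: comp_def)
  moreover have "map ((!) ?Bs) [0..<2 * ?m] = ?Bs"
    using map_nth[of ?Bs] by (simp add: length_tournament_blocks)
  ultimately have count: "length (filter (\<lambda>i. gate_vals (x @ y) (link ?Bs) ! last_pos ?Bs i) [0..<2 * ?m]) =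
      length (filter ?h ?Bs)"
    by simp
  \<comment> \<open>The induction is over circuits rather than blocks, because the identity holds
    only for the two blocks of a circuit together.\<close>
  have "int (length (filter ?h (tournament_blocks Ds))) = sum_list (map ?s Ds) + int (length Ds)"
    if "set Ds \<subseteq> set Cs" for Ds
    using that
  proof (induction Ds)
    case (Cons C Ds)
    then have C: "is_circuit n n C"
      using Cs(2) by auto
    note * = is_circuitD[OF C]
    have "?h (cmp_block b n (gates C) (outputs C)) \<longleftrightarrow>
        (if b then binary_value (eval_circuit C x) \<ge> binary_value (eval_circuit C y)
         else binary_value (eval_circuit C x) > binary_value (eval_circuit C y))" for b
      unfolding eval_circuit_def by (rule cmp_block_value[OF *(3,4) x y])
    then show ?case
      using Cons *(1) by (auto simp: tournament_blocks_def sgn_if)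
  qed (simp add: tournament_blocks_def)
  then have "int (length (filter ?h ?Bs)) = (\<Sum>i < ?m. ?s (Cs ! i)) + int ?m"
    by (simp add: sum_list_sum_nth atLeast0LessThan)
  then have "Suc ?m \<le> length (filter ?h ?Bs) \<longleftrightarrow> (\<Sum>i < ?m. ?s (Cs ! i)) > 0"
    by linarith
  moreover have "gate_vals (x @ y) (link ?Bs @ threshold ?N (Suc ?m) (2 * ?m) (last_pos ?Bs)) !
      (cell_pos ?N (Suc ?m) (2 * ?m) (Suc ?m) + 1) \<longleftrightarrow> Suc ?m \<le> length (filter ?h ?Bs)"
    unfolding count[symmetric]
  proof (rule threshold_value)
    show "wf_gates (2 * n) (link ?Bs)"
      by (rule wf_gates_link[OF wf])
    show "last_pos ?Bs k < length (link ?Bs)" if "k < 2 * length Cs" for k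
      by (rule last_pos_less) (use that ne length_tournament_blocks in auto)
  qed simp_all
  ultimately show ?thesis
    by (simp add: eval_circuit_def tournament_circuit_def Let_def)
qed

lemma tournament_in_WTS_iff:
  "enc_circuit (tournament_circuit Cs) \<in> Weak_Tournament_Source \<longleftrightarrow> enc_list enc_circuit Cs \<in> Ckt_Condorcet"
proof -
  define S where "S x y = (\<Sum>i < length Cs. sgn (binary_value (eval_circuit (Cs ! i) x) - binary_value (eval_circuit (Cs ! i) y)))" for x y
  have anti: "S y x = - S x y" for x y
    unfolding S_def sum_negf[symmetric] by (rule sum.cong) (auto simp: sgn_if)
  have "enc_circuit (tournament_circuit Cs) \<in> Weak_Tournament_Source \<longleftrightarrow>
      (\<exists>x. length x = n \<and> (\<forall>y. length y = n \<and> y \<noteq> x \<longrightarrow>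
        eval_circuit (tournament_circuit Cs) (x @ y) = [True] \<and> eval_circuit (tournament_circuit Cs) (y @ x) = [False]))"
    (is "_ \<longleftrightarrow> ?R")
  proof
    assume "enc_circuit (tournament_circuit Cs) \<in> Weak_Tournament_Source"
    then obtain n' where "is_circuit (2 * n') 1 (tournament_circuit Cs)"
      "\<exists>x. length x = n' \<and> (\<forall>y. length y = n' \<and> y \<noteq> x \<longrightarrow>
        eval_circuit (tournament_circuit Cs) (x @ y) = [True] \<and> eval_circuit (tournament_circuit Cs) (y @ x) = [False])"
      unfolding Weak_Tournament_Source_def using injD[OF inj_enc_circuit] by blast
    \<comment> \<open>The language quantifies over the input length; as the encoding is injective,
      the number of inputs of the circuit determines it.\<close>
    moreover from this have "n' = n"
      using is_circuit_tournament by (simp add: is_circuit_def)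
    ultimately show ?R
      by simp
  next
    assume ?R
    then show "enc_circuit (tournament_circuit Cs) \<in> Weak_Tournament_Source"
      unfolding Weak_Tournament_Source_def using is_circuit_tournament by blast
  qed
  also have "\<dots> \<longleftrightarrow> (\<exists>x. length x = n \<and> (\<forall>y. length y = n \<and> y \<noteq> x \<longrightarrow> S x y > 0))"
  proof -
    have "eval_circuit (tournament_circuit Cs) (x @ y) = [True] \<and>
        eval_circuit (tournament_circuit Cs) (y @ x) = [False] \<longleftrightarrow> S x y > 0"
      if "length x = n" "length y = n" for x y
      using anti[of y x] eval_tournament[OF that, folded S_def] eval_tournament[OF that(2,1), folded S_def] by auto
    then show ?thesis
      by blast
  qed
  also have "\<dots> \<longleftrightarrow> enc_list enc_circuit Cs \<in> Ckt_Condorcet"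
  proof
    assume "\<exists>x. length x = n \<and> (\<forall>y. length y = n \<and> y \<noteq> x \<longrightarrow> S x y > 0)"
    then show "enc_list enc_circuit Cs \<in> Ckt_Condorcet"
      unfolding Ckt_Condorcet_def S_def using Cs by blast
  next
    assume "enc_list enc_circuit Cs \<in> Ckt_Condorcet"
    then obtain n' where "\<forall>C \<in> set Cs. is_circuit n' n' C"
      "\<exists>x. length x = n' \<and> (\<forall>y. length y = n' \<and> y \<noteq> x \<longrightarrow> S x y > 0)"
      unfolding Ckt_Condorcet_def S_def using injD[OF inj_enc_circuits] by blast
    moreover from this have "n' = n"
      using Cs is_circuitD(1) by (metis list.set_sel(1))
    ultimately show "\<exists>x. length x = n \<and> (\<forall>y. length y = n \<and> y \<noteq> x \<longrightarrow> S x y > 0)"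
      by simp
  qed
  finally show ?thesis .
qed

end

section \<open>The reduction\<close>

subsection \<open>Parsing\<close>

text \<open>One direction makes the reduction succeed on every encoding; the other one guarantees
  that words which are no encodings are noticed. The rest \<open>r\<close> lets parsers be
  chained.\<close>

definition parses :: "(bool list \<Rightarrow> ('a \<times> bool list) option) \<Rightarrow> ('a \<Rightarrow> bool list) \<Rightarrow> bool" where
  "parses p e \<longleftrightarrow> (\<forall>w a r. p w = Some (a, r) \<longleftrightarrow> w = e a @ r)"

definition parse_nat :: "bool list \<Rightarrow> (nat \<times> bool list) option" where
  "parse_nat w = (if dropWhile id w = [] then None else Some (length w - length (dropWhile id w), tl (dropWhile id w)))"

lemma parses_nat: "parses parse_nat enc_nat"
  unfolding parses_def
proof (intro allI iffI)
  fix w a r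
  have "dropWhile id (enc_nat a @ r) = False # r"
    unfolding enc_nat_def by (induction a) auto
  then show "w = enc_nat a @ r \<Longrightarrow> parse_nat w = Some (a, r)"
    by (simp add: parse_nat_def) (simp add: enc_nat_def)
  show "parse_nat w = Some (a, r) \<Longrightarrow> w = enc_nat a @ r"
  proof (induction w arbitrary: a)
    case (Cons b w)
    show ?case
    proof (cases b)
      case True
      have "length (dropWhile id w) \<le> length w"
        by (rule length_dropWhile_le)
      then obtain a' where "a = Suc a'" "parse_nat w = Some (a', r)"
        using Cons.prems True by (auto simp: parse_nat_def Suc_diff_le split: if_splits)
      then show ?thesis
        using Cons.IH True by (simp add: enc_nat_def)
    next
      case False
      then show ?thesis
        using Cons.prems by (auto simp: parse_nat_def enc_nat_def)
    qed
  qed (simp add: parse_nat_def)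
qed

lemma parsesD1: "parses p e \<Longrightarrow> p (e a @ r) = Some (a, r)"
  by (simp add: parses_def)

lemma parsesD2: "parses p e \<Longrightarrow> p w = Some (a, r) \<Longrightarrow> w = e a @ r"
  by (simp add: parses_def)

text \<open>
  The state consists of the elements found so far, the rest of the input, and two flags: whether
  the list may still continue, and whether its end has been found.
\<close>

definition parse_step ::
  "(bool list \<Rightarrow> ('a \<times> bool list) option) \<Rightarrow> 'a list \<times> bool list \<times> bool \<times> bool \<Rightarrow> 'a list \<times> bool list \<times> bool \<times> bool" where
  "parse_step p s =
     (if \<not> fst (snd (snd s)) then s
      else if fst (snd s) = [] then (fst s, fst (snd s), False, False)
      else if \<not> hd (fst (snd s)) then (fst s, tl (fst (snd s)), False, True)
      else case p (tl (fst (snd s))) of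
        None \<Rightarrow> (fst s, fst (snd s), False, False)
      | Some q \<Rightarrow> (fst s @ [fst q], snd q, True, False))"

text \<open>The word itself is the counter: an encoded list has fewer elements than bits, and steps
  after the end change nothing. A fold with a fixed number of rounds thus replaces recursion on the
  unread input.\<close>

definition parse_list :: "(bool list \<Rightarrow> ('a \<times> bool list) option) \<Rightarrow> bool list \<Rightarrow> ('a list \<times> bool list) option" where
  "parse_list p w =
     (let s = foldl (\<lambda>s u. parse_step p s) ([], w, True, False) w in
      if snd (snd (snd s)) then Some (fst s, fst (snd s)) else None)"

lemma foldl_const: "foldl (\<lambda>s u. f s) s l = (f ^^ length l) s"
  by (induction l arbitrary: s) (simp_all add: funpow_swap1)

text \<open>The inequality is strict because one step beyond the elements is needed to consume the
  terminator.\<close>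

lemma parse_steps_enc_list:
  assumes p: "parses p e"
  shows "length ys < k \<Longrightarrow> (parse_step p ^^ k) (xs, enc_list e ys @ r, True, False) = (xs @ ys, r, False, True)"
proof (induction ys arbitrary: k xs)
  case Nil
  then obtain k' where k: "k = Suc k'"
    by (cases k) auto
  have start: "parse_step p (xs, enc_list e [] @ r, True, False) = (xs, r, False, True)"
    by (simp add: parse_step_def enc_list_def)
  have "(parse_step p ^^ i) (xs, r, False, True) = (xs, r, False, True)" for i
    by (induction i) (simp_all add: parse_step_def)
  then show ?case
    unfolding k funpow_Suc_right comp_apply start by simp
next
  case (Cons y ys)
  then obtain k' where k: "k = Suc k'" "length ys < k'"
    by (cases k) auto
  have "p (e y @ enc_list e ys @ r) = Some (y, enc_list e ys @ r)"
    by (rule parsesD1[OF p])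
  then have "parse_step p (xs, enc_list e (y # ys) @ r, True, False) = (xs @ [y], enc_list e ys @ r, True, False)"
    by (simp add: parse_step_def enc_list_def)
  then show ?case
    using Cons.IH[OF k(2), of "xs @ [y]"] by (simp add: k(1) funpow_swap1)
qed

lemma length_enc_list: "length ys < length (enc_list e ys)"
  by (induction ys) (simp_all add: enc_list_def)

text \<open>While the list may continue, the consumed prefix lacks the final \<open>False\<close>,
  so it is described by the bare concatenation. The clause excluding \<open>go\<close> once
  \<open>ok\<close> holds says that a finished state is frozen.\<close>

lemma parse_steps_invariant:
  assumes p: "parses p e" and s: "(parse_step p ^^ i) ([], w, True, False) = (xs, v, go, ok)"
  shows "(ok \<longrightarrow> \<not> go \<and> w = enc_list e xs @ v) \<and> (go \<longrightarrow> w = concat (map (\<lambda>x. True # e x) xs) @ v)"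
  using s
proof (induction i arbitrary: xs v go ok)
  case (Suc i)
  obtain xs' v' go' ok' where s': "(parse_step p ^^ i) ([], w, True, False) = (xs', v', go', ok')"
    by (metis prod_cases4)
  note IH = Suc.IH[OF s']
  have step: "parse_step p (xs', v', go', ok') = (xs, v, go, ok)"
    using Suc.prems s' by simp
  show ?case
  proof (cases "go' \<and> v' \<noteq> []")
    case False
    then show ?thesis
      using IH step by (cases go'; cases "v' = []") (simp_all add: parse_step_def)
  next
    case True
    then obtain b v'' where v': "v' = b # v''"
      by (cases v') auto
    show ?thesis
    proof (cases b)
      case False
      then show ?thesis
        using IH step True v' by (simp add: parse_step_def enc_list_def)
    next
      case b: True
      show ?thesis
      proof (cases "p v''")
        case None
        then show ?thesis
          using step True v' b by (auto simp: parse_step_def)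
      next
        case (Some q)
        then have "v'' = e (fst q) @ snd q"
          using parsesD2[OF p, of v'' "fst q" "snd q"] by simp
        then show ?thesis
          using Some IH step True v' b by (auto simp: parse_step_def)
      qed
    qed
  qed
qed simp

lemma parses_list:
  assumes p: "parses p e"
  shows "parses (parse_list p) (enc_list e)"
  unfolding parses_def
proof (intro allI iffI)
  fix w xs r
  obtain xs' r' go ok where s: "(parse_step p ^^ length w) ([], w, True, False) = (xs', r', go, ok)"
    by (metis prod_cases4)
  {
    assume "parse_list p w = Some (xs, r)"
    then show "w = enc_list e xs @ r"
      using s parse_steps_invariant[OF p s] by (auto simp: parse_list_def foldl_const Let_def split: if_splits)
  next
    assume w: "w = enc_list e xs @ r"
    have "(parse_step p ^^ length w) ([], enc_list e xs @ r, True, False) = ([] @ xs, r, False, True)"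
      by (rule parse_steps_enc_list[OF p]) (use length_enc_list[of xs e] w in simp)
    then show "parse_list p w = Some (xs, r)"
      using w by (simp add: parse_list_def foldl_const)
  }
qed

text \<open>Tests and projections instead of patterns keep the definition within the closure rules.
  \<open>num2\<close> is arbitrary if \<open>num = None\<close>, but then it cannot influence the
  result.\<close>

definition parse_gate :: "bool list \<Rightarrow> (gate \<times> bool list) option" where
  "parse_gate w =
     (let r = drop 3 w; num = parse_nat r; num2 = parse_nat (snd (the num)) in
      if length w < 3 then None
      else if hd w then
        (if hd (tl w) \<or> hd (tl (tl w)) \<or> num = None \<or> num2 = None then None
         else Some (Or (fst (the num)) (fst (the num2)), snd (the num2)))
      else if hd (tl w) then
        (if hd (tl (tl w)) then
           (if num = None \<or> num2 = None then None
            else Some (And (fst (the num)) (fst (the num2)), snd (the num2)))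
         else if num = None then None else Some (Not (fst (the num)), snd (the num)))
      else if hd (tl (tl w)) then (if r = [] then None else Some (Const (hd r), tl r))
      else if num = None then None else Some (In (fst (the num)), snd (the num)))"

lemma parses_gate: "parses parse_gate enc_gate"
  unfolding parses_def
proof (intro allI iffI)
  fix w g r
  note nat1 [simp] = parsesD1[OF parses_nat] and nat2 = parsesD2[OF parses_nat]
  show "w = enc_gate g @ r \<Longrightarrow> parse_gate w = Some (g, r)"
    by (cases g) (auto simp: parse_gate_def Let_def eval_nat_numeral)
  show "parse_gate w = Some (g, r) \<Longrightarrow> w = enc_gate g @ r"
  proof -
    assume *: "parse_gate w = Some (g, r)"
    then have "\<not> length w < 3"
      by (auto simp: parse_gate_def)
    then obtain a b c v where w: "w = a # b # c # v"
      by (auto simp: not_less eval_nat_numeral Suc_le_length_iff)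
    note * = *[unfolded w]
    have nat3: "u = enc_nat (fst q) @ snd q" if "parse_nat u = Some q" for u q
      using nat2[of u "fst q" "snd q"] that by simp
    show ?thesis
    proof (cases "parse_nat v")
      case None
      then show ?thesis
        using * unfolding w by (cases a; cases b; cases c) (auto simp: parse_gate_def split: if_splits)
    next
      case q: (Some q)
      note nat3(1)[OF q, symmetric, simp]
      show ?thesis
      proof (cases "parse_nat (snd q)")
        case None
        then show ?thesis
          using * q unfolding w by (cases a; cases b; cases c) (auto simp: parse_gate_def split: if_splits)
      next
        case q': (Some q')
        note nat3(1)[OF q', symmetric, simp]
        show ?thesis
          using * q q' unfolding w by (cases a; cases b; cases c) (auto simp: parse_gate_def split: if_splits)
      qed
    qed
  qed
qed

type_synonym triple = "nat \<times> gate list \<times> nat list"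

text \<open>Triples stand in for the record because products of data types already have a
  code.\<close>

definition circuit_of :: "triple \<Rightarrow> circuit" where
  "circuit_of t = \<lparr>num_inputs = fst t, gates = fst (snd t), outputs = snd (snd t)\<rparr>"

definition parse_circuit :: "bool list \<Rightarrow> (triple \<times> bool list) option" where
  "parse_circuit w =
     (case parse_nat w of None \<Rightarrow> None | Some a \<Rightarrow>
       (case parse_list parse_gate (snd a) of None \<Rightarrow> None | Some b \<Rightarrow>
         (case parse_list parse_nat (snd b) of None \<Rightarrow> None | Some c \<Rightarrow>
           Some ((fst a, fst b, fst c), snd c))))"

lemma parses_circuit: "parses parse_circuit (\<lambda>t. enc_circuit (circuit_of t))"
  unfolding parses_def
proof (intro allI iffI)
  fix w t r
  note D1 [simp] = parsesD1[OF parses_nat] parsesD1[OF parses_list[OF parses_gate]] parsesD1[OF parses_list[OF parses_nat]]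
    and D2 = parsesD2[OF parses_nat] parsesD2[OF parses_list[OF parses_gate]] parsesD2[OF parses_list[OF parses_nat]]
  show "w = enc_circuit (circuit_of t) @ r \<Longrightarrow> parse_circuit w = Some (t, r)"
    by (simp add: enc_circuit_def circuit_of_def parse_circuit_def)
  show "parse_circuit w = Some (t, r) \<Longrightarrow> w = enc_circuit (circuit_of t) @ r"
    by (auto simp: enc_circuit_def circuit_of_def parse_circuit_def split: option.splits dest!: D2)
qed

subsection \<open>The reduction is computable in polynomial time\<close>

instantiation gate :: data
begin

text \<open>Tagged tuples reduce the construction and analysis of gates to operations on numbers and
  pairs.\<close>

fun gate_tuple :: "gate \<Rightarrow> nat \<times> nat \<times> nat" where
  "gate_tuple (In i) = (0, i, 0)"
| "gate_tuple (Const b) = (1, if b then 1 else 0, 0)"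
| "gate_tuple (Not i) = (2, i, 0)"
| "gate_tuple (And i j) = (3, i, j)"
| "gate_tuple (Or i j) = (4, i, j)"

definition code_gate :: "gate \<Rightarrow> bool list" where
  "code_gate g = code (gate_tuple g)"

instance ..

end

lemma FP_gate_tuple [FP_intros]:
  assumes "FP g"
  shows "FP (\<lambda>x. gate_tuple (g x))"
  by (rule FPon_recode[OF assms, where \<phi> = "\<lambda>x. x"]) (simp add: code_gate_def)

lemma FP_of_gate_tuple:
  assumes "FP t" "\<And>x. gate_tuple (g x) = t x"
  shows "FP g"
  by (rule FPon_recode[OF assms(1), where \<phi> = "\<lambda>x. x"]) (simp add: code_gate_def assms(2))

lemma FP_In [FP_intros]:
  assumes "FP i" shows "FP (\<lambda>x. In (i x))"
  by (rule FP_of_gate_tuple[where t = "\<lambda>x. (0, i x, 0)"]) (intro FP_intros assms, simp)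

lemma FP_Const [FP_intros]:
  assumes "FP b" shows "FP (\<lambda>x. Const (b x))"
  by (rule FP_of_gate_tuple[where t = "\<lambda>x. (1, if b x then 1 else 0, 0)"]) (intro FP_intros assms, simp)

lemma FP_Not [FP_intros]:
  assumes "FP i" shows "FP (\<lambda>x. Not (i x))"
  by (rule FP_of_gate_tuple[where t = "\<lambda>x. (2, i x, 0)"]) (intro FP_intros assms, simp)

lemma FP_And [FP_intros]:
  assumes "FP i" "FP j" shows "FP (\<lambda>x. And (i x) (j x))"
  by (rule FP_of_gate_tuple[where t = "\<lambda>x. (3, i x, j x)"]) (intro FP_intros assms, simp)

lemma FP_Or [FP_intros]:
  assumes "FP i" "FP j" shows "FP (\<lambda>x. Or (i x) (j x))"
  by (rule FP_of_gate_tuple[where t = "\<lambda>x. (4, i x, j x)"]) (intro FP_intros assms, simp)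

lemma FP_reloc [FP_intros]:
  assumes "FP a" "FP b" "FP g"
  shows "FP (\<lambda>x. reloc (a x) (b x) (g x))"
proof -
  have "reloc a b g = (let t = gate_tuple g in
      if fst t = 0 then In (a + fst (snd t))
      else if fst t = 1 then Const (fst (snd t) = 1)
      else if fst t = 2 then Not (b + fst (snd t))
      else if fst t = 3 then And (b + fst (snd t)) (b + snd (snd t))
      else Or (b + fst (snd t)) (b + snd (snd t)))" for a b g
    by (cases g) auto
  then show ?thesis
    unfolding Let_def by (simp only:) (intro FP_intros assms)
qed

lemma FP_wf_gate [FP_intros]:
  assumes "FP n" "FP k" "FP g"
  shows "FP (\<lambda>x. wf_gate (n x) (k x) (g x))"
proof -
  have "wf_gate n k g = (let t = gate_tuple g in
      if fst t = 0 then fst (snd t) < n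
      else if fst t = 1 then True
      else if fst t = 2 then fst (snd t) < k
      else fst (snd t) < k \<and> snd (snd t) < k)" for n k g
    by (cases g) auto
  then show ?thesis
    unfolding Let_def by (simp only:) (intro FP_intros assms)
qed

lemma FP_enc_nat [FP_intros]: "FP k \<Longrightarrow> FP (\<lambda>x. enc_nat (k x))"
  unfolding enc_nat_def by (intro FP_intros)

lemma FP_enc_gate [FP_intros]:
  assumes "FP g"
  shows "FP (\<lambda>x. enc_gate (g x))"
proof -
  have "enc_gate g = (let t = gate_tuple g; k = enc_nat (fst (snd t)) in
      if fst t = 0 then [False, False, False] @ k
      else if fst t = 1 then [False, False, True, fst (snd t) = 1]
      else if fst t = 2 then [False, True, False] @ k
      else if fst t = 3 then [False, True, True] @ k @ enc_nat (snd (snd t))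
      else [True, False, False] @ k @ enc_nat (snd (snd t)))" for g
    by (cases g) auto
  then show ?thesis
    unfolding Let_def by (simp only:) (intro FP_intros assms)
qed

lemma FP_enc_list [FP_intros]:
  assumes "FP (\<lambda>p. e (fst p) (snd p))" "FP l"
  shows "FP (\<lambda>x. enc_list (e x) (l x))"
  unfolding enc_list_def by (intro FP_intros assms)

text \<open>The word is both the argument and the counter: no more heads have to be removed than it
  has bits, and \<open>F\<close> is idle once the head is \<open>False\<close> or nothing is
  left.\<close>

lemma FP_dropWhile_id [FP_intros]:
  assumes w: "FP w"
  shows "FP (\<lambda>x. dropWhile id (w x))"
proof -
  define F where "F s u = (if s \<noteq> [] \<and> hd s then tl s else s)" for s :: "bool list" and u :: bool
  have stop: "foldl F (False # s) l = False # s" "foldl F [] l = []" for s l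
    by (induction l) (simp_all add: F_def)
  have "length s \<le> length l \<Longrightarrow> foldl F s l = dropWhile id s" for s l
  proof (induction l arbitrary: s)
    case (Cons u l)
    show ?case
    proof (cases s)
      case s: (Cons b s')
      have "F (True # s') u = s'" "F (False # s') u = False # s'"
        by (simp_all add: F_def)
      then show ?thesis
        using Cons.IH[of s'] Cons.prems s stop(1) by (cases b) simp_all
    qed (use stop(2)[of "u # l"] in simp)
  qed simp
  then have eq: "dropWhile id (w x) = foldl F (w x) (w x)" for x
    by simp
  have "csz (F s u) \<le> csz s" for s u
    by (cases s) (simp_all add: F_def)
  then have "FP (\<lambda>x. foldl F (w x) (w x))"
  proof (intro FP_foldl_growth[where g = 0] w)
    show "FP (\<lambda>p :: 'a \<times> bool list \<times> bool. F (fst (snd p)) (snd (snd p)))"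
      unfolding F_def by (intro FP_intros)
  qed (simp add: trans_le_add1)
  then show ?thesis
    unfolding eq .
qed

lemma FP_parse_nat [FP_intros]: "FP w \<Longrightarrow> FP (\<lambda>x. parse_nat (w x))"
  unfolding parse_nat_def by (intro FP_intros)

text \<open>The size of a parsed element is controlled by the unread input, which is part of the
  accumulator, so \<open>FP_foldl_growth\<close> does not apply. By \<open>parses p e\<close> the
  unread input never gets longer, hence all elements obey one bound in terms of the whole
  word.\<close>

lemma FP_parse_list:
  fixes p :: "bool list \<Rightarrow> ('a :: data \<times> bool list) option"
  assumes p: "FP p" and e: "parses p e" and w: "FP w"
  shows "FP (\<lambda>x. parse_list p (w x))"
proof (rule FP_comp[OF _ w])
  obtain q where q: "\<And>w. csz (p w) \<le> poly q (csz w)"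
    using FP_size[OF p] by auto
  \<comment> \<open>At most \<open>n\<close> quoted elements, the unread input and the two flags;
    the factors 2 and the constants come from the quoting of the components of the state.\<close>
  define T where "T n = 2 * (n * (2 * poly q n + 1)) + 1 + (2 * n + 1 + 4)" for n
  have rest: "length (snd a) \<le> length w" and elem: "csz (fst a) \<le> poly q (csz w)" if "p w = Some a" for w a
  proof -
    show "length (snd a) \<le> length w"
      using parsesD2[OF e, of w "fst a" "snd a"] that by simp
    show "csz (fst a) \<le> poly q (csz w)"
      using q[of w] that by (cases a) simp
  qed
  have step: "FP (\<lambda>y :: bool list \<times> ('a list \<times> bool list \<times> bool \<times> bool) \<times> bool. parse_step p (fst (snd y)))"
    unfolding parse_step_def by (intro FP_intros FP_comp[OF p])
  have size: "csz (foldl (\<lambda>s u. parse_step p s) ([], w, True, False) (take i w)) \<le> T (csz w)" for i w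
  proof -
    define k where "k = length (take i w)"
    have "length (fst (snd ((parse_step p ^^ k) ([], w, True, False)))) \<le> length w \<and>
        csz (fst ((parse_step p ^^ k) ([], w, True, False))) \<le> k * (2 * poly q (csz w) + 1)" for k
    proof (induction k)
      case (Suc k)
      obtain xs v go ok where s: "(parse_step p ^^ k) ([], w, True, False) = (xs, v, go, ok)"
        by (metis prod_cases4)
      have IH: "length v \<le> length w" "csz xs \<le> k * (2 * poly q (csz w) + 1)"
        using Suc.IH s by simp_all
      have "length (snd a) \<le> length w \<and> csz (fst a) \<le> poly q (csz w)" if "p (tl v) = Some a" for a
      proof -
        have "length (tl v) \<le> length w"
          using IH(1) by simp
        moreover from this have "poly q (csz (tl v)) \<le> poly q (csz w)"
          by (intro poly_mono_nat) (simp add: csz_word)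
        ultimately show ?thesis
          using rest[OF that] elem[OF that] by linarith
      qed
      then have "length (fst (snd (parse_step p (xs, v, go, ok)))) \<le> length w \<and>
          csz (fst (parse_step p (xs, v, go, ok))) \<le> csz xs + (2 * poly q (csz w) + 1)"
        using IH(1) by (cases "p (tl v)") (auto simp: parse_step_def intro: le_trans[OF diff_le_self])
      then show ?case
        using IH(2) s by simp
    qed simp
    from this[of k] obtain xs v go ok where s: "(parse_step p ^^ k) ([], w, True, False) = (xs, v, go, ok)"
      and *: "length v \<le> length w" "csz xs \<le> k * (2 * poly q (csz w) + 1)"
      by (metis fst_conv prod_cases4 snd_conv)
    have "k \<le> csz w"
      by (simp add: k_def csz_word)
    then have "k * (2 * poly q (csz w) + 1) \<le> csz w * (2 * poly q (csz w) + 1)"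
      by (rule mult_le_mono1)
    moreover have "csz v \<le> csz w"
      using *(1) by (simp add: csz_word)
    ultimately have "csz (xs, v, go, ok) \<le> T (csz w)"
      using *(2) unfolding T_def by simp
    then show ?thesis
      unfolding foldl_const s[symmetric] k_def .
  qed
  have "pbounded T"
    unfolding T_def by (intro pbounded_intros)
  from FP_foldl[OF step _ _ this size]
  have "FP (\<lambda>w. foldl (\<lambda>s u. parse_step p s) ([], w, True, False) w)"
    by (simp add: FP_Pair FP_const FP_id)
  then show "FP (parse_list p)"
    unfolding parse_list_def Let_def by (intro FP_intros)
qed

lemma FP_parse_gate [FP_intros]: "FP w \<Longrightarrow> FP (\<lambda>x. parse_gate (w x))"
  unfolding parse_gate_def Let_def by (intro FP_intros)

lemma FP_parse_circuit [FP_intros]: "FP w \<Longrightarrow> FP (\<lambda>x. parse_circuit (w x))"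
  unfolding parse_circuit_def
  by (intro FP_intros FP_parse_list[OF _ parses_gate] FP_parse_list[OF _ parses_nat])

section \<open>Validity check and construction of the circuit\<close>

definition valid_triples :: "triple list \<Rightarrow> bool" where
  "valid_triples ts \<longleftrightarrow> ts \<noteq> [] \<and>
     list_all (\<lambda>t. fst t = fst (hd ts) \<and> length (snd (snd t)) = fst (hd ts) \<and>
       list_all (\<lambda>k. wf_gate (fst t) k (hd (drop k (fst (snd t))))) [0..<length (fst (snd t))] \<and>
       list_all (\<lambda>k. k < length (fst (snd t))) (snd (snd t))) ts"

lemma FP_valid_triples [FP_intros]: "FP ts \<Longrightarrow> FP (\<lambda>x. valid_triples (ts x))"
  by (rule FP_comp) (unfold valid_triples_def, intro FP_intros)

lemma valid_triples_iff: "valid_triples ts \<longleftrightarrow> valid_circuits (map circuit_of ts)"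
proof -
  have "list_all (\<lambda>k. wf_gate (fst t) k (hd (drop k (fst (snd t))))) [0..<length (fst (snd t))] \<longleftrightarrow>
      (\<forall>k < length (fst (snd t)). wf_gate (fst t) k (fst (snd t) ! k))" for t :: triple
    by (auto simp: list_all_iff hd_drop_conv_nth)
  then show ?thesis
    by (auto simp: valid_triples_def valid_circuits_def list_all_iff circuit_of_def is_circuit_def
        wf_circuit_def hd_map)
qed

definition triple_blocks :: "triple list \<Rightarrow> gate list list" where
  "triple_blocks ts = concat (map (\<lambda>t.
     [cmp_block False (fst t) (fst (snd t)) (snd (snd t)), cmp_block True (fst t) (fst (snd t)) (snd (snd t))]) ts)"

lemma triple_blocks: "tournament_blocks (map circuit_of ts) = triple_blocks ts"
  by (simp add: tournament_blocks_def triple_blocks_def circuit_of_def comp_def)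

lemma FP_cmp_block [FP_intros]:
  assumes "FP b" "FP n" "FP gs" "FP os"
  shows "FP (\<lambda>x. cmp_block (b x) (n x) (gs x) (os x))"
proof -
  have "FP (\<lambda>y :: bool \<times> triple. cmp_block (fst y) (fst (snd y)) (fst (snd (snd y))) (snd (snd (snd y))))"
    unfolding cmp_block_def cmp_stage_def Let_def by (intro FP_intros)
  from FP_comp[OF this, of UNIV "\<lambda>x. (b x, n x, gs x, os x)"] show ?thesis
    using assms by (simp add: FP_Pair)
qed

lemma FP_triple_blocks [FP_intros]: "FP ts \<Longrightarrow> FP (\<lambda>x. triple_blocks (ts x))"
  unfolding triple_blocks_def by (intro FP_intros)

lemma FP_link [FP_intros]: "FP Bs \<Longrightarrow> FP (\<lambda>x. link (Bs x))"
  by (rule FP_comp) (unfold link_def, intro FP_intros)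

lemma FP_last_pos [FP_intros]: "FP Bs \<Longrightarrow> FP i \<Longrightarrow> FP (\<lambda>x. last_pos (Bs x) (i x))"
  unfolding last_pos_def by (intro FP_intros)

lemma FP_cell_pos [FP_intros]:
  "FP N \<Longrightarrow> FP W \<Longrightarrow> FP k \<Longrightarrow> FP j \<Longrightarrow> FP (\<lambda>x. cell_pos (N x) (W x) (k x) (j x))"
  unfolding cell_pos_def by (intro FP_intros)

text \<open>The parameter \<open>ps\<close> of \<open>threshold\<close> is a function and has no
  code. The instance \<open>last_pos Bs\<close> is determined by the list \<open>Bs\<close>, which
  has one.\<close>

lemma FP_tournament_gates:
  "FP (\<lambda>y :: gate list list \<times> nat \<times> nat \<times> nat.
    threshold (fst (snd y)) (fst (snd (snd y))) (snd (snd (snd y))) (last_pos (fst y)))"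
  unfolding threshold_def cell_def by (intro FP_intros)

text \<open>The empty list is singled out because \<open>hd []\<close> for circuits is unrelated to
  \<open>hd []\<close> for triples.\<close>

definition encode_tournament :: "triple list \<Rightarrow> bool list" where
  "encode_tournament ts = (if ts = [] then [] else enc_circuit (tournament_circuit (map circuit_of ts)))"

lemma FP_encode_tournament: "FP encode_tournament"
proof -
  let ?Bs = triple_blocks and ?W = "\<lambda>ts :: triple list. Suc (length ts)"
    and ?M = "\<lambda>ts :: triple list. 2 * length ts"
  let ?N = "\<lambda>ts. length (link (?Bs ts))"
  have "FP (\<lambda>ts. threshold (?N ts) (?W ts) (?M ts) (last_pos (?Bs ts)))"
  proof -
    have "FP (\<lambda>ts. (?Bs ts, ?N ts, ?W ts, ?M ts))"
      by (intro FP_intros)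
    from FP_comp[OF FP_tournament_gates this] show ?thesis
      by simp
  qed
  then have "FP (\<lambda>ts. if ts = [] then [] else enc_nat (2 * fst (hd ts)) @
      enc_list enc_gate (link (?Bs ts) @ threshold (?N ts) (?W ts) (?M ts) (last_pos (?Bs ts))) @
      enc_list enc_nat [cell_pos (?N ts) (?W ts) (?M ts) (?W ts) + 1])"
    by (intro FP_intros)
  then show ?thesis
  proof (rule FPon_cong)
    fix ts :: "triple list"
    have "num_inputs (hd (map circuit_of ts)) = fst (hd ts)" if "ts \<noteq> []"
      using that by (simp add: hd_map circuit_of_def)
    then show "(if ts = [] then [] else enc_nat (2 * fst (hd ts)) @
        enc_list enc_gate (link (?Bs ts) @ threshold (?N ts) (?W ts) (?M ts) (last_pos (?Bs ts))) @
        enc_list enc_nat [cell_pos (?N ts) (?W ts) (?M ts) (?W ts) + 1]) =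
      encode_tournament ts"
      by (simp add: encode_tournament_def enc_circuit_def tournament_circuit_def triple_blocks Let_def)
  qed
qed

section \<open>The reduction and its correctness\<close>

definition reduction :: "bool list \<Rightarrow> bool list" where
  "reduction w =
     (case parse_list parse_circuit w of None \<Rightarrow> [] | Some p \<Rightarrow>
       (if snd p = [] \<and> valid_triples (fst p)
        then encode_tournament (fst p) else []))"

lemma FP_reduction: "FP reduction"
proof -
  have "FP (\<lambda>y :: bool list \<times> triple list \<times> bool list. fst (snd y))"
    by (intro FP_intros)
  from FP_comp[OF FP_encode_tournament this] show ?thesis
    unfolding reduction_def by (intro FP_intros FP_parse_list[OF _ parses_circuit])
qed

text \<open>A word is either the encoding of a valid list, which the parser recovers with nothing
  left over, or lies outside \<open>Ckt_Condorcet\<close> and is sent to \<open>[]\<close>. Trailing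
  bits after a valid list are caught by the test \<open>snd p = []\<close>.\<close>

lemma reduction_correct: "w \<in> Ckt_Condorcet \<longleftrightarrow> reduction w \<in> Weak_Tournament_Source"
proof (cases "\<exists>ts. w = enc_list enc_circuit (map circuit_of ts) \<and> valid_circuits (map circuit_of ts)")
  case True
  then obtain ts where w: "w = enc_list enc_circuit (map circuit_of ts)" and valid: "valid_circuits (map circuit_of ts)"
    by blast
  have "enc_list (\<lambda>t. enc_circuit (circuit_of t)) ts = w"
    by (simp add: w enc_list_def comp_def)
  then have "parse_list parse_circuit w = Some (ts, [])"
    using parsesD1[OF parses_list[OF parses_circuit], of ts "[]"] by simp
  moreover have "ts \<noteq> []"
    using valid by (auto simp: valid_circuits_def)
  ultimately have "reduction w = enc_circuit (tournament_circuit (map circuit_of ts))"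
    using valid by (simp add: reduction_def valid_triples_iff encode_tournament_def)
  then show ?thesis
    using tournament_in_WTS_iff[of "map circuit_of ts"] valid unfolding valid_circuits_def w
    by auto
next
  case False
  have "w \<notin> Ckt_Condorcet"
  proof
    assume "w \<in> Ckt_Condorcet"
    then obtain Cs n where w: "w = enc_list enc_circuit Cs" and Cs: "Cs \<noteq> []" "\<forall>C \<in> set Cs. is_circuit n n C"
      unfolding Ckt_Condorcet_def by blast
    have "circuit_of (num_inputs C, gates C, outputs C) = C" for C
      by (simp add: circuit_of_def)
    then have "map circuit_of (map (\<lambda>C. (num_inputs C, gates C, outputs C)) Cs) = Cs"
      by (simp add: comp_def)
    then obtain ts where "Cs = map circuit_of ts"
      by metis
    moreover have "valid_circuits Cs"
      using Cs num_inputs_hd[OF Cs] by (simp add: valid_circuits_def)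
    ultimately show False
      using False w by blast
  qed
  moreover have "reduction w = []"
  proof (cases "parse_list parse_circuit w")
    case (Some p)
    then have "w = enc_list (\<lambda>t. enc_circuit (circuit_of t)) (fst p) @ snd p"
      using parsesD2[OF parses_list[OF parses_circuit], of w "fst p" "snd p"] by simp
    then have "\<not> (snd p = [] \<and> valid_triples (fst p))"
      using False by (auto simp: enc_list_def comp_def valid_triples_iff)
    then show ?thesis
      using Some by (auto simp: reduction_def)
  qed (simp add: reduction_def)
  moreover have "[] \<notin> Weak_Tournament_Source"
    by (auto simp: Weak_Tournament_Source_def enc_circuit_def enc_nat_def)
  ultimately show ?thesis
    by simp
qed

theorem theorem4p2: "PCW \<subseteq> PTW"
proof -
  have "Ckt_Condorcet \<le>\<^sub>P Weak_Tournament_Source"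
    unfolding poly_reducible_def
    using FP_polytime_computable[OF FP_reduction] reduction_correct by blast
  then show ?thesis
    unfolding PCW_def PTW_def using poly_reducible_trans by blast
qed

end
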